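(* Let $m,n\geq 1$ be integers, let $\Phi : M_n\to M_n$ be a Hermiticity-preserving linear map, and let $x>0$ be a real scalar. Let $\ell(\Phi)=\min\{\mathrm{Tr}(\Phi(\rho)) : \rho\in M_n \text{ a density matrix}\}$. Then \[ \nu_m(\Phi^* ) \leq \left\lceil \frac{mn\,(x + d_m(x\Delta,\Phi) - \ell(\Phi))}{2x}\right\rceil - 1. \] In particular, \[ \nu(\Phi^* ) \leq \frac{n\,(x + d_\diamond(x\Delta,\Phi)-\ell(\Phi))}{2x}. \]
   Context: $M_n$ is the set of $n\times n$ complex matrices. A density matrix is a positive semidefinite matrix with trace $1$. $A\succeq O$ means that $A$ is positive semidefinite. A linear map $\Phi$ on $M_n$ is Hermiticity-preserving if it sends Hermitian matrices to Hermitian matrices; its adjoint $\Phi^*$ is defined by $\mathrm{Tr}(X\Phi(Y))=\mathrm{Tr}(\Phi^*(X)Y)$ for all Hermitian $X,Y$. $I_m\otimes\Phi$ acts as the identity map on $M_m$ tensored with $\Phi$. The support of a Hermitian matrix is its range. For a Hermiticity-preserving linear map $\Psi$ on $M_n$, $\nu_m(\Psi)$ is the maximum of $\dim(\mathcal{S})$ over all subspaces $\mathcal{S}\subseteq\mathbb{C}^m\otimes\mathbb{C}^n$ such that $(I_m\otimes\Psi)(\rho)\not\succeq O$ for every density matrix $\rho\in M_m\otimes M_n$ with support contained in $\mathcal{S}$; and $\nu(\Psi)=\lim_{m\to\infty}\nu_m(\Psi)/m$ (this limit always exists). $\Delta : M_n\to M_n$ is the completely depolarizing map $\Delta(X)=\mathrm{Tr}(X)I/n$.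 The trace norm $\|X\|_1$ is the sum of the singular values of $X$. For a linear map $\Psi$ on $M_n$, $\|\Psi\|_m = \max\{\|(I_m\otimes\Psi)(X)\|_1 : X\in M_m\otimes M_n,\ \|X\|_1\leq 1\}$. This is the same for all $m\geq n$, and that common value is the diamond norm $\|\Psi\|_\diamond$. Finally $d_m(\Psi_1,\Psi_2)=\|\Psi_1-\Psi_2\|_m$ and $d_\diamond(\Psi_1,\Psi_2)=\|\Psi_1-\Psi_2\|_\diamond$.
   Formalization: The first bound is replaced by the maximum of 0 and the stated right-hand side, since for Φ = xΔ the stated one equals −1 while ν_m ≥ 0; whenever x + d_m(xΔ,Φ) − ℓ(Φ) > 0 the bound is unchanged. *)

theory Defs
  imports Complex_Main "Jordan_Normal_Form.Schur_Decomposition"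
begin

section \<open>Matrices\<close>

definition mat_trace :: "complex mat \<Rightarrow> complex" where
  "mat_trace A = (\<Sum>i<dim_row A. A $$ (i, i))"

definition hermitian_mat :: "nat \<Rightarrow> complex mat \<Rightarrow> bool" where
  "hermitian_mat N A \<longleftrightarrow> A \<in> carrier_mat N N \<and> mat_adjoint A = A"

definition psd_mat :: "nat \<Rightarrow> complex mat \<Rightarrow> bool" where
  "psd_mat N A \<longleftrightarrow> hermitian_mat N A \<and> (\<forall>v \<in> carrier_vec N. 0 \<le> Re ((A *\<^sub>v v) \<bullet>c v))"

definition density_matrix :: "nat \<Rightarrow> complex mat \<Rightarrow> bool" where
  "density_matrix N \<rho> \<longleftrightarrow> psd_mat N \<rho> \<and> mat_trace \<rho> = 1"

definition mat_support :: "complex mat \<Rightarrow> complex vec set" where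
  "mat_support A = (\<lambda>v. A *\<^sub>v v) ` carrier_vec (dim_col A)"

text \<open>Singular values with multiplicity: square roots of the eigenvalues of
  the (positive semidefinite) matrix \<open>A\<^sup>* A\<close>.\<close>

definition singular_values :: "complex mat \<Rightarrow> real multiset" where
  "singular_values A = image_mset (\<lambda>z. sqrt (Re z)) (proots (char_poly (mat_adjoint A * A)))"

definition trace_norm :: "complex mat \<Rightarrow> real" where
  "trace_norm A = \<Sum>\<^sub># (singular_values A)"

section \<open>Linear maps on matrices\<close>

text \<open>A map on $M_n$ is a function on the type of all matrices, of which only the
  restriction to \<open>carrier_mat n n\<close> is meaningful.\<close>

definition mat_linear_map :: "nat \<Rightarrow> (complex mat \<Rightarrow> complex mat) \<Rightarrow> bool" where
  "mat_linear_map n \<Phi> \<longleftrightarrow>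
     linear_map class_ring (module_mat TYPE(complex) n n) (module_mat TYPE(complex) n n) \<Phi>"

definition hermiticity_preserving :: "nat \<Rightarrow> (complex mat \<Rightarrow> complex mat) \<Rightarrow> bool" where
  "hermiticity_preserving n \<Phi> \<longleftrightarrow> (\<forall>X. hermitian_mat n X \<longrightarrow> hermitian_mat n (\<Phi> X))"

definition is_adjoint_map ::
  "nat \<Rightarrow> (complex mat \<Rightarrow> complex mat) \<Rightarrow> (complex mat \<Rightarrow> complex mat) \<Rightarrow> bool" where
  "is_adjoint_map n \<Phi> \<Psi> \<longleftrightarrow> mat_linear_map n \<Psi> \<and>
     (\<forall>X Y. hermitian_mat n X \<longrightarrow> hermitian_mat n Y \<longrightarrow>
        mat_trace (X * \<Phi> Y) = mat_trace (\<Psi> X * Y))"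

text \<open>The choice is immaterial: for linear \<open>\<Phi>\<close> an adjoint exists and is unique on
  \<open>carrier_mat n n\<close>; see \<open>is_adjoint_map_adjoint_map\<close> and \<open>is_adjoint_map_unique\<close> below.\<close>

definition adjoint_map :: "nat \<Rightarrow> (complex mat \<Rightarrow> complex mat) \<Rightarrow> complex mat \<Rightarrow> complex mat" where
  "adjoint_map n \<Phi> = (SOME \<Psi>. is_adjoint_map n \<Phi> \<Psi>)"

text \<open>$\mathbb{C}^m \otimes \mathbb{C}^n$ is identified with $\mathbb{C}^{mn}$ by
  $e_i \otimes e_k \mapsto e_{in+k}$ (indices from 0), so that $M_m \otimes M_n$ consists of
  $m \times m$ block matrices with blocks in $M_n$.\<close>

definition mat_block :: "nat \<Rightarrow> complex mat \<Rightarrow> nat \<Rightarrow> nat \<Rightarrow> complex mat" where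
  "mat_block n X i j = mat n n (\<lambda>(k, l). X $$ (i * n + k, j * n + l))"

definition kron :: "nat \<Rightarrow> nat \<Rightarrow> complex mat \<Rightarrow> complex mat \<Rightarrow> complex mat" where
  "kron m n A B = mat (m * n) (m * n) (\<lambda>(r, c). A $$ (r div n, c div n) * B $$ (r mod n, c mod n))"

text \<open>$I_m \otimes \Psi$ applies \<open>\<Psi>\<close> to every block; lemma \<open>id_tensor_kron\<close> gives
  its values on elementary tensors.\<close>

definition id_tensor ::
  "nat \<Rightarrow> nat \<Rightarrow> (complex mat \<Rightarrow> complex mat) \<Rightarrow> complex mat \<Rightarrow> complex mat" where
  "id_tensor m n \<Psi> X =
     mat (m * n) (m * n) (\<lambda>(r, c). \<Psi> (mat_block n X (r div n) (c div n)) $$ (r mod n, c mod n))"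

definition depolarizing :: "nat \<Rightarrow> complex mat \<Rightarrow> complex mat" where
  "depolarizing n X = (mat_trace X / of_nat n) \<cdot>\<^sub>m 1\<^sub>m n"

text \<open>The minimum of a continuous function on a compact set, written as an infimum.\<close>

definition min_output_trace :: "nat \<Rightarrow> (complex mat \<Rightarrow> complex mat) \<Rightarrow> real" where
  "min_output_trace n \<Phi> = Inf {Re (mat_trace (\<Phi> \<rho>)) | \<rho>. density_matrix n \<rho>}"

section \<open>Norms\<close>

text \<open>Again the supremum is a maximum, by compactness.\<close>

definition map_norm :: "nat \<Rightarrow> nat \<Rightarrow> (complex mat \<Rightarrow> complex mat) \<Rightarrow> real" where
  "map_norm m n \<Psi> = Sup {trace_norm (id_tensor m n \<Psi> X) | X.
     X \<in> carrier_mat (m * n) (m * n) \<and> trace_norm X \<le> 1}"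

text \<open>\<open>map_norm m n \<Psi>\<close> is the same for all \<open>m \<ge> n\<close>.\<close>

definition diamond_norm :: "nat \<Rightarrow> (complex mat \<Rightarrow> complex mat) \<Rightarrow> real" where
  "diamond_norm n \<Psi> = map_norm n n \<Psi>"

definition map_dist ::
  "nat \<Rightarrow> nat \<Rightarrow> (complex mat \<Rightarrow> complex mat) \<Rightarrow> (complex mat \<Rightarrow> complex mat) \<Rightarrow> real" where
  "map_dist m n \<Psi>1 \<Psi>2 = map_norm m n (\<lambda>X. \<Psi>1 X - \<Psi>2 X)"

definition diamond_dist ::
  "nat \<Rightarrow> (complex mat \<Rightarrow> complex mat) \<Rightarrow> (complex mat \<Rightarrow> complex mat) \<Rightarrow> real" where
  "diamond_dist n \<Psi>1 \<Psi>2 = diamond_norm n (\<lambda>X. \<Psi>1 X - \<Psi>2 X)"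

section \<open>Subspaces of states mapped outside the positive semidefinite cone\<close>

abbreviation vec_subspace :: "nat \<Rightarrow> complex vec set \<Rightarrow> bool" where
  "vec_subspace N S \<equiv> VectorSpace.subspace class_ring S (module_vec TYPE(complex) N)"

abbreviation vec_subspace_dim :: "nat \<Rightarrow> complex vec set \<Rightarrow> nat" where
  "vec_subspace_dim N S \<equiv> vectorspace.dim class_ring (module_vec TYPE(complex) N\<lparr>carrier := S\<rparr>)"

definition non_psd_subspace ::
  "nat \<Rightarrow> nat \<Rightarrow> (complex mat \<Rightarrow> complex mat) \<Rightarrow> complex vec set \<Rightarrow> bool" where
  "non_psd_subspace m n \<Psi> S \<longleftrightarrow> vec_subspace (m * n) S \<and>
     (\<forall>\<rho>. density_matrix (m * n) \<rho> \<and> mat_support \<rho> \<subseteq> S \<longrightarrow>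
        \<not> psd_mat (m * n) (id_tensor m n \<Psi> \<rho>))"

text \<open>The zero subspace supports no density matrix and always qualifies, so \<open>nu_m\<close> is the
  maximum of a nonempty set of dimensions (bounded by \<open>m * n\<close>), and is 0 when nothing else
  qualifies. For \<open>\<Phi> = x \<Delta>\<close> one has \<open>map_dist m n (x \<Delta>) \<Phi> = 0\<close> and \<open>min_output_trace n \<Phi> = x\<close>,
  so that a bound of the form $\lceil mn(x + d_m - \ell)/(2x) \rceil - 1$ is $-1$ while
  \<open>nu_m\<close> is 0; such a bound is therefore cut off at 0.\<close>

definition nu_m :: "nat \<Rightarrow> nat \<Rightarrow> (complex mat \<Rightarrow> complex mat) \<Rightarrow> nat" where
  "nu_m m n \<Psi> = Max {vec_subspace_dim (m * n) S | S. non_psd_subspace m n \<Psi> S}"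

definition nu :: "nat \<Rightarrow> (complex mat \<Rightarrow> complex mat) \<Rightarrow> real" where
  "nu n \<Psi> = lim (\<lambda>m. real (nu_m m n \<Psi>) / real m)"

section \<open>Checks of the encodings\<close>

lemma mat_linear_map_iff:
  "mat_linear_map n \<Phi> \<longleftrightarrow>
     (\<forall>X \<in> carrier_mat n n. \<Phi> X \<in> carrier_mat n n) \<and>
     (\<forall>X \<in> carrier_mat n n. \<forall>Y \<in> carrier_mat n n. \<Phi> (X + Y) = \<Phi> X + \<Phi> Y) \<and>
     (\<forall>a. \<forall>X \<in> carrier_mat n n. \<Phi> (a \<cdot>\<^sub>m X) = a \<cdot>\<^sub>m \<Phi> X)"
proof -
  interpret matrix_vs n n "TYPE(complex)" .
  show ?thesis
    unfolding mat_linear_map_def linear_map_def mod_hom_def mod_hom_axioms_def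
      LinearCombinations.module_hom_def
    using vectorspace_axioms module_axioms
    by (auto simp: module_mat_simps Pi_def)
qed

lemma id_tensor_kron:
  assumes "mat_linear_map n \<Phi>" "A \<in> carrier_mat m m" "B \<in> carrier_mat n n"
  shows "id_tensor m n \<Phi> (kron m n A B) = kron m n A (\<Phi> B)"
proof (cases "n = 0")
  case True
  then show ?thesis by (intro eq_matI) (auto simp: id_tensor_def kron_def)
next
  case False
  have blk: "mat_block n (kron m n A B) i j = A $$ (i, j) \<cdot>\<^sub>m B" if "i < m" "j < m" for i j
  proof (rule eq_matI)
    fix k l assume "k < dim_row (A $$ (i, j) \<cdot>\<^sub>m B)" "l < dim_col (A $$ (i, j) \<cdot>\<^sub>m B)"
    then have kl: "k < n" "l < n" using assms by auto
    have lt: "p * n + q < m * n" if "p < m" "q < n" for p q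
    proof -
      have "p * n + q < (p + 1) * n" using that by simp
      also have "\<dots> \<le> m * n" using that by (intro mult_le_mono1) auto
      finally show ?thesis .
    qed
    show "mat_block n (kron m n A B) i j $$ (k, l) = (A $$ (i, j) \<cdot>\<^sub>m B) $$ (k, l)"
      using kl that assms lt[OF that(1) kl(1)] lt[OF that(2) kl(2)]
      by (auto simp: mat_block_def kron_def)
  qed (use assms in \<open>auto simp: mat_block_def\<close>)
  show ?thesis
  proof (rule eq_matI)
    fix r c assume "r < dim_row (kron m n A (\<Phi> B))" "c < dim_col (kron m n A (\<Phi> B))"
    then have rc: "r < m * n" "c < m * n" by (auto simp: kron_def)
    then have d: "r div n < m" "c div n < m" by (auto simp: less_mult_imp_div_less)
    have "\<Phi> (A $$ (r div n, c div n) \<cdot>\<^sub>m B) = A $$ (r div n, c div n) \<cdot>\<^sub>m \<Phi> B"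
      "\<Phi> B \<in> carrier_mat n n"
      using assms unfolding mat_linear_map_iff by blast+
    then show "id_tensor m n \<Phi> (kron m n A B) $$ (r, c) = kron m n A (\<Phi> B) $$ (r, c)"
      using rc blk[OF d] False by (auto simp: id_tensor_def kron_def)
  qed (auto simp: id_tensor_def kron_def)
qed

lemma mat_trace_mult:
  assumes "A \<in> carrier_mat n n" "B \<in> carrier_mat n n"
  shows "mat_trace (A * B) = (\<Sum>i<n. \<Sum>j<n. A $$ (i, j) * B $$ (j, i))"
  using assms by (auto simp: mat_trace_def scalar_prod_def lessThan_atLeast0 intro!: sum.cong)

lemma mat_trace_add:
  "A \<in> carrier_mat n n \<Longrightarrow> B \<in> carrier_mat n n \<Longrightarrow> mat_trace (A + B) = mat_trace A + mat_trace B"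
  by (auto simp: mat_trace_def sum.distrib)

lemma mat_trace_smult: "A \<in> carrier_mat n n \<Longrightarrow> mat_trace (a \<cdot>\<^sub>m A) = a * mat_trace A"
  by (auto simp: mat_trace_def sum_distrib_left)

abbreviation unit_mat :: "nat \<Rightarrow> nat \<times> nat \<Rightarrow> complex mat" where
  "unit_mat n p \<equiv> mat n n (\<lambda>q. if q = p then 1 else 0)"

lemma linear_functional_expand:
  fixes f :: "complex mat \<Rightarrow> complex"
  assumes add: "\<And>X Y. X \<in> carrier_mat n n \<Longrightarrow> Y \<in> carrier_mat n n \<Longrightarrow> f (X + Y) = f X + f Y"
    and sm: "\<And>a X. X \<in> carrier_mat n n \<Longrightarrow> f (a \<cdot>\<^sub>m X) = a * f X"
    and Y: "Y \<in> carrier_mat n n"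
  shows "f Y = (\<Sum>p \<in> {..<n} \<times> {..<n}. Y $$ p * f (unit_mat n p))"
proof -
  have expand: "f (mat n n (\<lambda>p. if p \<in> S then Y $$ p else 0)) = (\<Sum>p \<in> S. Y $$ p * f (unit_mat n p))"
    if "finite S" for S
    using that
  proof (induction S rule: finite_induct)
    case empty
    have "mat n n (\<lambda>p. 0) = 0 \<cdot>\<^sub>m Y" using Y by (intro eq_matI) auto
    then show ?case using sm[OF Y, of 0] by simp
  next
    case (insert p S)
    have "mat n n (\<lambda>q. if q \<in> insert p S then Y $$ q else 0) =
      Y $$ p \<cdot>\<^sub>m unit_mat n p + mat n n (\<lambda>q. if q \<in> S then Y $$ q else 0)"
      using insert.hyps by (intro eq_matI) auto
    then show ?case
      using insert by (simp add: add sm)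
  qed
  have "mat n n (\<lambda>p. if p \<in> {..<n} \<times> {..<n} then Y $$ p else 0) = Y"
    using Y by (intro eq_matI) auto
  then show ?thesis using expand[of "{..<n} \<times> {..<n}"] by simp
qed

lemma is_adjoint_map_adjoint_map:
  assumes "mat_linear_map n \<Phi>"
  shows "is_adjoint_map n \<Phi> (adjoint_map n \<Phi>)"
proof -
  have \<Phi>: "\<Phi> X \<in> carrier_mat n n" if "X \<in> carrier_mat n n" for X
    using assms that by (auto simp: mat_linear_map_iff)
  define \<Psi> where "\<Psi> X = mat n n (\<lambda>(i, j). mat_trace (X * \<Phi> (unit_mat n (j, i))))" for X
  have lin: "mat_linear_map n \<Psi>"
    unfolding mat_linear_map_iff
  proof (intro conjI ballI allI)
    fix X Y :: "complex mat" assume "X \<in> carrier_mat n n" "Y \<in> carrier_mat n n"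
    then show "\<Psi> (X + Y) = \<Psi> X + \<Psi> Y"
      by (intro eq_matI)
        (auto simp: \<Psi>_def \<Phi> add_mult_distrib_mat[of _ n n _ _ n] mat_trace_add[of _ n])
  next
    fix a and X :: "complex mat" assume "X \<in> carrier_mat n n"
    then show "\<Psi> (a \<cdot>\<^sub>m X) = a \<cdot>\<^sub>m \<Psi> X"
      by (intro eq_matI)
        (auto simp: \<Psi>_def \<Phi> mult_smult_assoc_mat[of _ n n _ n] mat_trace_smult[of _ n])
  qed (auto simp: \<Psi>_def)
  have "mat_trace (X * \<Phi> Y) = mat_trace (\<Psi> X * Y)"
    if X: "X \<in> carrier_mat n n" and Y: "Y \<in> carrier_mat n n" for X Y
  proof -
    have "mat_trace (X * \<Phi> Y) =
        (\<Sum>p \<in> {..<n} \<times> {..<n}. Y $$ p * mat_trace (X * \<Phi> (unit_mat n p)))"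
    proof (rule linear_functional_expand[OF _ _ Y])
      fix A B :: "complex mat" assume "A \<in> carrier_mat n n" "B \<in> carrier_mat n n"
      then have "\<Phi> (A + B) = \<Phi> A + \<Phi> B" "\<Phi> A \<in> carrier_mat n n" "\<Phi> B \<in> carrier_mat n n"
        using assms by (auto simp: mat_linear_map_iff)
      then show "mat_trace (X * \<Phi> (A + B)) = mat_trace (X * \<Phi> A) + mat_trace (X * \<Phi> B)"
        using X by (simp add: mult_add_distrib_mat[of _ n n _ n] mat_trace_add[of _ n])
    next
      fix a and A :: "complex mat" assume "A \<in> carrier_mat n n"
      then have "\<Phi> (a \<cdot>\<^sub>m A) = a \<cdot>\<^sub>m \<Phi> A" "\<Phi> A \<in> carrier_mat n n"
        using assms by (auto simp: mat_linear_map_iff)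
      then show "mat_trace (X * \<Phi> (a \<cdot>\<^sub>m A)) = a * mat_trace (X * \<Phi> A)"
        using X by (simp add: mult_smult_distrib[of _ n n _ n] mat_trace_smult[of _ n])
    qed
    also have "\<dots> = (\<Sum>j<n. \<Sum>i<n. Y $$ (j, i) * mat_trace (X * \<Phi> (unit_mat n (j, i))))"
      by (simp add: sum.cartesian_product)
    also have "\<dots> = (\<Sum>i<n. \<Sum>j<n. Y $$ (j, i) * mat_trace (X * \<Phi> (unit_mat n (j, i))))"
      by (rule sum.swap)
    also have "\<dots> = mat_trace (\<Psi> X * Y)"
      using Y by (subst mat_trace_mult) (auto simp: \<Psi>_def intro!: sum.cong)
    finally show ?thesis .
  qed
  then have "is_adjoint_map n \<Phi> \<Psi>"
    using lin by (simp add: is_adjoint_map_def hermitian_mat_def)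
  then show ?thesis unfolding adjoint_map_def by (rule someI[where P = "is_adjoint_map n \<Phi>"])
qed

lemma hermitian_decomp:
  assumes "A \<in> carrier_mat n n"
  obtains H K where "hermitian_mat n H" "hermitian_mat n K" "A = H + \<i> \<cdot>\<^sub>m K"
proof
  let ?H = "mat n n (\<lambda>(i, j). (A $$ (i, j) + cnj (A $$ (j, i))) / 2)"
  let ?K = "mat n n (\<lambda>(i, j). - \<i> * (A $$ (i, j) - cnj (A $$ (j, i))) / 2)"
  have dec: "z = (z + w) / 2 + \<i> * (- \<i> * (z - w) / 2)" for z w :: complex
    by (simp add: complex_eq_iff field_simps)
  have cnj_K: "cnj (- \<i> * (z - cnj w) / 2) = - \<i> * (w - cnj z) / 2" for z w
    by (simp add: algebra_simps)
  show "hermitian_mat n ?H"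
    unfolding hermitian_mat_def
    by (auto intro!: eq_matI simp: mat_adjoint_def mat_of_rows_def complex_eq_iff)
  have "mat_adjoint ?K = ?K"
  proof (rule eq_matI)
    fix i j assume "i < dim_row ?K" "j < dim_col ?K"
    then show "mat_adjoint ?K $$ (i, j) = ?K $$ (i, j)"
      using cnj_K[of "A $$ (j, i)" "A $$ (i, j)"] by (simp add: mat_adjoint_def mat_of_rows_def)
  qed (simp_all add: mat_adjoint_def)
  then show "hermitian_mat n ?K" by (simp add: hermitian_mat_def)
  show "A = ?H + \<i> \<cdot>\<^sub>m ?K"
  proof (rule eq_matI)
    fix i j assume "i < dim_row (?H + \<i> \<cdot>\<^sub>m ?K)" "j < dim_col (?H + \<i> \<cdot>\<^sub>m ?K)"
    then show "A $$ (i, j) = (?H + \<i> \<cdot>\<^sub>m ?K) $$ (i, j)"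
      using dec[of "A $$ (i, j)" "cnj (A $$ (j, i))"] by simp
  qed (use assms in auto)
qed

lemma is_adjoint_map_unique:
  assumes "is_adjoint_map n \<Phi> \<Psi>1" "is_adjoint_map n \<Phi> \<Psi>2" "X \<in> carrier_mat n n"
  shows "\<Psi>1 X = \<Psi>2 X"
proof -
  have c: "\<Psi>1 A \<in> carrier_mat n n" "\<Psi>2 A \<in> carrier_mat n n" if "A \<in> carrier_mat n n" for A
    using assms that by (auto simp: is_adjoint_map_def mat_linear_map_iff)
  have herm: "\<Psi>1 A = \<Psi>2 A" if A: "hermitian_mat n A" for A
  proof -
    have A': "A \<in> carrier_mat n n" using A by (simp add: hermitian_mat_def)
    have tr: "mat_trace (\<Psi>1 A * Y) = mat_trace (\<Psi>2 A * Y)" if "Y \<in> carrier_mat n n" for Y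
    proof -
      obtain H K where HK: "hermitian_mat n H" "hermitian_mat n K" "Y = H + \<i> \<cdot>\<^sub>m K"
        using hermitian_decomp[OF \<open>Y \<in> carrier_mat n n\<close>] .
      have HK': "H \<in> carrier_mat n n" "K \<in> carrier_mat n n"
        using HK by (auto simp: hermitian_mat_def)
      have split: "mat_trace (B * Y) = mat_trace (B * H) + \<i> * mat_trace (B * K)"
        if "B \<in> carrier_mat n n" for B
        using that HK' unfolding HK(3)
        by (simp add: mult_add_distrib_mat[of _ n n _ n] mult_smult_distrib[of _ n n _ n]
            mat_trace_add[of _ n] mat_trace_smult[of _ n])
      have "mat_trace (\<Psi>1 A * H) = mat_trace (\<Psi>2 A * H)"
        "mat_trace (\<Psi>1 A * K) = mat_trace (\<Psi>2 A * K)"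
        using assms(1,2) A HK(1,2) unfolding is_adjoint_map_def by metis+
      then show ?thesis by (simp add: split c A')
    qed
    have entry: "mat_trace (B * unit_mat n (j, i)) = B $$ (i, j)"
      if "B \<in> carrier_mat n n" "i < n" "j < n" for B i j
    proof -
      have "mat_trace (B * unit_mat n (j, i)) =
        (\<Sum>a<n. \<Sum>b<n. B $$ (a, b) * (if (b, a) = (j, i) then 1 else 0))"
        using that by (subst mat_trace_mult[of _ n]) auto
      also have "\<dots> = (\<Sum>a<n. \<Sum>b<n. if b = j then (if a = i then B $$ (a, b) else 0) else 0)"
        by (intro sum.cong) auto
      also have "\<dots> = B $$ (i, j)" using that by simp
      finally show ?thesis .
    qed
    show ?thesis
    proof (rule eq_matI)
      fix i j assume "i < dim_row (\<Psi>2 A)" "j < dim_col (\<Psi>2 A)"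
      then have "i < n" "j < n" using c[OF A'] by auto
      then show "\<Psi>1 A $$ (i, j) = \<Psi>2 A $$ (i, j)"
        using tr[of "unit_mat n (j, i)"] entry c[OF A'] by simp
    qed (use c[OF A'] in auto)
  qed
  obtain H K where HK: "hermitian_mat n H" "hermitian_mat n K" "X = H + \<i> \<cdot>\<^sub>m K"
    using hermitian_decomp[OF assms(3)] .
  have HK': "H \<in> carrier_mat n n" "K \<in> carrier_mat n n"
    using HK by (auto simp: hermitian_mat_def)
  have comb: "\<Psi> X = \<Psi> H + \<i> \<cdot>\<^sub>m \<Psi> K" if "is_adjoint_map n \<Phi> \<Psi>" for \<Psi>
    using that HK' unfolding HK(3) is_adjoint_map_def mat_linear_map_iff by simp
  then show ?thesis
    using comb[OF assms(1)] comb[OF assms(2)] herm[OF HK(1)] herm[OF HK(2)] by simp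
qed

end

theory Submission
  imports Defs "HOL-Analysis.Function_Topology" "Jordan_Normal_Form.DL_Rank"
begin

text \<open>Let \<open>S\<close> be a subspace of dimension \<open>d > 0\<close> supporting no state with positive semidefinite image
  under $I \otimes \Phi^*$. Separating the compact convex set of these images from the positive
  semidefinite cone gives a positive definite $Y$ with $X = (I \otimes \Phi)(Y)$ negative definite on $S$.
  Conjugation by $A \otimes I$ preserves this up to replacing $S$ by another subspace of dimension $d$, so
  one may take $Y$ to be a state whose reduction to $M_m$ is $I/m$. Then
  $(I \otimes x\Delta)(Y) = xI/(mn)$, and for the projection $P$ onto $S$
  \[ xd/(mn) < \mathrm{Tr}\,P(xI/(mn) - X), \quad
     2\,\mathrm{Tr}\,PZ - \mathrm{Tr}\,Z \leq \|Z\|_1 \mbox{ for Hermitian } Z. \]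
  With $Z = xI/(mn) - X$ this bounds $d$. For $\nu$ one needs in addition that the ratios $\nu_m/m$ converge,
  which is Fekete's lemma for the superadditive sequence $\nu_m$, and that the diamond norm dominates
  $d_m$ on states for every $m$.\<close>

section \<open>Adjoints, traces and quadratic forms\<close>

text \<open>Negativity of X on S says nothing about dim S by itself. The count enters through (I
  \<otimes> \<Delta>)(Y), which is the reduction of Y to M_m tensored with I/n: once that reduction
  is I/m, its trace against P is d/(mn) for every P of rank d. Normalizing the reduction means
  inverting it, hence the demand for a positive definite Y; the strictness of the separation leaves
  room for the perturbation that provides it. The term x - l(\<Phi>) is an upper bound for Tr Z = x
  - Tr \<Phi>(\<rho>), where \<rho> is the reduction of the state to M_n, and the factor 2 comes
  from testing Z with the reflection 2P - I. Since Tr PX < 0 is strict, d lies strictly below the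
  real bound, which produces the ceiling minus one. The estimate is kept as a trace against a test
  operator, so that the same inequality feeds both d_m and the diamond norm; for the latter only
  images of states are compared. A zero-dimensional subspace carries no states and is treated apart
  in both bounds.\<close>

lemma adj_dim [simp]: "dim_row (mat_adjoint A) = dim_col A" "dim_col (mat_adjoint A) = dim_row A"
  by (simp_all add: mat_adjoint_def)

lemma adj_carrier [intro]: "A \<in> carrier_mat r c \<Longrightarrow> mat_adjoint A \<in> carrier_mat c r"
  by (intro carrier_matI) auto

lemma adj_index [simp]:
  "i < dim_col A \<Longrightarrow> j < dim_row A \<Longrightarrow> mat_adjoint A $$ (i, j) = cnj (A $$ (j, i))"
  for A :: "complex mat"
  by (simp add: mat_adjoint_def mat_of_rows_def)

lemma adj_adj [simp]: "mat_adjoint (mat_adjoint A) = A" for A :: "complex mat"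
  by (rule eq_matI) auto

lemma mult_index_sum:
  "i < dim_row A \<Longrightarrow> j < dim_col B \<Longrightarrow> dim_col A = dim_row B \<Longrightarrow>
    (A * B) $$ (i, j) = (\<Sum>k<dim_row B. A $$ (i, k) * B $$ (k, j))"
  by (simp add: scalar_prod_def lessThan_atLeast0)

lemma adj_mult:
  "dim_col A = dim_row B \<Longrightarrow> mat_adjoint (A * B) = mat_adjoint B * mat_adjoint A"
  for A :: "complex mat"
  by (rule eq_matI) (auto simp: mult_index_sum simp del: index_mult_mat(1) intro!: sum.cong)

lemma adj_one [simp]: "mat_adjoint (1\<^sub>m n) = (1\<^sub>m n :: complex mat)"
  by (rule eq_matI) auto

lemma adj_add: "dim_row A = dim_row B \<Longrightarrow> dim_col A = dim_col B \<Longrightarrow>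
    mat_adjoint (A + B) = mat_adjoint A + mat_adjoint B" for A :: "complex mat"
  by (rule eq_matI) auto

lemma adj_smult: "mat_adjoint (a \<cdot>\<^sub>m A) = cnj a \<cdot>\<^sub>m mat_adjoint A" for A :: "complex mat"
  by (rule eq_matI) auto

lemma mult_assoc_dim:
  "dim_col A = dim_row B \<Longrightarrow> dim_col B = dim_row C \<Longrightarrow> A * B * C = A * (B * C)"
  for A :: "'a::semiring_0 mat"
  by (rule assoc_mult_mat) auto

lemma trace_mult_sum:
  "dim_col A = dim_row B \<Longrightarrow> dim_row A = dim_col B \<Longrightarrow>
    mat_trace (A * B) = (\<Sum>i<dim_row A. \<Sum>j<dim_row B. A $$ (i, j) * B $$ (j, i))"
  by (auto simp: mat_trace_def mult_index_sum simp del: index_mult_mat(1) intro!: sum.cong)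

lemma trace_comm:
  assumes "dim_col A = dim_row B" "dim_row A = dim_col B"
  shows "mat_trace (A * B) = mat_trace (B * A)"
proof -
  have "mat_trace (A * B) = (\<Sum>i<dim_row A. \<Sum>j<dim_row B. A $$ (i, j) * B $$ (j, i))"
    using assms by (rule trace_mult_sum)
  also have "\<dots> = (\<Sum>j<dim_row B. \<Sum>i<dim_row A. A $$ (i, j) * B $$ (j, i))"
    by (rule sum.swap)
  also have "\<dots> = mat_trace (B * A)"
    using assms by (simp add: trace_mult_sum mult.commute)
  finally show ?thesis .
qed

lemma trace_adj: "dim_row A = dim_col A \<Longrightarrow> mat_trace (mat_adjoint A) = cnj (mat_trace A)"
  by (auto simp: mat_trace_def)

lemma trace_one: "mat_trace (1\<^sub>m n) = of_nat n"
  by (simp add: mat_trace_def)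

lemma member_le_double_sum:
  fixes g :: "nat \<Rightarrow> nat \<Rightarrow> real"
  assumes "i < M" "j < N" "\<And>i j. 0 \<le> g i j"
  shows "g i j \<le> (\<Sum>i<M. \<Sum>j<N. g i j)"
proof -
  have "g i j \<le> (\<Sum>j<N. g i j)" using assms by (intro member_le_sum) auto
  also have "\<dots> \<le> (\<Sum>i<M. \<Sum>j<N. g i j)"
    using assms by (intro member_le_sum[where f = "\<lambda>i. \<Sum>j<N. g i j"]) (auto intro!: sum_nonneg)
  finally show ?thesis .
qed

section \<open>Hermitian and positive semidefinite matrices\<close>

lemma hermitian_carrier: "hermitian_mat N A \<Longrightarrow> A \<in> carrier_mat N N"
  and hermitian_adj: "hermitian_mat N A \<Longrightarrow> mat_adjoint A = A"
  by (simp_all add: hermitian_mat_def)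

lemma psd_hermitian: "psd_mat N A \<Longrightarrow> hermitian_mat N A"
  by (simp add: psd_mat_def)

lemma psd_carrier: "psd_mat N A \<Longrightarrow> A \<in> carrier_mat N N"
  by (simp add: psd_mat_def hermitian_mat_def)

lemma hermitian_index: "hermitian_mat N A \<Longrightarrow> i < N \<Longrightarrow> j < N \<Longrightarrow> cnj (A $$ (i, j)) = A $$ (j, i)"
  by (metis adj_index carrier_matD hermitian_mat_def)

lemma hermitian_matI:
  assumes "A \<in> carrier_mat N N" "\<And>i j. i < N \<Longrightarrow> j < N \<Longrightarrow> cnj (A $$ (i, j)) = A $$ (j, i)"
  shows "hermitian_mat N A"
  unfolding hermitian_mat_def using assms by (auto intro!: eq_matI)

text \<open>Arguments are functions rather than vectors, so that no dimension condition is attached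
  to them and product vectors such as
  \<open>\<lambda>r. if r mod n = k then f (r div n) else 0\<close> serve directly as test
  vectors.\<close>

definition quad_form :: "nat \<Rightarrow> complex mat \<Rightarrow> (nat \<Rightarrow> complex) \<Rightarrow> complex" where
  "quad_form N A f = (\<Sum>i<N. \<Sum>j<N. cnj (f i) * A $$ (i, j) * f j)"

lemma quad_form_vec:
  assumes "A \<in> carrier_mat N N" "v \<in> carrier_vec N"
  shows "(A *\<^sub>v v) \<bullet>c v = quad_form N A (\<lambda>i. v $ i)"
  using assms
  by (auto simp: scalar_prod_def quad_form_def lessThan_atLeast0 sum_distrib_left mult_ac
      intro!: sum.cong)

lemma psd_mat_iff:
  "psd_mat N A \<longleftrightarrow> hermitian_mat N A \<and> (\<forall>f. 0 \<le> Re (quad_form N A f))"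
proof -
  have "(\<forall>v \<in> carrier_vec N. 0 \<le> Re ((A *\<^sub>v v) \<bullet>c v)) \<longleftrightarrow> (\<forall>f. 0 \<le> Re (quad_form N A f))"
    if A: "A \<in> carrier_mat N N"
  proof (intro iffI allI ballI)
    fix f assume *: "\<forall>v \<in> carrier_vec N. 0 \<le> Re ((A *\<^sub>v v) \<bullet>c v)"
    have "quad_form N A f = quad_form N A (\<lambda>i. vec N f $ i)"
      by (simp add: quad_form_def)
    then show "0 \<le> Re (quad_form N A f)"
      using *[rule_format, of "vec N f"] quad_form_vec[OF A, of "vec N f"] by simp
  qed (simp add: quad_form_vec[OF A])
  then show ?thesis by (auto simp: psd_mat_def hermitian_mat_def)
qed

text \<open>\<open>col_mat N f\<close> is a vector as a one-column matrix, so that forms become traces.\<close>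

abbreviation col_mat :: "nat \<Rightarrow> (nat \<Rightarrow> complex) \<Rightarrow> complex mat" where
  "col_mat N f \<equiv> mat N 1 (\<lambda>(i, j). f i)"

lemma quad_form_trace:
  assumes "A \<in> carrier_mat N N"
  shows "quad_form N A f = mat_trace (A * (col_mat N f * mat_adjoint (col_mat N f)))"
proof -
  have "quad_form N A f = (\<Sum>i<N. \<Sum>j<N. A $$ (i, j) * (f j * cnj (f i)))"
    by (simp add: quad_form_def mult_ac)
  also have "\<dots> = mat_trace (A * (col_mat N f * mat_adjoint (col_mat N f)))"
    using assms by (subst trace_mult_sum) (auto simp: mult_index_sum simp del: index_mult_mat(1))
  finally show ?thesis .
qed

text \<open>Both forms are traces against rank-one matrices, and cyclicity of the trace moves
  \<open>B\<close> around. The function on the right is \<open>B\<^sup>* f\<close> in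
  coordinates.\<close>

lemma quad_form_conj:
  assumes "A \<in> carrier_mat N N" "B \<in> carrier_mat M N"
  shows "quad_form M (B * A * mat_adjoint B) f
    = quad_form N A (\<lambda>i. \<Sum>k<M. cnj (B $$ (k, i)) * f k)"
proof -
  let ?g = "\<lambda>i. \<Sum>k<M. cnj (B $$ (k, i)) * f k"
  have g: "mat_adjoint B * col_mat M f = col_mat N ?g"
    using assms by (intro eq_matI) (auto simp: mult_index_sum simp del: index_mult_mat(1))
  have g2: "col_mat N ?g * mat_adjoint (col_mat N ?g)
    = mat_adjoint B * (col_mat M f * (mat_adjoint (col_mat M f) * B))"
    unfolding g[symmetric] using assms by (simp add: adj_mult mult_assoc_dim)
  have "quad_form M (B * A * mat_adjoint B) f
    = mat_trace (B * (A * (mat_adjoint B * (col_mat M f * mat_adjoint (col_mat M f)))))"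
    using assms by (subst quad_form_trace) (auto simp: mult_assoc_dim)
  also have "\<dots> = mat_trace (A * (mat_adjoint B * (col_mat M f * mat_adjoint (col_mat M f))) * B)"
    using assms by (subst trace_comm) (auto simp: mult_assoc_dim)
  also have "\<dots> = quad_form N A ?g"
    using assms by (subst quad_form_trace) (auto simp: g2[unfolded One_nat_def] mult_assoc_dim)
  finally show ?thesis .
qed

lemma hermitian_conj:
  assumes "hermitian_mat N A" "B \<in> carrier_mat M N"
  shows "hermitian_mat M (B * A * mat_adjoint B)"
  using assms by (auto simp: hermitian_mat_def adj_mult mult_assoc_dim)

lemma hermitian_add: "hermitian_mat N A \<Longrightarrow> hermitian_mat N B \<Longrightarrow> hermitian_mat N (A + B)"
  by (auto simp: hermitian_mat_def adj_add)

lemma hermitian_smult: "hermitian_mat N A \<Longrightarrow> hermitian_mat N (complex_of_real a \<cdot>\<^sub>m A)"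
  by (auto simp: hermitian_mat_def adj_smult)

lemma hermitian_one: "hermitian_mat N (1\<^sub>m N)"
  by (auto simp: hermitian_mat_def)

lemma quad_form_add: "A \<in> carrier_mat N N \<Longrightarrow> B \<in> carrier_mat N N \<Longrightarrow>
    quad_form N (A + B) f = quad_form N A f + quad_form N B f"
  by (simp add: quad_form_def ring_distribs sum.distrib)

lemma quad_form_smult: "A \<in> carrier_mat N N \<Longrightarrow> quad_form N (a \<cdot>\<^sub>m A) f = a * quad_form N A f"
  by (simp add: quad_form_def sum_distrib_left mult_ac)

lemma quad_form_one: "quad_form N (1\<^sub>m N) f = of_real (\<Sum>i<N. (cmod (f i))\<^sup>2)"
proof -
  have "quad_form N (1\<^sub>m N) f = (\<Sum>i<N. \<Sum>j<N. if j = i then cnj (f i) * f j else 0)"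
    unfolding quad_form_def by (intro sum.cong) auto
  also have "\<dots> = (\<Sum>i<N. cnj (f i) * f i)" by simp
  finally show ?thesis by (simp add: complex_norm_square[symmetric] mult.commute)
qed

lemma psd_conj: "psd_mat N A \<Longrightarrow> B \<in> carrier_mat M N \<Longrightarrow> psd_mat M (B * A * mat_adjoint B)"
  using hermitian_conj[of N A B M] quad_form_conj[of A N B M] hermitian_carrier[of N A]
  by (simp add: psd_mat_iff)

lemma psd_add: "psd_mat N A \<Longrightarrow> psd_mat N B \<Longrightarrow> psd_mat N (A + B)"
  unfolding psd_mat_iff by (simp add: hermitian_add quad_form_add hermitian_carrier)

lemma psd_smult: "psd_mat N A \<Longrightarrow> 0 \<le> a \<Longrightarrow> psd_mat N (complex_of_real a \<cdot>\<^sub>m A)"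
  unfolding psd_mat_iff by (simp add: hermitian_smult quad_form_smult hermitian_carrier)

lemma psd_one: "psd_mat N (1\<^sub>m N)"
  unfolding psd_mat_iff by (simp add: hermitian_one quad_form_one sum_nonneg)

lemma psd_gram: "B \<in> carrier_mat M N \<Longrightarrow> psd_mat M (B * mat_adjoint B)"
  using psd_conj[OF psd_one, of B M N] by simp

lemma quad_form_unit: "i < N \<Longrightarrow> quad_form N A (\<lambda>k. if k = i then 1 else 0) = A $$ (i, i)"
  by (simp add: quad_form_def if_distrib[of "\<lambda>x. _ * x"] if_distrib[of "\<lambda>x. x * _"]
      if_distrib[of cnj] cong: if_cong)

lemma psd_diag:
  assumes "psd_mat N A" "i < N"
  shows "0 \<le> Re (A $$ (i, i))"
  using assms quad_form_unit[of i N A] unfolding psd_mat_iff by metis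

lemma hermitian_trace_Im: "hermitian_mat N A \<Longrightarrow> Im (mat_trace A) = 0"
  using trace_adj[of A] by (auto simp: hermitian_mat_def complex_eq_iff)

lemma hermitian_trace_of_real: "hermitian_mat N A \<Longrightarrow> mat_trace A = of_real (Re (mat_trace A))"
  using hermitian_trace_Im by (simp add: complex_eq_iff)

section \<open>The spectral theorem\<close>

text \<open>Schur triangularization puts the roots of the characteristic polynomial on a diagonal,
  with multiplicity, and cyclicity of the trace removes the change of basis.\<close>

lemma trace_eq_sum_eigenvalues:
  fixes A :: "complex mat"
  assumes A: "A \<in> carrier_mat n n" and c: "char_poly A = (\<Prod>a\<leftarrow>es. [:- a, 1:])"
  shows "mat_trace A = sum_list es"
proof -
  obtain B P Q where B: "schur_decomposition A es = (B, P, Q)"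
    by (cases "schur_decomposition A es") auto
  have s: "similar_mat_wit A B P Q" "diag_mat B = es"
    using schur_decomposition[OF A c B] by auto
  note w = similar_mat_witD2[OF A s(1)]
  have "mat_trace A = mat_trace (P * (B * Q))"
    using w by (simp add: mult_assoc_dim)
  also have "\<dots> = mat_trace (B * (Q * P))"
    using w by (subst trace_comm) (auto simp: mult_assoc_dim)
  also have "\<dots> = mat_trace B" using w by simp
  also have "\<dots> = sum_list (diag_mat B)"
    by (simp add: mat_trace_def diag_mat_def sum_list_sum_nth lessThan_atLeast0)
  finally show ?thesis using s by simp
qed

text \<open>If all \<open>n\<close> roots of the characteristic polynomial were \<open>c\<close>,
  the trace would be \<open>n c\<close>. This supplies the new eigenvalue in the deflation below
  without restricting \<open>A\<close> to an orthogonal complement.\<close>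

lemma exists_eigenvalue_neq:
  fixes A :: "complex mat"
  assumes A: "A \<in> carrier_mat n n" and n: "n > 0" and tr: "mat_trace A \<noteq> of_nat n * c"
  obtains \<mu> v where "\<mu> \<noteq> c" "eigenvector A v \<mu>"
proof -
  obtain es where es: "char_poly A = (\<Prod>a\<leftarrow>es. [:- a, 1:])" "length es = n"
    using char_poly_factorized[OF A] by auto
  have "\<exists>a\<in>set es. a \<noteq> c"
  proof (rule ccontr)
    assume "\<not> ?thesis"
    then have "es = replicate n c" using es(2) by (intro replicate_eqI) auto
    then show False using tr trace_eq_sum_eigenvalues[OF A es(1)]
      by (simp add: sum_list_replicate)
  qed
  then obtain a where a: "a \<in> set es" "a \<noteq> c" by auto
  have "poly (char_poly A) a = 0"
    using a(1) unfolding es(1) by (induction es) auto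
  then have "eigenvalue A a" using eigenvalue_root_char_poly[OF A] by simp
  then show ?thesis using a that unfolding eigenvalue_def by auto
qed

text \<open>A partial diagonalization: only the first \<open>k\<close> vectors and values are
  constrained, so that eigenvectors can be added one at a time inside a fixed space of dimension
  \<open>N\<close>.\<close>

definition orthonormal_eigensystem ::
  "nat \<Rightarrow> complex mat \<Rightarrow> nat \<Rightarrow> (nat \<Rightarrow> nat \<Rightarrow> complex) \<Rightarrow> (nat \<Rightarrow> real) \<Rightarrow> bool" where
  "orthonormal_eigensystem N A k u \<alpha> \<longleftrightarrow>
     (\<forall>a<k. \<forall>b<k. (\<Sum>i<N. u a i * cnj (u b i)) = (if a = b then 1 else 0)) \<and>
     (\<forall>a<k. \<forall>i<N. (\<Sum>j<N. A $$ (i, j) * u a j) = of_real (\<alpha> a) * u a i)"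

lemma hermitian_form_swap:
  assumes "hermitian_mat N A"
  shows "(\<Sum>i<N. (\<Sum>j<N. A $$ (i, j) * w j) * cnj (g i)) =
    (\<Sum>j<N. w j * cnj (\<Sum>i<N. A $$ (j, i) * g i))"
proof -
  have "(\<Sum>i<N. (\<Sum>j<N. A $$ (i, j) * w j) * cnj (g i)) =
    (\<Sum>i<N. \<Sum>j<N. w j * (cnj (A $$ (j, i)) * cnj (g i)))"
    using hermitian_index[OF assms]
    by (auto simp: sum_distrib_left mult_ac intro!: sum.cong)
  also have "\<dots> = (\<Sum>j<N. \<Sum>i<N. w j * (cnj (A $$ (j, i)) * cnj (g i)))"
    by (rule sum.swap)
  finally show ?thesis by (simp add: sum_distrib_left)
qed

text \<open>Deflation: moving the known eigenvalues of \<open>A\<close> to a common value \<open>c\<close> that is not the average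
  of the new spectrum leaves an eigenvalue \<open>\<noteq> c\<close>; its eigenvectors are orthogonal to the known
  ones, hence eigenvectors of \<open>A\<close>.\<close>

lemma extend_eigensystem:
  assumes h: "hermitian_mat N A" and k: "k < N" and e: "orthonormal_eigensystem N A k u \<alpha>"
  obtains w \<mu> where "orthonormal_eigensystem N A (Suc k) (u(k := w)) (\<alpha>(k := \<mu>))"
proof -
  note of_real_diff [simp del]
  have A: "A \<in> carrier_mat N N" using hermitian_carrier[OF h] .
  have on: "(\<Sum>i<N. u a i * cnj (u b i)) = (if a = b then 1 else 0)" if "a < k" "b < k" for a b
    using e that by (auto simp: orthonormal_eigensystem_def)
  have ev: "(\<Sum>j<N. A $$ (i, j) * u a j) = of_real (\<alpha> a) * u a i" if "a < k" "i < N" for a i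
    using e that by (auto simp: orthonormal_eigensystem_def)
  \<comment> \<open>The mean of the \<open>N - k\<close> eigenvalues still to be found, plus 1. The
    trace of \<open>A'\<close> is that of \<open>A\<close> with the \<open>k\<close> known
    eigenvalues replaced by \<open>c\<close>; it would equal \<open>N c\<close> only if
    \<open>c\<close> were that mean.\<close>
  define c :: real where "c = (Re (mat_trace A) - (\<Sum>l<k. \<alpha> l)) / (real N - real k) + 1"
  define A' where
    "A' = mat N N (\<lambda>(i, j). A $$ (i, j) + (\<Sum>l<k. of_real (c - \<alpha> l) * u l i * cnj (u l j)))"
  have A': "A' \<in> carrier_mat N N" by (simp add: A'_def)
  have "mat_trace A' = mat_trace A + (\<Sum>i<N. \<Sum>l<k. of_real (c - \<alpha> l) * u l i * cnj (u l i))"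
    using A by (simp add: mat_trace_def A'_def sum.distrib)
  also have "(\<Sum>i<N. \<Sum>l<k. of_real (c - \<alpha> l) * u l i * cnj (u l i)) =
    (\<Sum>l<k. of_real (c - \<alpha> l) * (\<Sum>i<N. u l i * cnj (u l i)))"
    by (subst sum.swap) (simp add: sum_distrib_left mult_ac)
  also have "\<dots> = of_real (\<Sum>l<k. c - \<alpha> l)" by (simp add: on)
  finally have tr: "Re (mat_trace A') = Re (mat_trace A) + real k * c - (\<Sum>l<k. \<alpha> l)"
    by (simp add: sum_subtractf)
  have "mat_trace A' \<noteq> of_nat N * of_real c"
  proof
    assume "mat_trace A' = of_nat N * of_real c"
    then have "Re (mat_trace A') = real N * c" by simp
    then have "(real N - real k) * c = Re (mat_trace A) - (\<Sum>l<k. \<alpha> l)"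
      using tr by (simp add: algebra_simps)
    moreover have "(real N - real k) * c = Re (mat_trace A) - (\<Sum>l<k. \<alpha> l) + (real N - real k)"
      using k by (simp add: c_def distrib_left)
    ultimately show False using k by simp
  qed
  then obtain \<mu> v where \<mu>: "\<mu> \<noteq> of_real c" and v: "eigenvector A' v \<mu>"
    using exists_eigenvalue_neq[OF A'] k by (metis gr_implies_not0 not_gr_zero)
  have v': "v \<in> carrier_vec N" "v \<noteq> 0\<^sub>v N" "A' *\<^sub>v v = \<mu> \<cdot>\<^sub>v v"
    using v A' by (auto simp: eigenvector_def)
  define p where "p l = (\<Sum>j<N. v $ j * cnj (u l j))" for l
  have eq: "(\<Sum>j<N. A $$ (i, j) * v $ j) + (\<Sum>l<k. of_real (c - \<alpha> l) * u l i * p l) = \<mu> * v $ i"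
    if i: "i < N" for i
  proof -
    have "\<mu> * v $ i = (A' *\<^sub>v v) $ i" using v' i by simp
    also have "\<dots> = (\<Sum>j<N. A' $$ (i, j) * v $ j)"
      using v'(1) i A' by (auto simp: scalar_prod_def lessThan_atLeast0)
    also have "\<dots> = (\<Sum>j<N. A $$ (i, j) * v $ j) +
      (\<Sum>j<N. \<Sum>l<k. of_real (c - \<alpha> l) * u l i * (v $ j * cnj (u l j)))"
      using i by (simp add: A'_def distrib_left distrib_right sum.distrib sum_distrib_left mult_ac)
    also have "(\<Sum>j<N. \<Sum>l<k. of_real (c - \<alpha> l) * u l i * (v $ j * cnj (u l j))) =
      (\<Sum>l<k. of_real (c - \<alpha> l) * u l i * p l)"
      by (subst sum.swap) (simp add: p_def sum_distrib_left)
    finally show ?thesis by simp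
  qed
  \<comment> \<open>The eigenvalue equation is paired with \<open>u m\<close>: the value \<alpha> m
    from \<open>A\<close> and the shift c - \<alpha> m add up to \<open>c\<close>, which leaves
    (\<mu> - c) p m = 0.\<close>
  have p0: "p m = 0" if m: "m < k" for m
  proof -
    have "\<mu> * p m = (\<Sum>i<N. \<mu> * v $ i * cnj (u m i))"
      by (simp add: p_def sum_distrib_left mult_ac)
    also have "\<dots> = (\<Sum>i<N. ((\<Sum>j<N. A $$ (i, j) * v $ j) +
        (\<Sum>l<k. of_real (c - \<alpha> l) * u l i * p l)) * cnj (u m i))"
      by (intro sum.cong) (auto simp only: lessThan_iff eq)
    also have "\<dots> = (\<Sum>i<N. (\<Sum>j<N. A $$ (i, j) * v $ j) * cnj (u m i)) +
        (\<Sum>i<N. \<Sum>l<k. of_real (c - \<alpha> l) * p l * (u l i * cnj (u m i)))"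
      by (simp add: distrib_left sum.distrib sum_distrib_left mult.commute mult.left_commute)
    also have "(\<Sum>i<N. (\<Sum>j<N. A $$ (i, j) * v $ j) * cnj (u m i)) =
        (\<Sum>j<N. v $ j * cnj (of_real (\<alpha> m) * u m j))"
      unfolding hermitian_form_swap[OF h] using ev[OF m] by (intro sum.cong) auto
    also have "\<dots> = of_real (\<alpha> m) * p m"
      by (simp add: p_def sum_distrib_left mult_ac)
    also have "(\<Sum>i<N. \<Sum>l<k. of_real (c - \<alpha> l) * p l * (u l i * cnj (u m i))) =
        (\<Sum>l<k. of_real (c - \<alpha> l) * p l * (\<Sum>i<N. u l i * cnj (u m i)))"
      by (subst sum.swap) (simp add: sum_distrib_left)
    also have "\<dots> = (\<Sum>l<k. if l = m then of_real (c - \<alpha> l) * p l else 0)"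
      using m by (intro sum.cong) (auto simp: on)
    also have "\<dots> = of_real (c - \<alpha> m) * p m" using m by simp
    finally have "(\<mu> - of_real c) * p m = 0" by (simp add: algebra_simps of_real_diff)
    then show ?thesis using \<mu> by simp
  qed
  have eigA: "(\<Sum>j<N. A $$ (i, j) * v $ j) = \<mu> * v $ i" if "i < N" for i
    using eq[OF that] by (simp add: p0)
  define s where "s = (\<Sum>i<N. (cmod (v $ i))\<^sup>2)"
  have ss: "(\<Sum>i<N. v $ i * cnj (v $ i)) = of_real s"
    by (simp add: s_def complex_norm_square[symmetric])
  obtain i0 where i0: "i0 < N" "v $ i0 \<noteq> 0"
    using v'(1,2) by (metis carrier_vecD eq_vecI index_zero_vec)
  have "0 < (cmod (v $ i0))\<^sup>2" using i0 by simp
  also have "\<dots> \<le> s" unfolding s_def using i0 by (intro member_le_sum) auto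
  finally have s: "s > 0" .
  \<comment> \<open>Evaluating the form of \<open>A\<close> at \<open>v\<close> from either side
    shows that \<mu> is real.\<close>
  have "\<mu> * of_real s = (\<Sum>i<N. (\<Sum>j<N. A $$ (i, j) * v $ j) * cnj (v $ i))"
    unfolding ss[symmetric] sum_distrib_left mult.assoc[symmetric]
    by (intro sum.cong) (auto simp only: lessThan_iff eigA)
  also have "\<dots> = (\<Sum>i<N. v $ i * cnj (\<mu> * v $ i))"
    unfolding hermitian_form_swap[OF h] by (intro sum.cong) (auto simp only: lessThan_iff eigA)
  also have "\<dots> = cnj \<mu> * of_real s"
    unfolding ss[symmetric] by (simp add: sum_distrib_left mult_ac)
  finally have "\<mu> = cnj \<mu>" using s by simp
  then have \<mu>r: "\<mu> = of_real (Re \<mu>)" by (simp add: complex_eq_iff)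
  define w where "w i = v $ i / of_real (sqrt s)" for i
  have w1: "(\<Sum>i<N. w i * cnj (w i)) = 1"
  proof -
    have "(\<Sum>i<N. w i * cnj (w i)) = (\<Sum>i<N. v $ i * cnj (v $ i)) / (of_real (sqrt s) * of_real (sqrt s))"
      by (simp add: w_def sum_divide_distrib)
    also have "\<dots> = 1" using s unfolding ss of_real_mult[symmetric] by simp
    finally show ?thesis .
  qed
  have w2: "(\<Sum>i<N. w i * cnj (u m i)) = 0" if "m < k" for m
    using p0[OF that] unfolding w_def p_def
    by (simp add: sum_divide_distrib[symmetric])
  have w3: "(\<Sum>i<N. u m i * cnj (w i)) = 0" if "m < k" for m
  proof -
    have "(\<Sum>i<N. u m i * cnj (w i)) = cnj (\<Sum>i<N. w i * cnj (u m i))"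
      by (simp add: mult.commute)
    then show ?thesis using w2[OF that] by simp
  qed
  have w4: "(\<Sum>j<N. A $$ (i, j) * w j) = of_real (Re \<mu>) * w i" if "i < N" for i
    using eigA[OF that] \<mu>r unfolding w_def
    by (simp add: sum_divide_distrib[symmetric])
  show ?thesis
    by (rule that[of w "Re \<mu>"])
      (auto simp: orthonormal_eigensystem_def less_Suc_eq on ev w1 w2 w3 w4)
qed

lemma eigensystem_exists:
  assumes "hermitian_mat N A" "k \<le> N"
  shows "\<exists>u \<alpha>. orthonormal_eigensystem N A k u \<alpha>"
  using assms(2)
proof (induction k)
  case 0
  then show ?case by (simp add: orthonormal_eigensystem_def)
next
  case (Suc k)
  then show ?case using extend_eigensystem[OF assms(1)] by (metis Suc_le_eq less_imp_le_nat)
qed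

definition real_diag :: "nat \<Rightarrow> (nat \<Rightarrow> real) \<Rightarrow> complex mat" where
  "real_diag N \<alpha> = mat N N (\<lambda>(i, j). if i = j then of_real (\<alpha> i) else 0)"

lemma real_diag_dim [simp]: "dim_row (real_diag N \<alpha>) = N" "dim_col (real_diag N \<alpha>) = N"
  and real_diag_carrier [simp]: "real_diag N \<alpha> \<in> carrier_mat N N"
  and real_diag_index: "i < N \<Longrightarrow> j < N \<Longrightarrow> real_diag N \<alpha> $$ (i, j) = (if i = j then of_real (\<alpha> i) else 0)"
  and real_diag_adj [simp]: "mat_adjoint (real_diag N \<alpha>) = real_diag N \<alpha>"
  by (auto simp: real_diag_def intro!: eq_matI)

lemma real_diag_mult: "real_diag N \<alpha> * real_diag N \<mu> = real_diag N (\<lambda>i. \<alpha> i * \<mu> i)"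
  by (rule eq_matI)
    (auto simp: mult_index_sum real_diag_index if_distrib[of "\<lambda>x. x * _"] cong: if_cong
      simp del: index_mult_mat(1))

lemma mult_real_diag_index:
  assumes "i < dim_row U" "j < N" "dim_col U = N"
  shows "(U * real_diag N \<alpha>) $$ (i, j) = of_real (\<alpha> j) * U $$ (i, j)"
  using assms by (simp add: mult_index_sum real_diag_index if_distrib[of "\<lambda>x. _ * x"] mult.commute
      cong: if_cong del: index_mult_mat(1))

lemma spectral_theorem:
  assumes h: "hermitian_mat N A"
  obtains U \<alpha> where "U \<in> carrier_mat N N" "mat_adjoint U * U = 1\<^sub>m N" "U * mat_adjoint U = 1\<^sub>m N"
    "A = U * real_diag N \<alpha> * mat_adjoint U"
proof -
  have A: "A \<in> carrier_mat N N" using hermitian_carrier[OF h] .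
  obtain u \<alpha> where e: "orthonormal_eigensystem N A N u \<alpha>"
    using eigensystem_exists[OF h] by blast
  define U where "U = mat N N (\<lambda>(i, a). u a i)"
  have U: "U \<in> carrier_mat N N" by (simp add: U_def)
  have UU: "mat_adjoint U * U = 1\<^sub>m N"
    using e by (intro eq_matI)
      (auto simp: U_def orthonormal_eigensystem_def mult_index_sum mult.commute
        simp del: index_mult_mat(1))
  have UU': "U * mat_adjoint U = 1\<^sub>m N"
    using mat_mult_left_right_inverse[OF adj_carrier[OF U] U UU] .
  have AU: "A * U = U * real_diag N \<alpha>"
  proof (rule eq_matI)
    fix i j assume "i < dim_row (U * real_diag N \<alpha>)" "j < dim_col (U * real_diag N \<alpha>)"
    then have ij: "i < N" "j < N" by (simp_all add: U_def)
    have "(U * real_diag N \<alpha>) $$ (i, j) = of_real (\<alpha> j) * U $$ (i, j)"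
      using ij by (intro mult_real_diag_index) (simp_all add: U_def)
    also have "\<dots> = (\<Sum>k<N. A $$ (i, k) * U $$ (k, j))"
      using e ij by (simp add: U_def orthonormal_eigensystem_def)
    also have "\<dots> = (A * U) $$ (i, j)"
      using ij A U by (subst mult_index_sum) auto
    finally show "(A * U) $$ (i, j) = (U * real_diag N \<alpha>) $$ (i, j)" ..
  qed (use A in \<open>auto simp: U_def\<close>)
  have "A = A * (U * mat_adjoint U)" using UU' A by simp
  also have "\<dots> = A * U * mat_adjoint U" using A U by (simp add: mult_assoc_dim)
  finally show ?thesis using that[OF U UU UU', of \<alpha>] AU by simp
qed

section \<open>The trace norm\<close>

text \<open>Similar matrices have the same characteristic polynomial, so the multiset of roots
  behind \<open>singular_values\<close> can be read off any unitary diagonalization.\<close>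

lemma trace_norm_eq_sum_sqrt:
  assumes A: "A \<in> carrier_mat N N" and U: "U \<in> carrier_mat N N"
    and UU: "mat_adjoint U * U = 1\<^sub>m N" "U * mat_adjoint U = 1\<^sub>m N"
    and AA: "mat_adjoint A * A = U * real_diag N \<beta> * mat_adjoint U"
  shows "trace_norm A = (\<Sum>i<N. sqrt (\<beta> i))"
proof -
  have "similar_mat (mat_adjoint A * A) (real_diag N \<beta>)"
    using A U UU AA by (intro similar_matI[where n = N and P = U and Q = "mat_adjoint U"]) auto
  then have "char_poly (mat_adjoint A * A) = char_poly (real_diag N \<beta>)"
    by (rule char_poly_similar)
  also have "\<dots> = (\<Prod>a\<leftarrow>diag_mat (real_diag N \<beta>). [:- a, 1:])"
    by (intro char_poly_upper_triangular[where n = N]) (auto simp: real_diag_index upper_triangular_def)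
  finally have cp: "char_poly (mat_adjoint A * A) = (\<Prod>a\<leftarrow>diag_mat (real_diag N \<beta>). [:- a, 1:])" .
  have pr: "proots (\<Prod>a\<leftarrow>as. [:- a, 1:]) = mset as" for as :: "complex list"
  proof (induction as)
    case (Cons a as)
    have "(\<Prod>a\<leftarrow>as. [:- a, 1:]) \<noteq> 0" by (auto simp: prod_list_zero_iff)
    then show ?case using Cons by (simp add: proots_mult del: mult_pCons_left)
  qed simp
  have "trace_norm A = sum_list (map (\<lambda>z. sqrt (Re z)) (diag_mat (real_diag N \<beta>)))"
    unfolding trace_norm_def singular_values_def cp pr
    by (metis mset_map sum_mset_sum_list)
  also have "\<dots> = (\<Sum>i<N. sqrt (\<beta> i))"
    by (simp add: diag_mat_def sum_list_sum_nth lessThan_atLeast0 real_diag_index)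
  finally show ?thesis .
qed

text \<open>The trace is expanded in the eigenbasis formed by the columns of \<open>U\<close>. With
  \<open>C\<close> the identity it yields the sum of the eigenvalues, with a contraction it yields
  one half of the trace-norm duality.\<close>

lemma trace_mult_spectral:
  assumes C: "C \<in> carrier_mat N N" and U: "U \<in> carrier_mat N N"
  shows "mat_trace (C * (U * real_diag N \<alpha> * mat_adjoint U)) =
    (\<Sum>i<N. of_real (\<alpha> i) * quad_form N C (\<lambda>j. U $$ (j, i)))"
proof -
  have "mat_trace (C * (U * real_diag N \<alpha> * mat_adjoint U)) =
      mat_trace ((C * (U * real_diag N \<alpha>)) * mat_adjoint U)"
    using assms by (simp add: mult_assoc_dim)
  also have "\<dots> = mat_trace (mat_adjoint U * C * U * real_diag N \<alpha>)"
    using assms by (subst trace_comm) (auto simp: mult_assoc_dim)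
  also have "\<dots> = (\<Sum>i<N. (mat_adjoint U * C * U * real_diag N \<alpha>) $$ (i, i))"
    using assms by (simp add: mat_trace_def)
  also have "\<dots> = (\<Sum>i<N. of_real (\<alpha> i) * (mat_adjoint U * C * U) $$ (i, i))"
    using assms by (intro sum.cong mult_real_diag_index) auto
  also have "\<dots> = (\<Sum>i<N. of_real (\<alpha> i) * quad_form N C (\<lambda>j. U $$ (j, i)))"
  proof (intro sum.cong refl)
    fix i assume "i \<in> {..<N}"
    then have i: "i < N" by simp
    have "(mat_adjoint U * C * U) $$ (i, i) = (\<Sum>j<N. (\<Sum>k<N. cnj (U $$ (k, i)) * C $$ (k, j)) * U $$ (j, i))"
      using assms i by (simp add: mult_index_sum del: index_mult_mat(1))
    also have "\<dots> = (\<Sum>j<N. \<Sum>k<N. cnj (U $$ (k, i)) * C $$ (k, j) * U $$ (j, i))"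
      by (simp add: sum_distrib_right)
    also have "\<dots> = quad_form N C (\<lambda>j. U $$ (j, i))"
      unfolding quad_form_def by (rule sum.swap)
    finally show "of_real (\<alpha> i) * (mat_adjoint U * C * U) $$ (i, i) =
      of_real (\<alpha> i) * quad_form N C (\<lambda>j. U $$ (j, i))" by simp
  qed
  finally show ?thesis .
qed

lemma unitary_col_norm:
  assumes "U \<in> carrier_mat N N" "mat_adjoint U * U = 1\<^sub>m N" "i < N"
  shows "(\<Sum>j<N. (cmod (U $$ (j, i)))\<^sup>2) = 1"
proof -
  have "(\<Sum>j<N. cnj (U $$ (j, i)) * U $$ (j, i)) = (mat_adjoint U * U) $$ (i, i)"
    using assms(1,3) by (subst mult_index_sum) auto
  then have "complex_of_real (\<Sum>j<N. (cmod (U $$ (j, i)))\<^sup>2) = 1"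
    using assms(2,3) by (simp add: complex_norm_square[symmetric] mult.commute)
  then show ?thesis using of_real_eq_1_iff by blast
qed

lemma spectral_nonneg:
  assumes "psd_mat N A" and U: "U \<in> carrier_mat N N" "mat_adjoint U * U = 1\<^sub>m N"
    and A: "A = U * real_diag N \<alpha> * mat_adjoint U" and i: "i < N"
  shows "0 \<le> \<alpha> i"
proof -
  have "mat_adjoint U * A * mat_adjoint (mat_adjoint U) =
      (mat_adjoint U * U) * real_diag N \<alpha> * (mat_adjoint U * U)"
    using U(1) unfolding A by (simp add: mult_assoc_dim)
  also have "\<dots> = real_diag N \<alpha>"
    unfolding U(2) by simp
  finally have "psd_mat N (real_diag N \<alpha>)"
    using psd_conj[OF assms(1), of "mat_adjoint U" N] U(1) by (metis adj_carrier)
  from psd_diag[OF this i] show ?thesis using i by (simp add: real_diag_index)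
qed

lemma trace_norm_hermitian:
  assumes U: "U \<in> carrier_mat N N" "mat_adjoint U * U = 1\<^sub>m N" "U * mat_adjoint U = 1\<^sub>m N"
    and A: "A = U * real_diag N \<alpha> * mat_adjoint U"
  shows "trace_norm A = (\<Sum>i<N. \<bar>\<alpha> i\<bar>)"
proof -
  have A': "A \<in> carrier_mat N N" using U(1) A by auto
  have "mat_adjoint A * A = U * (real_diag N \<alpha> * (mat_adjoint U * U) * real_diag N \<alpha>) * mat_adjoint U"
    using U(1) unfolding A by (simp add: adj_mult mult_assoc_dim)
  also have "\<dots> = U * real_diag N (\<lambda>i. \<alpha> i * \<alpha> i) * mat_adjoint U"
    unfolding U(2) by (simp add: real_diag_mult)
  finally show ?thesis
    using trace_norm_eq_sum_sqrt[OF _ U, of A "\<lambda>i. \<alpha> i * \<alpha> i"] A' by simp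
qed

text \<open>For Hermitian \<open>C\<close> this says that the operator norm is at most 1. The
  version with forms is immediate for 2P - I and passes to \<open>E\<^sup>* C E\<close> for every
  contraction \<open>E\<close>.\<close>

definition contraction_form :: "nat \<Rightarrow> complex mat \<Rightarrow> bool" where
  "contraction_form N C \<longleftrightarrow> C \<in> carrier_mat N N \<and>
     (\<forall>f. \<bar>Re (quad_form N C f)\<bar> \<le> (\<Sum>i<N. (cmod (f i))\<^sup>2))"

text \<open>In an eigenbasis of \<open>A\<close> the trace is a sum of eigenvalues weighted by
  values of the form of \<open>C\<close> at unit vectors, and these weights lie between -1 and
  1.\<close>

lemma trace_norm_ge:
  assumes C: "contraction_form N C" and h: "hermitian_mat N A"
  shows "Re (mat_trace (C * A)) \<le> trace_norm A"
proof -
  obtain U \<alpha> where U: "U \<in> carrier_mat N N" "mat_adjoint U * U = 1\<^sub>m N" "U * mat_adjoint U = 1\<^sub>m N"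
    and A: "A = U * real_diag N \<alpha> * mat_adjoint U"
    using spectral_theorem[OF h] .
  have "Re (mat_trace (C * A)) = (\<Sum>i<N. \<alpha> i * Re (quad_form N C (\<lambda>j. U $$ (j, i))))"
    using C U unfolding A contraction_form_def by (simp add: trace_mult_spectral)
  also have "\<dots> \<le> (\<Sum>i<N. \<bar>\<alpha> i\<bar>)"
  proof (intro sum_mono)
    fix i assume "i \<in> {..<N}"
    then have "\<bar>Re (quad_form N C (\<lambda>j. U $$ (j, i)))\<bar> \<le> 1"
      using C unitary_col_norm[OF U(1,2)] unfolding contraction_form_def by (metis lessThan_iff)
    then have "\<bar>\<alpha> i * Re (quad_form N C (\<lambda>j. U $$ (j, i)))\<bar> \<le> \<bar>\<alpha> i\<bar>"
      by (simp add: abs_mult mult_left_le)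
    then show "\<alpha> i * Re (quad_form N C (\<lambda>j. U $$ (j, i))) \<le> \<bar>\<alpha> i\<bar>" by linarith
  qed
  also have "\<dots> = trace_norm A" using trace_norm_hermitian[OF U A] by simp
  finally show ?thesis .
qed

lemma trace_spectral:
  assumes "U \<in> carrier_mat N N" "mat_adjoint U * U = 1\<^sub>m N"
  shows "mat_trace (U * real_diag N \<alpha> * mat_adjoint U) = of_real (\<Sum>i<N. \<alpha> i)"
  using assms trace_mult_spectral[OF one_carrier_mat assms(1), of \<alpha>]
  by (simp add: quad_form_one unitary_col_norm mult_assoc_dim)

lemma trace_norm_psd:
  assumes "psd_mat N A"
  shows "trace_norm A = Re (mat_trace A)"
proof -
  obtain U \<alpha> where U: "U \<in> carrier_mat N N" "mat_adjoint U * U = 1\<^sub>m N" "U * mat_adjoint U = 1\<^sub>m N"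
    and A: "A = U * real_diag N \<alpha> * mat_adjoint U"
    using spectral_theorem[OF psd_hermitian[OF assms]] .
  have "0 \<le> \<alpha> i" if "i < N" for i using spectral_nonneg[OF assms U(1,2) A that] .
  then show ?thesis
    using trace_norm_hermitian[OF U A] trace_spectral[OF U(1,2), of \<alpha>] A by simp
qed

lemma frobenius_trace:
  assumes "A \<in> carrier_mat M N"
  shows "mat_trace (mat_adjoint A * A) = of_real (\<Sum>j<N. \<Sum>i<M. (cmod (A $$ (i, j)))\<^sup>2)"
  using assms by (subst trace_mult_sum)
    (auto simp: complex_norm_square[symmetric] mult.commute)

text \<open>The numbers \<beta> are the squared singular values. Their square roots sum to the trace
  norm and they themselves sum to the squared Frobenius norm, which is how entries and trace norm
  are compared in both directions.\<close>

lemma trace_norm_frobenius: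
  assumes A: "A \<in> carrier_mat N N"
  obtains \<beta> where "\<And>i. i < N \<Longrightarrow> 0 \<le> \<beta> i" "trace_norm A = (\<Sum>i<N. sqrt (\<beta> i))"
    "(\<Sum>i<N. \<beta> i) = (\<Sum>j<N. \<Sum>i<N. (cmod (A $$ (i, j)))\<^sup>2)"
proof -
  have p: "psd_mat N (mat_adjoint A * A)" using psd_gram[of "mat_adjoint A" N N] A by auto
  obtain U \<beta> where U: "U \<in> carrier_mat N N" "mat_adjoint U * U = 1\<^sub>m N" "U * mat_adjoint U = 1\<^sub>m N"
    and AA: "mat_adjoint A * A = U * real_diag N \<beta> * mat_adjoint U"
    using spectral_theorem[OF psd_hermitian[OF p]] .
  have "complex_of_real (\<Sum>i<N. \<beta> i) = of_real (\<Sum>j<N. \<Sum>i<N. (cmod (A $$ (i, j)))\<^sup>2)"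
    using trace_spectral[OF U(1,2), of \<beta>] frobenius_trace[OF A] AA by simp
  then have "(\<Sum>i<N. \<beta> i) = (\<Sum>j<N. \<Sum>i<N. (cmod (A $$ (i, j)))\<^sup>2)"
    using of_real_eq_iff by blast
  then show ?thesis
    using that[of \<beta>] spectral_nonneg[OF p U(1,2) AA] trace_norm_eq_sum_sqrt[OF A U AA] by blast
qed

text \<open>An entry is bounded by the Frobenius norm, and a sum of squares of nonnegative numbers
  is at most the square of their sum.\<close>

lemma cmod_entry_le_trace_norm:
  assumes A: "A \<in> carrier_mat N N" and ij: "i < N" "j < N"
  shows "cmod (A $$ (i, j)) \<le> trace_norm A"
proof -
  obtain \<beta> where \<beta>: "\<And>i. i < N \<Longrightarrow> 0 \<le> \<beta> i" "trace_norm A = (\<Sum>i<N. sqrt (\<beta> i))"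
    "(\<Sum>i<N. \<beta> i) = (\<Sum>j<N. \<Sum>i<N. (cmod (A $$ (i, j)))\<^sup>2)"
    using trace_norm_frobenius[OF A] by blast
  have nn: "0 \<le> trace_norm A" unfolding \<beta> using \<beta>(1) by (auto intro!: sum_nonneg)
  have "(cmod (A $$ (i, j)))\<^sup>2 \<le> (\<Sum>j<N. \<Sum>i<N. (cmod (A $$ (i, j)))\<^sup>2)"
    using ij by (intro member_le_double_sum[where g = "\<lambda>j i. (cmod (A $$ (i, j)))\<^sup>2"]) auto
  also have "\<dots> = (\<Sum>i<N. (sqrt (\<beta> i))\<^sup>2)" using \<beta> by simp
  also have "\<dots> \<le> (\<Sum>i<N. sqrt (\<beta> i) * trace_norm A)"
  proof (intro sum_mono)
    fix k assume k: "k \<in> {..<N}"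
    have "sqrt (\<beta> k) \<le> trace_norm A"
      unfolding \<beta> using k \<beta>(1) by (intro member_le_sum) auto
    then show "(sqrt (\<beta> k))\<^sup>2 \<le> sqrt (\<beta> k) * trace_norm A"
      using \<beta>(1) k by (auto simp: power2_eq_square intro!: mult_left_mono simp del: real_sqrt_mult_self)
  qed
  also have "\<dots> = (trace_norm A)\<^sup>2"
    by (simp add: sum_distrib_right[symmetric] \<beta>(2) power2_eq_square)
  finally show ?thesis using nn by (rule power2_le_imp_le)
qed

text \<open>Each singular value is at most the Frobenius norm, hence at most \<open>N b\<close>, and
  there are \<open>N\<close> of them. The crude constant suffices to show that a supremum is
  finite.\<close>

lemma trace_norm_le_entries:
  assumes A: "A \<in> carrier_mat N N" and b: "\<And>i j. i < N \<Longrightarrow> j < N \<Longrightarrow> cmod (A $$ (i, j)) \<le> b"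
    and b0: "0 \<le> b"
  shows "trace_norm A \<le> real N * (real N * b)"
proof -
  obtain \<beta> where \<beta>: "\<And>i. i < N \<Longrightarrow> 0 \<le> \<beta> i" "trace_norm A = (\<Sum>i<N. sqrt (\<beta> i))"
    "(\<Sum>i<N. \<beta> i) = (\<Sum>j<N. \<Sum>i<N. (cmod (A $$ (i, j)))\<^sup>2)"
    using trace_norm_frobenius[OF A] by blast
  have "(\<Sum>j<N. \<Sum>i<N. (cmod (A $$ (i, j)))\<^sup>2) \<le> (\<Sum>j<N. \<Sum>i<N. b\<^sup>2)"
    using b by (intro sum_mono power_mono) auto
  also have "\<dots> = (real N * b)\<^sup>2" by (simp add: power2_eq_square)
  finally have s: "(\<Sum>i<N. \<beta> i) \<le> (real N * b)\<^sup>2" using \<beta>(3) by simp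
  have "trace_norm A \<le> (\<Sum>i<N. real N * b)"
    unfolding \<beta>(2)
  proof (intro sum_mono real_le_lsqrt)
    fix i assume i: "i \<in> {..<N}"
    have "\<beta> i \<le> (\<Sum>i<N. \<beta> i)" using i \<beta>(1) by (intro member_le_sum) auto
    then show "\<beta> i \<le> (real N * b)\<^sup>2" using s by linarith
  qed (use b0 in auto)
  then show ?thesis by simp
qed

section \<open>Entrywise bounds and finiteness of the map norm\<close>

lemma mat_linear_mapD:
  assumes "mat_linear_map n \<Phi>"
  shows "X \<in> carrier_mat n n \<Longrightarrow> \<Phi> X \<in> carrier_mat n n"
    and "X \<in> carrier_mat n n \<Longrightarrow> Y \<in> carrier_mat n n \<Longrightarrow> \<Phi> (X + Y) = \<Phi> X + \<Phi> Y"
    and "X \<in> carrier_mat n n \<Longrightarrow> \<Phi> (a \<cdot>\<^sub>m X) = a \<cdot>\<^sub>m \<Phi> X"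
  using assms by (auto simp: mat_linear_map_iff)

lemma linear_map_entry:
  assumes \<Phi>: "mat_linear_map n \<Phi>" and Y: "Y \<in> carrier_mat n n" and kl: "k < n" "l < n"
  shows "\<Phi> Y $$ (k, l) = (\<Sum>p \<in> {..<n} \<times> {..<n}. Y $$ p * \<Phi> (unit_mat n p) $$ (k, l))"
proof (rule linear_functional_expand[OF _ _ Y])
  fix A B :: "complex mat" assume AB: "A \<in> carrier_mat n n" "B \<in> carrier_mat n n"
  then show "\<Phi> (A + B) $$ (k, l) = \<Phi> A $$ (k, l) + \<Phi> B $$ (k, l)"
    using mat_linear_mapD(1)[OF \<Phi> AB(2)] kl by (simp add: mat_linear_mapD(2)[OF \<Phi>])
next
  fix a and A :: "complex mat" assume A: "A \<in> carrier_mat n n"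
  then show "\<Phi> (a \<cdot>\<^sub>m A) $$ (k, l) = a * \<Phi> A $$ (k, l)"
    using mat_linear_mapD(1)[OF \<Phi> A] kl by (simp add: mat_linear_mapD(3)[OF \<Phi>])
qed

lemma linear_map_entry_bound:
  assumes \<Phi>: "mat_linear_map n \<Phi>"
  obtains K where "0 \<le> K"
    "\<And>Y k l. Y \<in> carrier_mat n n \<Longrightarrow> (\<And>i j. i < n \<Longrightarrow> j < n \<Longrightarrow> cmod (Y $$ (i, j)) \<le> 1) \<Longrightarrow>
      k < n \<Longrightarrow> l < n \<Longrightarrow> cmod (\<Phi> Y $$ (k, l)) \<le> K"
proof -
  define c where "c k l = (\<Sum>p \<in> {..<n} \<times> {..<n}. cmod (\<Phi> (unit_mat n p) $$ (k, l)))" for k l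
  define K where "K = (\<Sum>k<n. \<Sum>l<n. c k l)"
  have c0: "0 \<le> c k l" for k l by (simp add: c_def sum_nonneg)
  have "cmod (\<Phi> Y $$ (k, l)) \<le> K"
    if Y: "Y \<in> carrier_mat n n" and b: "\<And>i j. i < n \<Longrightarrow> j < n \<Longrightarrow> cmod (Y $$ (i, j)) \<le> 1"
      and kl: "k < n" "l < n" for Y k l
  proof -
    have "cmod (\<Phi> Y $$ (k, l)) \<le> c k l"
      unfolding linear_map_entry[OF \<Phi> Y kl] c_def
    proof (rule order_trans[OF norm_sum], rule sum_mono)
      fix p assume "p \<in> {..<n} \<times> {..<n}"
      then have "cmod (Y $$ p) \<le> 1" using b by (cases p) auto
      then show "cmod (Y $$ p * \<Phi> (unit_mat n p) $$ (k, l)) \<le> cmod (\<Phi> (unit_mat n p) $$ (k, l))"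
        by (simp add: norm_mult mult_left_le_one_le)
    qed
    also have "\<dots> \<le> K" unfolding K_def by (rule member_le_double_sum[OF kl c0])
    finally show ?thesis .
  qed
  then show ?thesis using that[of K] c0 by (simp add: K_def sum_nonneg)
qed

lemma mat_block_carrier [simp]: "mat_block n X i j \<in> carrier_mat n n"
  by (simp add: mat_block_def)

lemma mult_add_less: "i < m \<Longrightarrow> k < n \<Longrightarrow> i * n + k < m * n" for i k m n :: nat
proof -
  assume "i < m" "k < n"
  then have "i * n + k < (i + 1) * n" by simp
  also have "\<dots> \<le> m * n" using \<open>i < m\<close> by (intro mult_le_mono1) auto
  finally show ?thesis .
qed

lemma id_tensor_carrier [simp]: "id_tensor m n \<Phi> X \<in> carrier_mat (m * n) (m * n)"
  by (simp add: id_tensor_def)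

text \<open>A real \<open>Sup\<close> is an upper bound only for a set that is bounded above. Trace
  norm at most 1 forces entries of modulus at most 1, so the entries of all images share a bound
  \<open>K\<close>, and with them the trace norms.\<close>

lemma trace_norm_le_map_norm:
  assumes \<Phi>: "mat_linear_map n \<Phi>" and X: "X \<in> carrier_mat (m * n) (m * n)" "trace_norm X \<le> 1"
  shows "trace_norm (id_tensor m n \<Phi> X) \<le> map_norm m n \<Phi>"
  unfolding map_norm_def
proof (rule cSup_upper)
  show "trace_norm (id_tensor m n \<Phi> X) \<in> {trace_norm (id_tensor m n \<Phi> X) | X.
     X \<in> carrier_mat (m * n) (m * n) \<and> trace_norm X \<le> 1}" using X by blast
  obtain K where K: "0 \<le> K"
    "\<And>Y k l. Y \<in> carrier_mat n n \<Longrightarrow> (\<And>i j. i < n \<Longrightarrow> j < n \<Longrightarrow> cmod (Y $$ (i, j)) \<le> 1) \<Longrightarrow>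
      k < n \<Longrightarrow> l < n \<Longrightarrow> cmod (\<Phi> Y $$ (k, l)) \<le> K"
    using linear_map_entry_bound[OF \<Phi>] by blast
  show "bdd_above {trace_norm (id_tensor m n \<Phi> X) | X.
     X \<in> carrier_mat (m * n) (m * n) \<and> trace_norm X \<le> 1}"
  proof (rule bdd_aboveI, safe)
    fix X assume X: "X \<in> carrier_mat (m * n) (m * n)" "trace_norm X \<le> 1"
    have e: "cmod (mat_block n X i j $$ (k, l)) \<le> 1" if "i < m" "j < m" "k < n" "l < n" for i j k l
    proof -
      have "cmod (X $$ (i * n + k, j * n + l)) \<le> trace_norm X"
        using that by (intro cmod_entry_le_trace_norm[OF X(1)] mult_add_less)
      then show ?thesis using X that by (simp add: mat_block_def)
    qed
    show "trace_norm (id_tensor m n \<Phi> X) \<le> real (m * n) * (real (m * n) * K)"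
    proof (rule trace_norm_le_entries)
      fix r c assume rc: "r < m * n" "c < m * n"
      then have n: "0 < n" by (cases n) auto
      have d: "r div n < m" "c div n < m" using rc by (auto simp: less_mult_imp_div_less)
      show "cmod (id_tensor m n \<Phi> X $$ (r, c)) \<le> K"
        using rc n K(2)[OF mat_block_carrier e[OF d]] by (simp add: id_tensor_def)
    qed (use K in auto)
  qed
qed

section \<open>Separation from the positive semidefinite cone\<close>

lemma real_diag_one: "(\<And>i. i < N \<Longrightarrow> \<alpha> i = 1) \<Longrightarrow> real_diag N \<alpha> = 1\<^sub>m N"
  by (rule eq_matI) (auto simp: real_diag_index)

text \<open>With the spectral form of \<open>G\<close>, \<open>R\<close> is \<open>U\<close> times
  the diagonal of the values 1 / sqrt \<alpha>, and \<open>R'\<close> is its inverse. Every later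
  argument rests on the listed identities alone, so \<open>R\<close> is determined only up to a
  unitary factor on the right.\<close>

lemma positive_definite_inverse_sqrt:
  assumes h: "hermitian_mat N G"
    and pos: "\<And>f. (\<exists>i<N. f i \<noteq> 0) \<Longrightarrow> 0 < Re (quad_form N G f)"
  obtains R R' where "R \<in> carrier_mat N N" "R' \<in> carrier_mat N N" "R * R' = 1\<^sub>m N" "R' * R = 1\<^sub>m N"
    "mat_adjoint R * G * R = 1\<^sub>m N" "G = mat_adjoint R' * R'"
proof -
  obtain U \<alpha> where U: "U \<in> carrier_mat N N" "mat_adjoint U * U = 1\<^sub>m N" "U * mat_adjoint U = 1\<^sub>m N"
    and G: "G = U * real_diag N \<alpha> * mat_adjoint U"
    using spectral_theorem[OF h] .
  have UD: "mat_adjoint U * (U * X) = X" if "dim_row X = N" for X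
  proof -
    have "X \<in> carrier_mat N (dim_col X)" using that by auto
    then have "(mat_adjoint U * U) * X = X" unfolding U(2) by simp
    then show ?thesis using U(1) that by (simp add: mult_assoc_dim)
  qed
  have \<alpha>: "\<alpha> i > 0" if i: "i < N" for i
  proof -
    have "\<exists>j<N. U $$ (j, i) \<noteq> 0"
    proof (rule ccontr)
      assume "\<not> ?thesis"
      then have "(\<Sum>j<N. (cmod (U $$ (j, i)))\<^sup>2) = 0" by simp
      then show False using unitary_col_norm[OF U(1,2) i] by simp
    qed
    then have q: "0 < Re (quad_form N G (\<lambda>j. U $$ (j, i)))" by (rule pos)
    have d: "real_diag N \<alpha> = mat_adjoint U * G * mat_adjoint (mat_adjoint U)"
      using U by (simp add: G mult_assoc_dim UD)
    have "of_real (\<alpha> i) = quad_form N (mat_adjoint U * G * mat_adjoint (mat_adjoint U))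
        (\<lambda>k. if k = i then 1 else 0)"
      unfolding d[symmetric] using quad_form_unit[OF i, of "real_diag N \<alpha>"] i
      by (simp add: real_diag_index)
    also have "\<dots> = quad_form N G (\<lambda>j. \<Sum>k<N. cnj (mat_adjoint U $$ (k, j)) * (if k = i then 1 else 0))"
      using U hermitian_carrier[OF h] by (intro quad_form_conj) auto
    also have "\<dots> = quad_form N G (\<lambda>j. U $$ (j, i))"
      using U(1) i unfolding quad_form_def
      by (simp add: if_distrib[of "\<lambda>x. _ * x"] cong: if_cong)
    finally show ?thesis using q by (metis Re_complex_of_real)
  qed
  define R where "R = U * real_diag N (\<lambda>i. 1 / sqrt (\<alpha> i))"
  define R' where "R' = real_diag N (\<lambda>i. sqrt (\<alpha> i)) * mat_adjoint U"
  have c: "R \<in> carrier_mat N N" "R' \<in> carrier_mat N N" using U(1) by (auto simp: R_def R'_def)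
  have "R' * R = real_diag N (\<lambda>i. sqrt (\<alpha> i)) * (mat_adjoint U * U) * real_diag N (\<lambda>i. 1 / sqrt (\<alpha> i))"
    using U(1) by (simp add: R_def R'_def mult_assoc_dim)
  also have "\<dots> = 1\<^sub>m N"
    using \<alpha> unfolding U(2) by (simp add: real_diag_mult) (rule real_diag_one, fastforce)
  finally have 1: "R' * R = 1\<^sub>m N" .
  have 2: "R * R' = 1\<^sub>m N" using mat_mult_left_right_inverse[OF c(2,1) 1] .
  have "mat_adjoint R * G * R =
     real_diag N (\<lambda>i. 1 / sqrt (\<alpha> i)) * (real_diag N \<alpha> * real_diag N (\<lambda>i. 1 / sqrt (\<alpha> i)))"
    using U(1) by (simp add: R_def G adj_mult mult_assoc_dim UD)
  also have "\<dots> = 1\<^sub>m N"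
  proof -
    have "1 / sqrt (\<alpha> i) * (\<alpha> i * (1 / sqrt (\<alpha> i))) = 1" if "i < N" for i
      using \<alpha>[OF that] by (simp add: real_div_sqrt)
    then show ?thesis by (simp add: real_diag_mult real_diag_one)
  qed
  finally have 3: "mat_adjoint R * G * R = 1\<^sub>m N" .
  have GC: "G \<in> carrier_mat N N" using hermitian_carrier[OF h] .
  have "mat_adjoint R' * R' = mat_adjoint R' * (mat_adjoint R * G * R) * R'"
    unfolding 3 using c by simp
  also have "\<dots> = mat_adjoint (R * R') * G * (R * R')"
    using c GC by (simp add: adj_mult mult_assoc_dim)
  also have "\<dots> = G" unfolding 2 using GC by simp
  finally show ?thesis using that[OF c 2 1 3] by simp
qed

section \<open>Density matrices and bounds for functionals on them\<close>

lemma density_psd: "density_matrix N \<rho> \<Longrightarrow> psd_mat N \<rho>"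
  and density_trace: "density_matrix N \<rho> \<Longrightarrow> mat_trace \<rho> = 1"
  and density_carrier: "density_matrix N \<rho> \<Longrightarrow> \<rho> \<in> carrier_mat N N"
  by (auto simp: density_matrix_def psd_carrier)

lemma psd_normalize:
  assumes "psd_mat N W" "0 < Re (mat_trace W)"
  shows "density_matrix N (complex_of_real (1 / Re (mat_trace W)) \<cdot>\<^sub>m W)"
  using assms psd_smult[OF assms(1), of "1 / Re (mat_trace W)"]
    hermitian_trace_of_real[OF psd_hermitian[OF assms(1)]]
  by (simp add: density_matrix_def mat_trace_smult[OF psd_carrier[OF assms(1)]])
    (metis div_by_1 divide_self_if less_irrefl of_real_eq_0_iff)

lemma density_entry_le_1:
  assumes "density_matrix N \<rho>" "i < N" "j < N"
  shows "cmod (\<rho> $$ (i, j)) \<le> 1"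
  using cmod_entry_le_trace_norm[OF density_carrier[OF assms(1)] assms(2,3)]
    trace_norm_psd[OF density_psd[OF assms(1)]] density_trace[OF assms(1)] by simp

lemma psd_convex:
  assumes "psd_mat N A" "psd_mat N B" "0 \<le> s" "s \<le> 1"
  shows "psd_mat N (complex_of_real (1 - s) \<cdot>\<^sub>m A + complex_of_real s \<cdot>\<^sub>m B)"
  using assms by (intro psd_add psd_smult) auto

lemma density_convex:
  assumes "density_matrix N A" "density_matrix N B" "0 \<le> s" "s \<le> 1"
  shows "density_matrix N (complex_of_real (1 - s) \<cdot>\<^sub>m A + complex_of_real s \<cdot>\<^sub>m B)"
  using assms psd_convex[OF density_psd density_psd, of N A B s]
  by (auto simp: density_matrix_def mat_trace_add[of _ N] mat_trace_smult[of _ N] psd_carrier)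

lemma density_exists:
  assumes "0 < N"
  shows "density_matrix N (complex_of_real (1 / real N) \<cdot>\<^sub>m 1\<^sub>m N)"
  using assms psd_smult[OF psd_one, of "1 / real N" N]
  by (simp add: density_matrix_def mat_trace_smult[of _ N] trace_one)

text \<open>Entries of a density matrix have modulus at most 1, so the coefficients on the matrix
  units bound the functional uniformly over all states.\<close>

lemma linear_functional_bound:
  fixes f :: "complex mat \<Rightarrow> complex"
  assumes "\<And>X Y. X \<in> carrier_mat n n \<Longrightarrow> Y \<in> carrier_mat n n \<Longrightarrow> f (X + Y) = f X + f Y"
    and "\<And>a X. X \<in> carrier_mat n n \<Longrightarrow> f (a \<cdot>\<^sub>m X) = a * f X"
    and Y: "density_matrix n Y"
  shows "cmod (f Y) \<le> (\<Sum>p \<in> {..<n} \<times> {..<n}. cmod (f (unit_mat n p)))"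
proof -
  have "f Y = (\<Sum>p \<in> {..<n} \<times> {..<n}. Y $$ p * f (unit_mat n p))"
    by (rule linear_functional_expand[OF _ _ density_carrier[OF Y]]) (use assms in auto)
  also have "cmod \<dots> \<le> (\<Sum>p \<in> {..<n} \<times> {..<n}. cmod (f (unit_mat n p)))"
  proof (rule order_trans[OF norm_sum], rule sum_mono)
    fix p assume "p \<in> {..<n} \<times> {..<n}"
    then have "cmod (Y $$ p) \<le> 1" using density_entry_le_1[OF Y] by (cases p) auto
    then show "cmod (Y $$ p * f (unit_mat n p)) \<le> cmod (f (unit_mat n p))"
      by (simp add: norm_mult mult_left_le_one_le)
  qed
  finally show ?thesis .
qed

text \<open>Tychonoff's theorem for the topology of pointwise convergence. Pairs of matrices are
  coded as such functions in the minimization below.\<close>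

lemma compact_coordinate_box:
  fixes B :: "'a \<Rightarrow> complex set"
  assumes "\<And>p. compact (B p)"
  shows "compact {h. \<forall>p. h p \<in> B p}"
proof -
  have "compactin (product_topology (\<lambda>p::'a. euclidean :: complex topology) UNIV) (PiE UNIV B)"
    using assms by (subst compactin_PiE) auto
  then show ?thesis
    by (simp add: euclidean_product_topology PiE_UNIV_domain Pi_def)
qed

lemma compact_complex_square: "compact {z. \<bar>Re z\<bar> \<le> r \<and> \<bar>Im z\<bar> \<le> r}"
proof -
  have "compact ((\<lambda>p. of_real (fst p) + \<i> * of_real (snd p)) ` ({-r..r} \<times> {-r..r}))"
    by (intro compact_continuous_image compact_Times compact_Icc continuous_intros)
  also have "(\<lambda>p. of_real (fst p) + \<i> * of_real (snd p)) ` ({-r..r} \<times> {-r..r}) =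
      {z. \<bar>Re z\<bar> \<le> r \<and> \<bar>Im z\<bar> \<le> r}" (is "?f ` ?A = ?B")
  proof (intro equalityI subsetI)
    fix z assume "z \<in> ?B"
    then have "(Re z, Im z) \<in> ?A" by auto
    moreover have "z = ?f (Re z, Im z)" by (simp add: complex_eq_iff)
    ultimately show "z \<in> ?f ` ?A" by blast
  qed auto
  finally show ?thesis .
qed

lemma continuous_on_coordinate [continuous_intros]:
  "continuous_on S (\<lambda>h :: 'a \<Rightarrow> complex. h p)"
  by (rule continuous_on_subset[OF continuous_on_product_coordinates]) auto

lemma psd_mat_mat_iff:
  "psd_mat N (mat N N g) \<longleftrightarrow> (\<forall>i j. i < N \<longrightarrow> j < N \<longrightarrow> cnj (g (i, j)) = g (j, i)) \<and>
    (\<forall>f. 0 \<le> Re (\<Sum>i<N. \<Sum>j<N. cnj (f i) * g (i, j) * f j))"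
proof -
  have "hermitian_mat N (mat N N g) \<longleftrightarrow> (\<forall>i j. i < N \<longrightarrow> j < N \<longrightarrow> cnj (g (i, j)) = g (j, i))"
    using hermitian_index[of N "mat N N g"] by (auto intro!: hermitian_matI)
  then show ?thesis by (simp add: psd_mat_iff quad_form_def)
qed

text \<open>Positive semidefiniteness is an intersection of closed conditions, one for each pair of
  indices and each test vector, and each involves finitely many coordinates.\<close>

lemma closed_psd_coordinates:
  "closed {h :: 'a \<times> nat \<times> nat \<Rightarrow> complex. psd_mat N (mat N N (\<lambda>p. h (b, p)))}"
  unfolding psd_mat_mat_iff
  by (intro closed_Collect_conj closed_Collect_all closed_Collect_imp closed_Collect_le
      closed_Collect_eq open_Collect_const continuous_intros)

text \<open>First-order condition for a squared norm along a segment: 2 b is the derivative at the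
  minimizing end, and a negative one would beat the quadratic term for small
  \<open>s\<close>.\<close>

lemma norm_square_min_variational:
  fixes b q :: real
  assumes "\<And>s. 0 < s \<Longrightarrow> s \<le> 1 \<Longrightarrow> 0 \<le> 2 * s * b + s\<^sup>2 * q" "0 \<le> q"
  shows "0 \<le> b"
proof (rule ccontr)
  assume "\<not> 0 \<le> b"
  then have b: "b < 0" by simp
  \<comment> \<open>Small enough that \<open>s q\<close> is at most -b, and capped at 1 to stay on
    the segment; the summand 1 keeps the denominator positive.\<close>
  define s where "s = min 1 (- b / (q + 1))"
  have s: "0 < s" "s \<le> 1" using b assms(2) by (auto simp: s_def divide_neg_pos)
  have "s * q \<le> - b / (q + 1) * q"
    using assms(2) by (intro mult_right_mono) (auto simp: s_def)
  also have "\<dots> \<le> - b" using b assms(2) by (simp add: divide_simps)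
  finally have "2 * b + s * q < 0" using b by linarith
  then have "s * (2 * b + s * q) < 0" using s by (simp add: mult_pos_neg)
  moreover have "s * (2 * b + s * q) = 2 * s * b + s\<^sup>2 * q"
    by (simp add: algebra_simps power2_eq_square)
  ultimately show False using assms(1)[OF s] by simp
qed

text \<open>Hahn--Banach in finite dimension: the functional is \<open>P - T W\<close> for the pair of a positive
  semidefinite \<open>P\<close> and a density matrix \<open>W\<close> at minimal Frobenius distance.\<close>

lemma separation_from_psd_cone:
  fixes T :: "complex mat \<Rightarrow> complex mat"
  assumes d: "0 < d"
    and T: "\<And>W. W \<in> carrier_mat d d \<Longrightarrow> T W \<in> carrier_mat N N"
    and T_add: "\<And>V W. V \<in> carrier_mat d d \<Longrightarrow> W \<in> carrier_mat d d \<Longrightarrow> T (V + W) = T V + T W"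
    and T_smult: "\<And>a W. W \<in> carrier_mat d d \<Longrightarrow> T (a \<cdot>\<^sub>m W) = a \<cdot>\<^sub>m T W"
    and T_herm: "\<And>W. density_matrix d W \<Longrightarrow> hermitian_mat N (T W)"
    and not_psd: "\<And>W. density_matrix d W \<Longrightarrow> \<not> psd_mat N (T W)"
  obtains D c where "psd_mat N D" "0 < c"
    "\<And>W. density_matrix d W \<Longrightarrow> Re (mat_trace (D * T W)) \<le> - c"
proof -
  define t where "t i j p = T (unit_mat d p) $$ (i, j)" for i j p
  have fun_add: "T (V + W) $$ (i, j) = T V $$ (i, j) + T W $$ (i, j)"
    if "i < N" "j < N" "V \<in> carrier_mat d d" "W \<in> carrier_mat d d" for i j V W
    using that T_add[OF that(3,4)] T[OF that(4)] by auto
  have fun_smult: "T (a \<cdot>\<^sub>m W) $$ (i, j) = a * T W $$ (i, j)"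
    if "i < N" "j < N" "W \<in> carrier_mat d d" for i j a W
    using that T_smult[OF that(3)] T[OF that(3)] by auto
  have T_entry: "T W $$ (i, j) = (\<Sum>p \<in> {..<d} \<times> {..<d}. W $$ p * t i j p)"
    if "i < N" "j < N" "W \<in> carrier_mat d d" for i j W
    unfolding t_def
    by (rule linear_functional_expand[where f = "\<lambda>W. T W $$ (i, j)", OF _ _ that(3)])
      (use that fun_add fun_smult in auto)
  define B where "B = (\<Sum>i<N. \<Sum>j<N. \<Sum>p \<in> {..<d} \<times> {..<d}. cmod (t i j p))"
  have B0: "0 \<le> B" by (simp add: B_def sum_nonneg)
  have B: "cmod (T W $$ (i, j)) \<le> B" if "i < N" "j < N" "density_matrix d W" for i j W
  proof -
    have "cmod (T W $$ (i, j)) \<le> (\<Sum>p \<in> {..<d} \<times> {..<d}. cmod (t i j p))"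
      unfolding t_def
      by (rule linear_functional_bound[where f = "\<lambda>W. T W $$ (i, j)", OF _ _ that(3)])
        (use that fun_add fun_smult in auto)
    also have "\<dots> \<le> B" unfolding B_def
      by (rule member_le_double_sum[OF that(1,2)]) (simp add: sum_nonneg)
    finally show ?thesis .
  qed
  define dist2 where "dist2 P W = (\<Sum>i<N. \<Sum>j<N. (cmod (P $$ (i, j) - T W $$ (i, j)))\<^sup>2)" for P W
  \<comment> \<open>If an entry of \<open>P\<close> exceeds \<open>M\<close> in modulus, then
    \<open>P\<close> is farther from \<open>T W\<close> than \<open>N B\<close>, and
    \<open>N B\<close> bounds the distance from the zero matrix to \<open>T W\<close>. Such
    \<open>P\<close> cannot improve the minimum, so a bounded box captures the whole cone.\<close>
  define M where "M = B + real N * B + 1"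
  define \<phi> where "\<phi> h = (\<Sum>i<N. \<Sum>j<N. (cmod (h (False, i, j) -
      (\<Sum>p \<in> {..<d} \<times> {..<d}. h (True, p) * t i j p)))\<^sup>2)" for h :: "bool \<times> nat \<times> nat \<Rightarrow> complex"
  have \<phi>: "\<phi> h = dist2 (mat N N (\<lambda>p. h (False, p))) (mat d d (\<lambda>p. h (True, p)))" for h
  proof -
    have "(\<Sum>p \<in> {..<d} \<times> {..<d}. mat d d (\<lambda>p. h (True, p)) $$ p * t i j p) =
        (\<Sum>p \<in> {..<d} \<times> {..<d}. h (True, p) * t i j p)" for i j
      by (intro sum.cong) auto
    then show ?thesis
      unfolding \<phi>_def dist2_def by (intro sum.cong refl) (auto simp: T_entry)
  qed
  \<comment> \<open>A pair (P, W) is one function: \<open>False\<close> marks the coordinates of P,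
    \<open>True\<close> those of W. The box bounds them by \<open>M\<close> and by 1
    respectively.\<close>
  define K where "K = {h :: bool \<times> nat \<times> nat \<Rightarrow> complex. \<forall>p. h p \<in> {z. \<bar>Re z\<bar> \<le> (if fst p then 1 else M) \<and> \<bar>Im z\<bar> \<le> (if fst p then 1 else M)}} \<inter>
    {h. psd_mat d (mat d d (\<lambda>p. h (True, p))) \<and> psd_mat N (mat N N (\<lambda>p. h (False, p))) \<and>
        (\<Sum>i<d. h (True, i, i)) = 1}"
  have "compact K" unfolding K_def
    by (intro compact_Int_closed compact_coordinate_box closed_Collect_conj closed_psd_coordinates
        closed_Collect_eq continuous_intros compact_complex_square)
  \<comment> \<open>Coordinates lying outside the two matrices are set to 0, which meets the box
    constraint.\<close>
  define enc where "enc P W = (\<lambda>(b, i, j). if b then if i < d \<and> j < d then W $$ (i, j) else 0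
      else if i < N \<and> j < N then P $$ (i, j) else 0)" for P W :: "complex mat"
  have enc1: "mat d d (\<lambda>p. enc P W (True, p)) = W" if "W \<in> carrier_mat d d" for P W
    using that by (intro eq_matI) (auto simp: enc_def)
  have enc2: "mat N N (\<lambda>p. enc P W (False, p)) = P" if "P \<in> carrier_mat N N" for P W
    using that by (intro eq_matI) (auto simp: enc_def)
  have M0: "0 \<le> M" using B0 by (simp add: M_def)
  have encK: "enc P W \<in> K"
    if "psd_mat N P" "density_matrix d W" "\<And>i j. i < N \<Longrightarrow> j < N \<Longrightarrow> cmod (P $$ (i, j)) \<le> M" for P W
  proof -
    have "(\<Sum>i<d. enc P W (True, i, i)) = 1"
      using density_trace[OF that(2)] density_carrier[OF that(2)] by (simp add: enc_def mat_trace_def)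
    moreover have "\<forall>p. enc P W p \<in> {z. \<bar>Re z\<bar> \<le> (if fst p then 1 else M) \<and> \<bar>Im z\<bar> \<le> (if fst p then 1 else M)}"
      using that(3) density_entry_le_1[OF that(2)] M0
        order_trans[OF abs_Re_le_cmod] order_trans[OF abs_Im_le_cmod] by (auto simp: enc_def)
    ultimately show ?thesis
      using that psd_carrier[OF that(1)] density_carrier[OF that(2)]
      unfolding K_def by (simp add: enc1 enc2 density_psd)
  qed
  have psd0: "psd_mat N (0\<^sub>m N N)"
  proof -
    have "complex_of_real 0 \<cdot>\<^sub>m 1\<^sub>m N = 0\<^sub>m N N" by (intro eq_matI) auto
    then show ?thesis using psd_smult[OF psd_one[of N], of 0] by simp
  qed
  obtain W1 where W1: "density_matrix d W1" using density_exists[OF d] by blast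
  have "continuous_on K \<phi>" unfolding \<phi>_def by (intro continuous_intros)
  moreover have "K \<noteq> {}" using encK[OF psd0 W1] M0 by auto
  ultimately obtain h0 where h0: "h0 \<in> K" "\<And>h. h \<in> K \<Longrightarrow> \<phi> h0 \<le> \<phi> h"
    using continuous_attains_inf[OF \<open>compact K\<close>] by blast
  define P0 where "P0 = mat N N (\<lambda>p. h0 (False, p))"
  define W0 where "W0 = mat d d (\<lambda>p. h0 (True, p))"
  have P0: "psd_mat N P0" and W0: "density_matrix d W0"
    using h0(1) by (auto simp: K_def P0_def W0_def density_matrix_def mat_trace_def)
  have P0c: "P0 \<in> carrier_mat N N" and W0c: "W0 \<in> carrier_mat d d" by (auto simp: P0_def W0_def)
  have box: "dist2 P0 W0 \<le> dist2 P W"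
    if "psd_mat N P" "density_matrix d W" "\<And>i j. i < N \<Longrightarrow> j < N \<Longrightarrow> cmod (P $$ (i, j)) \<le> M" for P W
    using h0(2)[OF encK[OF that]] psd_carrier[OF that(1)] density_carrier[OF that(2)]
    by (simp add: \<phi> enc1 enc2 P0_def W0_def)
  have min: "dist2 P0 W0 \<le> dist2 P W" if P: "psd_mat N P" and W: "density_matrix d W" for P W
  proof (cases "\<forall>i j. i < N \<longrightarrow> j < N \<longrightarrow> cmod (P $$ (i, j)) \<le> M")
    case True
    then show ?thesis using box[OF P W] by blast
  next
    case False
    then obtain i j where ij: "i < N" "j < N" "M < cmod (P $$ (i, j))" by force
    have "dist2 P0 W0 \<le> dist2 (0\<^sub>m N N) W" using M0 by (intro box[OF psd0 W]) auto
    also have "\<dots> \<le> (\<Sum>i<N. \<Sum>j<N. B\<^sup>2)"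
      unfolding dist2_def using B[OF _ _ W] by (intro sum_mono power_mono) auto
    also have "\<dots> = (real N * B)\<^sup>2" by (simp add: power2_eq_square)
    also have "\<dots> \<le> (cmod (P $$ (i, j) - T W $$ (i, j)))\<^sup>2"
    proof (rule power_mono)
      have "cmod (P $$ (i, j)) \<le> cmod (P $$ (i, j) - T W $$ (i, j)) + cmod (T W $$ (i, j))"
        using norm_triangle_ineq[of "P $$ (i, j) - T W $$ (i, j)" "T W $$ (i, j)"] by simp
      then show "real N * B \<le> cmod (P $$ (i, j) - T W $$ (i, j))"
        using ij B[OF ij(1,2) W] by (simp add: M_def)
    qed (use B0 in auto)
    also have "\<dots> \<le> dist2 P W" unfolding dist2_def
      by (rule member_le_double_sum[OF ij(1,2)]) simp
    finally show ?thesis .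
  qed
  define D where "D = P0 + (-1) \<cdot>\<^sub>m T W0"
  have TW0: "hermitian_mat N (T W0)" using T_herm[OF W0] .
  have D: "hermitian_mat N D"
    using hermitian_add[OF psd_hermitian[OF P0] hermitian_smult[OF TW0, of "-1"]] by (simp add: D_def)
  have Dc: "D \<in> carrier_mat N N" using hermitian_carrier[OF D] .
  have D_entry: "D $$ (i, j) = P0 $$ (i, j) - T W0 $$ (i, j)" if "i < N" "j < N" for i j
    using that P0c hermitian_carrier[OF TW0] by (simp add: D_def)
  define c where "c = (\<Sum>i<N. \<Sum>j<N. (cmod (D $$ (i, j)))\<^sup>2)"
  have c0: "0 \<le> c" by (auto simp: c_def intro!: sum_nonneg)
  \<comment> \<open>At distance 0 the matrix \<open>T W0\<close> would be the positive semidefinite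
    \<open>P0\<close>, which is excluded.\<close>
  have "c \<noteq> 0"
  proof
    assume "c = 0"
    then have "\<forall>i\<in>{..<N}. \<forall>j\<in>{..<N}. D $$ (i, j) = 0"
      unfolding c_def by (simp add: sum_nonneg_eq_0_iff sum_nonneg)
    then have "T W0 = P0"
      using P0c hermitian_carrier[OF TW0] by (intro eq_matI) (auto simp: D_entry)
    then show False using not_psd[OF W0] P0 by simp
  qed
  then have c: "0 < c" using c0 by simp
  have tr: "Re (mat_trace (D * Y)) = (\<Sum>i<N. \<Sum>j<N. Re (cnj (D $$ (i, j)) * Y $$ (i, j)))"
    if Y: "Y \<in> carrier_mat N N" for Y
  proof -
    have "mat_trace (D * Y) = mat_trace (Y * D)" using Y Dc by (intro trace_comm) auto
    also have "\<dots> = (\<Sum>i<N. \<Sum>j<N. cnj (D $$ (i, j)) * Y $$ (i, j))"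
      using Y Dc by (subst trace_mult_sum) (auto simp: hermitian_index[OF D] mult.commute)
    finally show ?thesis by simp
  qed
  \<comment> \<open>First-order condition at the minimum on the segment towards (P, W), which stays
    admissible by convexity: the inner product of \<open>D\<close> with P - T W - D is nonnegative,
    and that of \<open>D\<close> with itself is \<open>c\<close>.\<close>
  have key: "c \<le> Re (mat_trace (D * P)) - Re (mat_trace (D * T W))"
    if P: "psd_mat N P" and W: "density_matrix d W" for P W
  proof -
    have Pc: "P \<in> carrier_mat N N" and Wc: "W \<in> carrier_mat d d"
      using psd_carrier[OF P] density_carrier[OF W] by auto
    define z where "z i j = P $$ (i, j) - T W $$ (i, j) - D $$ (i, j)" for i j
    define b where "b = (\<Sum>i<N. \<Sum>j<N. Re (cnj (D $$ (i, j)) * z i j))"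
    define q where "q = (\<Sum>i<N. \<Sum>j<N. (cmod (z i j))\<^sup>2)"
    have sq: "(cmod (u + of_real s * w))\<^sup>2 = (cmod u)\<^sup>2 + 2 * s * Re (cnj u * w) + s\<^sup>2 * (cmod w)\<^sup>2"
      for u w :: complex and s :: real
      unfolding cmod_power2 by (simp add: power2_eq_square algebra_simps)
    have "0 \<le> b"
    proof (rule norm_square_min_variational)
      fix s :: real assume s: "0 < s" "s \<le> 1"
      let ?P = "complex_of_real (1 - s) \<cdot>\<^sub>m P0 + complex_of_real s \<cdot>\<^sub>m P"
      let ?W = "complex_of_real (1 - s) \<cdot>\<^sub>m W0 + complex_of_real s \<cdot>\<^sub>m W"
      have "?P $$ (i, j) - T ?W $$ (i, j) = D $$ (i, j) + of_real s * z i j" if "i < N" "j < N" for i j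
      proof -
        have "T ?W $$ (i, j) = of_real (1 - s) * T W0 $$ (i, j) + of_real s * T W $$ (i, j)"
          using that W0c Wc by (simp add: fun_add fun_smult)
        then show ?thesis using that P0c Pc by (simp add: z_def D_entry algebra_simps)
      qed
      then have "dist2 ?P ?W = (\<Sum>i<N. \<Sum>j<N. (cmod (D $$ (i, j) + of_real s * z i j))\<^sup>2)"
        unfolding dist2_def by (intro sum.cong) auto
      also have "\<dots> = c + 2 * s * b + s\<^sup>2 * q"
        by (simp only: sq sum.distrib sum_distrib_left c_def b_def q_def)
      finally have "c \<le> c + 2 * s * b + s\<^sup>2 * q"
        using min[OF psd_convex[OF P0 P, of s] density_convex[OF W0 W, of s]] s
        by (simp add: dist2_def c_def D_entry)
      then show "0 \<le> 2 * s * b + s\<^sup>2 * q" by simp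
    qed (auto simp: q_def intro!: sum_nonneg)
    also have "b = (\<Sum>i<N. \<Sum>j<N. Re (cnj (D $$ (i, j)) * P $$ (i, j)) -
        Re (cnj (D $$ (i, j)) * T W $$ (i, j)) - (cmod (D $$ (i, j)))\<^sup>2)"
      unfolding b_def
    proof (intro sum.cong refl)
      fix i j
      have "Re (cnj y * (a - e - y)) = Re (cnj y * a) - Re (cnj y * e) - (cmod y)\<^sup>2" for y a e :: complex
        unfolding cmod_power2 by (simp add: power2_eq_square algebra_simps)
      then show "Re (cnj (D $$ (i, j)) * z i j) = Re (cnj (D $$ (i, j)) * P $$ (i, j)) -
        Re (cnj (D $$ (i, j)) * T W $$ (i, j)) - (cmod (D $$ (i, j)))\<^sup>2"
        unfolding z_def by blast
    qed
    also have "\<dots> = Re (mat_trace (D * P)) - Re (mat_trace (D * T W)) - c"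
      unfolding tr[OF Pc] tr[OF T[OF Wc]] c_def by (simp only: sum_subtractf)
    finally show ?thesis by simp
  qed
  \<comment> \<open>The apex P = 0 of the cone gives the negative bound on the images of
    states.\<close>
  have neg: "Re (mat_trace (D * T W)) \<le> - c" if "density_matrix d W" for W
    using key[OF psd0 that] Dc by (simp add: mat_trace_def)
  have "0 \<le> Re (quad_form N D f)" for f
  proof (rule ccontr)
    assume "\<not> ?thesis"
    then have q: "Re (quad_form N D f) < 0" by simp
    \<comment> \<open>A large multiple of a rank-one matrix on which \<open>D\<close> were negative
      would violate the first-order condition. This \<open>r\<close> makes its contribution the
      negative of \<open>\<bar>Re (mat_trace (D * T W0))\<bar> + 1\<close>, so the right-hand side
      is at most -1.\<close>
    define r where "r = (\<bar>Re (mat_trace (D * T W0))\<bar> + 1) / (- Re (quad_form N D f))"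
    have r: "0 \<le> r" using q unfolding r_def by (intro divide_nonneg_pos) auto
    let ?F = "col_mat N f * mat_adjoint (col_mat N f)"
    have F: "psd_mat N ?F" using psd_gram[of "col_mat N f" N 1] by simp
    have Fc: "?F \<in> carrier_mat N N" using psd_carrier[OF F] .
    have "mat_trace (D * (complex_of_real r \<cdot>\<^sub>m ?F)) = of_real r * quad_form N D f"
      using quad_form_trace[OF Dc, of f] mult_smult_distrib[OF Dc Fc, of "of_real r"]
        mat_trace_smult[OF mult_carrier_mat[OF Dc Fc]] by metis
    then have "c \<le> r * Re (quad_form N D f) - Re (mat_trace (D * T W0))"
      using key[OF psd_smult[OF F r] W0] by simp
    moreover have "r * Re (quad_form N D f) = - (\<bar>Re (mat_trace (D * T W0))\<bar> + 1)"
      using q by (simp add: r_def)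
    ultimately show False using c by linarith
  qed
  then have "psd_mat N D" using D by (simp add: psd_mat_iff)
  then show ?thesis using that c neg by blast
qed

section \<open>Block matrices and tensor products\<close>

lemma sum_blocks: "(\<Sum>c<p * n. g c) = (\<Sum>a<p. \<Sum>k<n. g (a * n + k))" for p n :: nat
proof -
  have "(\<Sum>c<p * n. g c) = (\<Sum>(a, k) \<in> {..<p} \<times> {..<n}. g (a * n + k))"
    by (rule sum.reindex_bij_witness[where i = "\<lambda>(a, k). a * n + k" and j = "\<lambda>c. (c div n, c mod n)"])
      (auto simp: less_mult_imp_div_less mult_add_less intro!: mod_less_divisor gr0I)
  then show ?thesis by (simp add: sum.cartesian_product)
qed

lemma block_index_cases:
  fixes r m n :: nat
  assumes "r < m * n"
  obtains i k where "i < m" "k < n" "r = i * n + k"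
proof (rule that[of "r div n" "r mod n"])
  have "0 < n" using assms by (cases n) auto
  then show "r mod n < n" by simp
qed (use assms in \<open>auto simp: less_mult_imp_div_less\<close>)

lemma eq_matI_blocks:
  assumes "A \<in> carrier_mat (p * n) (q * n)" "B \<in> carrier_mat (p * n) (q * n)"
    and "\<And>i j k l. i < p \<Longrightarrow> j < q \<Longrightarrow> k < n \<Longrightarrow> l < n \<Longrightarrow>
      A $$ (i * n + k, j * n + l) = B $$ (i * n + k, j * n + l)"
  shows "A = B"
proof (rule eq_matI)
  fix r c assume "r < dim_row B" "c < dim_col B"
  then have rc: "r < p * n" "c < q * n" using assms(2) by auto
  obtain i k where 1: "i < p" "k < n" "r = i * n + k" using block_index_cases[OF rc(1)] .
  obtain j l where 2: "j < q" "l < n" "c = j * n + l" using block_index_cases[OF rc(2)] .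
  show "A $$ (r, c) = B $$ (r, c)" using assms(3) 1 2 by blast
qed (use assms in auto)

text \<open>\<open>amp n A\<close> is $A \otimes I_n$ for rectangular \<open>A\<close>, and \<open>rect_tensor\<close> is \<open>id_tensor\<close> on
  rectangular block matrices; this allows covariance to be proved one side at a time.\<close>

definition amp :: "nat \<Rightarrow> complex mat \<Rightarrow> complex mat" where
  "amp n A = mat (dim_row A * n) (dim_col A * n)
     (\<lambda>(r, c). if r mod n = c mod n then A $$ (r div n, c div n) else 0)"

definition rect_tensor ::
  "nat \<Rightarrow> nat \<Rightarrow> nat \<Rightarrow> (complex mat \<Rightarrow> complex mat) \<Rightarrow> complex mat \<Rightarrow> complex mat" where
  "rect_tensor p q n \<Psi> X =
     mat (p * n) (q * n) (\<lambda>(r, c). \<Psi> (mat_block n X (r div n) (c div n)) $$ (r mod n, c mod n))"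

lemma id_tensor_eq_rect_tensor: "id_tensor m n \<Psi> X = rect_tensor m m n \<Psi> X"
  by (simp add: id_tensor_def rect_tensor_def)

lemma amp_dim [simp]: "dim_row (amp n A) = dim_row A * n" "dim_col (amp n A) = dim_col A * n"
  by (simp_all add: amp_def)

lemma amp_carrier: "A \<in> carrier_mat p q \<Longrightarrow> amp n A \<in> carrier_mat (p * n) (q * n)"
  by (auto simp: amp_def)

lemma amp_index:
  assumes "A \<in> carrier_mat p q" "i < p" "j < q" "k < n" "l < n"
  shows "amp n A $$ (i * n + k, j * n + l) = (if k = l then A $$ (i, j) else 0)"
  using assms mult_add_less[of i p k n] mult_add_less[of j q l n] by (auto simp: amp_def)

lemma amp_adj: "mat_adjoint (amp n A) = amp n (mat_adjoint A)"
proof (rule eq_matI_blocks)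
  fix i j k l assume "i < dim_col A" "j < dim_row A" "k < n" "l < n"
  moreover have "mat_adjoint A \<in> carrier_mat (dim_col A) (dim_row A)"
    by (intro carrier_matI) auto
  ultimately show "mat_adjoint (amp n A) $$ (i * n + k, j * n + l) = amp n (mat_adjoint A) $$ (i * n + k, j * n + l)"
    using mult_add_less[of i "dim_col A" k n] mult_add_less[of j "dim_row A" l n]
    by (simp add: amp_index[of A "dim_row A" "dim_col A"]
        amp_index[of "mat_adjoint A" "dim_col A" "dim_row A"])
qed auto

lemma amp_mult_index:
  assumes A: "A \<in> carrier_mat p q" and X: "dim_row X = q * n"
    and i: "i < p" "k < n" and c: "c < dim_col X"
  shows "(amp n A * X) $$ (i * n + k, c) = (\<Sum>a<q. A $$ (i, a) * X $$ (a * n + k, c))"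
proof -
  have "(amp n A * X) $$ (i * n + k, c) = (\<Sum>d<q * n. amp n A $$ (i * n + k, d) * X $$ (d, c))"
    using assms mult_add_less[OF i] by (subst mult_index_sum) auto
  also have "\<dots> = (\<Sum>a<q. \<Sum>b<n. if b = k then A $$ (i, a) * X $$ (a * n + b, c) else 0)"
    unfolding sum_blocks using i by (intro sum.cong refl) (auto simp: amp_index[OF A])
  also have "\<dots> = (\<Sum>a<q. A $$ (i, a) * X $$ (a * n + k, c))" using i by simp
  finally show ?thesis .
qed

lemma mult_amp_index:
  assumes A: "A \<in> carrier_mat q m" and X: "dim_col X = q * n"
    and j: "j < m" "l < n" and r: "r < dim_row X"
  shows "(X * amp n A) $$ (r, j * n + l) = (\<Sum>b<q. X $$ (r, b * n + l) * A $$ (b, j))"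
proof -
  have "(X * amp n A) $$ (r, j * n + l) = (\<Sum>d<q * n. X $$ (r, d) * amp n A $$ (d, j * n + l))"
    using assms mult_add_less[OF j] by (subst mult_index_sum) auto
  also have "\<dots> = (\<Sum>b<q. \<Sum>k<n. if k = l then X $$ (r, b * n + k) * A $$ (b, j) else 0)"
    unfolding sum_blocks using j by (intro sum.cong refl) (auto simp: amp_index[OF A])
  also have "\<dots> = (\<Sum>b<q. X $$ (r, b * n + l) * A $$ (b, j))" using j by simp
  finally show ?thesis .
qed

lemma amp_mult:
  assumes A: "A \<in> carrier_mat p q" and B: "B \<in> carrier_mat q m"
  shows "amp n (A * B) = amp n A * amp n B"
proof (rule eq_matI_blocks)
  fix i j k l assume *: "i < p" "j < m" "k < n" "l < n"
  have AB: "A * B \<in> carrier_mat p m" using A B by simp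
  have "(amp n A * amp n B) $$ (i * n + k, j * n + l) =
      (\<Sum>a<q. A $$ (i, a) * amp n B $$ (a * n + k, j * n + l))"
    using * A B mult_add_less[of j m l n] by (intro amp_mult_index[OF A]) auto
  also have "\<dots> = (\<Sum>a<q. A $$ (i, a) * (if k = l then B $$ (a, j) else 0))"
    using * by (intro sum.cong refl) (auto simp: amp_index[OF B])
  also have "\<dots> = amp n (A * B) $$ (i * n + k, j * n + l)"
    using * A B by (simp add: amp_index[OF AB] mult_index_sum del: index_mult_mat(1))
  finally show "amp n (A * B) $$ (i * n + k, j * n + l) = (amp n A * amp n B) $$ (i * n + k, j * n + l)" ..
qed (use A B in auto)

lemma amp_one: "amp n (1\<^sub>m m) = 1\<^sub>m (m * n)"
proof (rule eq_matI_blocks)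
  fix i j k l assume "i < m" "j < m" "k < n" "l < n"
  moreover have "i * n + k = j * n + l \<longleftrightarrow> i = j \<and> k = l"
    using \<open>k < n\<close> \<open>l < n\<close>
    by (metis add.commute div_mult_self1 div_less mod_less mod_mult_self1 add_0 mult.commute less_nat_zero_code)
  ultimately show "amp n (1\<^sub>m m) $$ (i * n + k, j * n + l) = 1\<^sub>m (m * n) $$ (i * n + k, j * n + l)"
    by (auto simp: amp_index[of _ m m] mult_add_less)
qed auto

lemma amp_smult: "amp n (a \<cdot>\<^sub>m A) = a \<cdot>\<^sub>m amp n A"
proof (rule eq_matI)
  fix r c assume rc: "r < dim_row (a \<cdot>\<^sub>m amp n A)" "c < dim_col (a \<cdot>\<^sub>m amp n A)"
  then show "amp n (a \<cdot>\<^sub>m A) $$ (r, c) = (a \<cdot>\<^sub>m amp n A) $$ (r, c)"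
    by (auto simp: amp_def less_mult_imp_div_less)
qed auto

lemma rect_tensor_dim [simp]:
  "dim_row (rect_tensor p q n \<Psi> X) = p * n" "dim_col (rect_tensor p q n \<Psi> X) = q * n"
  by (simp_all add: rect_tensor_def)

text \<open>The coefficients involve only the inner indices \<open>k\<close>, \<open>l\<close> and
  \<open>s\<close>, while multiplication by \<open>amp n V\<close> mixes only the outer ones.
  Commutation of the two thus reduces to exchanging finite sums.\<close>

lemma rect_tensor_index:
  assumes \<Psi>: "mat_linear_map n \<Psi>" and "i < p" "j < q" "k < n" "l < n"
  shows "rect_tensor p q n \<Psi> X $$ (i * n + k, j * n + l) =
    (\<Sum>s \<in> {..<n} \<times> {..<n}. X $$ (i * n + fst s, j * n + snd s) * \<Psi> (unit_mat n s) $$ (k, l))"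
proof -
  have "rect_tensor p q n \<Psi> X $$ (i * n + k, j * n + l) = \<Psi> (mat_block n X i j) $$ (k, l)"
    using assms mult_add_less[of i p k n] mult_add_less[of j q l n] by (simp add: rect_tensor_def)
  also have "\<dots> = (\<Sum>s \<in> {..<n} \<times> {..<n}. mat_block n X i j $$ s * \<Psi> (unit_mat n s) $$ (k, l))"
    using assms by (intro linear_map_entry) auto
  also have "\<dots> = (\<Sum>s \<in> {..<n} \<times> {..<n}. X $$ (i * n + fst s, j * n + snd s) * \<Psi> (unit_mat n s) $$ (k, l))"
    by (intro sum.cong refl) (auto simp: mat_block_def)
  finally show ?thesis .
qed

lemma rect_tensor_amp_left:
  assumes \<Psi>: "mat_linear_map n \<Psi>" and V: "V \<in> carrier_mat m p" and X: "X \<in> carrier_mat (p * n) (q * n)"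
  shows "rect_tensor m q n \<Psi> (amp n V * X) = amp n V * rect_tensor p q n \<Psi> X"
proof (rule eq_matI_blocks)
  fix i j k l assume *: "i < m" "j < q" "k < n" "l < n"
  let ?L = "\<lambda>s. \<Psi> (unit_mat n s) $$ (k, l)"
  have "rect_tensor m q n \<Psi> (amp n V * X) $$ (i * n + k, j * n + l) =
      (\<Sum>s \<in> {..<n} \<times> {..<n}. (amp n V * X) $$ (i * n + fst s, j * n + snd s) * ?L s)"
    by (rule rect_tensor_index[OF \<Psi> *])
  also have "\<dots> = (\<Sum>s \<in> {..<n} \<times> {..<n}. \<Sum>a<p. V $$ (i, a) * (X $$ (a * n + fst s, j * n + snd s) * ?L s))"
  proof (intro sum.cong refl)
    fix s assume "s \<in> {..<n} \<times> {..<n}"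
    then show "(amp n V * X) $$ (i * n + fst s, j * n + snd s) * ?L s =
      (\<Sum>a<p. V $$ (i, a) * (X $$ (a * n + fst s, j * n + snd s) * ?L s))"
      using * X mult_add_less[of j q "snd s" n]
      by (subst amp_mult_index[OF V]) (auto simp: sum_distrib_right mult.assoc)
  qed
  also have "\<dots> = (\<Sum>a<p. \<Sum>s \<in> {..<n} \<times> {..<n}. V $$ (i, a) * (X $$ (a * n + fst s, j * n + snd s) * ?L s))"
    by (rule sum.swap)
  also have "\<dots> = (\<Sum>a<p. V $$ (i, a) * rect_tensor p q n \<Psi> X $$ (a * n + k, j * n + l))"
    using * by (intro sum.cong refl) (simp add: rect_tensor_index[OF \<Psi>] sum_distrib_left)
  also have "\<dots> = (amp n V * rect_tensor p q n \<Psi> X) $$ (i * n + k, j * n + l)"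
    using * mult_add_less[of j q l n] by (subst amp_mult_index[OF V]) auto
  finally show "rect_tensor m q n \<Psi> (amp n V * X) $$ (i * n + k, j * n + l) =
    (amp n V * rect_tensor p q n \<Psi> X) $$ (i * n + k, j * n + l)" .
qed (use V in auto)

lemma rect_tensor_amp_right:
  assumes \<Psi>: "mat_linear_map n \<Psi>" and V: "V \<in> carrier_mat q m" and X: "X \<in> carrier_mat (p * n) (q * n)"
  shows "rect_tensor p m n \<Psi> (X * amp n V) = rect_tensor p q n \<Psi> X * amp n V"
proof (rule eq_matI_blocks)
  fix i j k l assume *: "i < p" "j < m" "k < n" "l < n"
  let ?L = "\<lambda>s. \<Psi> (unit_mat n s) $$ (k, l)"
  have "rect_tensor p m n \<Psi> (X * amp n V) $$ (i * n + k, j * n + l) =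
      (\<Sum>s \<in> {..<n} \<times> {..<n}. (X * amp n V) $$ (i * n + fst s, j * n + snd s) * ?L s)"
    by (rule rect_tensor_index[OF \<Psi> *])
  also have "\<dots> = (\<Sum>s \<in> {..<n} \<times> {..<n}. \<Sum>b<q. X $$ (i * n + fst s, b * n + snd s) * ?L s * V $$ (b, j))"
  proof (intro sum.cong refl)
    fix s assume "s \<in> {..<n} \<times> {..<n}"
    then show "(X * amp n V) $$ (i * n + fst s, j * n + snd s) * ?L s =
      (\<Sum>b<q. X $$ (i * n + fst s, b * n + snd s) * ?L s * V $$ (b, j))"
      using * X mult_add_less[of i p "fst s" n]
      by (subst mult_amp_index[OF V]) (auto simp: sum_distrib_left mult_ac)
  qed
  also have "\<dots> = (\<Sum>b<q. \<Sum>s \<in> {..<n} \<times> {..<n}. X $$ (i * n + fst s, b * n + snd s) * ?L s * V $$ (b, j))"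
    by (rule sum.swap)
  also have "\<dots> = (\<Sum>b<q. rect_tensor p q n \<Psi> X $$ (i * n + k, b * n + l) * V $$ (b, j))"
    using * by (intro sum.cong refl) (simp add: rect_tensor_index[OF \<Psi>] sum_distrib_right)
  also have "\<dots> = (rect_tensor p q n \<Psi> X * amp n V) $$ (i * n + k, j * n + l)"
    using * mult_add_less[of i p k n] by (subst mult_amp_index[OF V]) auto
  finally show "rect_tensor p m n \<Psi> (X * amp n V) $$ (i * n + k, j * n + l) =
    (rect_tensor p q n \<Psi> X * amp n V) $$ (i * n + k, j * n + l)" .
qed (use V in auto)

text \<open>Operations on different tensor factors commute. \<open>V\<close> is rectangular because
  it will be an invertible filter on C^m, a compression to a direct summand, and a contraction from
  C^n to C^m.\<close>

lemma id_tensor_amp_conj: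
  assumes \<Psi>: "mat_linear_map n \<Psi>" and V: "V \<in> carrier_mat m p" and X: "X \<in> carrier_mat (p * n) (p * n)"
  shows "id_tensor m n \<Psi> (amp n V * X * mat_adjoint (amp n V)) =
    amp n V * id_tensor p n \<Psi> X * mat_adjoint (amp n V)"
  using rect_tensor_amp_right[OF \<Psi> adj_carrier[OF V], of "amp n V * X" m]
    rect_tensor_amp_left[OF \<Psi> V X] amp_carrier[OF V, of n] X
  by (simp add: id_tensor_eq_rect_tensor amp_adj)

lemma id_tensor_dim [simp]:
  "dim_row (id_tensor m n \<Psi> X) = m * n" "dim_col (id_tensor m n \<Psi> X) = m * n"
  by (simp_all add: id_tensor_def)

lemma id_tensor_index:
  assumes "i < m" "j < m" "k < n" "l < n"
  shows "id_tensor m n \<Psi> X $$ (i * n + k, j * n + l) = \<Psi> (mat_block n X i j) $$ (k, l)"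
  using assms mult_add_less[of i m k n] mult_add_less[of j m l n] by (simp add: id_tensor_def)

lemma mat_block_index: "k < n \<Longrightarrow> l < n \<Longrightarrow> mat_block n X i j $$ (k, l) = X $$ (i * n + k, j * n + l)"
  by (simp add: mat_block_def)

lemma mat_block_id_tensor:
  assumes "mat_linear_map n \<Psi>" "i < m" "j < m"
  shows "mat_block n (id_tensor m n \<Psi> X) i j = \<Psi> (mat_block n X i j)"
  using mat_linear_mapD(1)[OF assms(1), of "mat_block n X i j"] assms(2,3)
  by (intro eq_matI) (auto simp: mat_block_index id_tensor_index mat_block_carrier[THEN carrier_matD(1)]
      mat_block_carrier[THEN carrier_matD(2)])

lemma id_tensor_add:
  assumes \<Psi>: "mat_linear_map n \<Psi>" and X: "X \<in> carrier_mat (m * n) (m * n)" and Y: "Y \<in> carrier_mat (m * n) (m * n)"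
  shows "id_tensor m n \<Psi> (X + Y) = id_tensor m n \<Psi> X + id_tensor m n \<Psi> Y"
proof (rule eq_matI_blocks)
  fix i j k l assume *: "i < m" "j < m" "k < n" "l < n"
  have "mat_block n (X + Y) i j = mat_block n X i j + mat_block n Y i j"
    using X Y * by (intro eq_matI) (auto simp: mat_block_def mult_add_less)
  then show "id_tensor m n \<Psi> (X + Y) $$ (i * n + k, j * n + l) =
    (id_tensor m n \<Psi> X + id_tensor m n \<Psi> Y) $$ (i * n + k, j * n + l)"
    using * mat_linear_mapD(1)[OF \<Psi>, of "mat_block n Y i j"]
    by (simp add: id_tensor_index mult_add_less mat_linear_mapD(2)[OF \<Psi>])
qed auto

lemma id_tensor_smult:
  assumes \<Psi>: "mat_linear_map n \<Psi>" and X: "X \<in> carrier_mat (m * n) (m * n)"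
  shows "id_tensor m n \<Psi> (a \<cdot>\<^sub>m X) = a \<cdot>\<^sub>m id_tensor m n \<Psi> X"
proof (rule eq_matI_blocks)
  fix i j k l assume *: "i < m" "j < m" "k < n" "l < n"
  have "mat_block n (a \<cdot>\<^sub>m X) i j = a \<cdot>\<^sub>m mat_block n X i j"
    using X * by (intro eq_matI) (auto simp: mat_block_def mult_add_less)
  then show "id_tensor m n \<Psi> (a \<cdot>\<^sub>m X) $$ (i * n + k, j * n + l) =
    (a \<cdot>\<^sub>m id_tensor m n \<Psi> X) $$ (i * n + k, j * n + l)"
    using * mat_linear_mapD(1)[OF \<Psi>, of "mat_block n X i j"]
    by (simp add: id_tensor_index mult_add_less mat_linear_mapD(3)[OF \<Psi>])
qed auto

section \<open>Traces of block matrices, adjoint maps and Hermiticity\<close>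

lemma trace_blocks:
  assumes "X \<in> carrier_mat (m * n) (m * n)" "Z \<in> carrier_mat (m * n) (m * n)"
  shows "mat_trace (X * Z) = (\<Sum>i<m. \<Sum>j<m. mat_trace (mat_block n X i j * mat_block n Z j i))"
proof -
  have "mat_trace (X * Z) = (\<Sum>r<m * n. \<Sum>c<m * n. X $$ (r, c) * Z $$ (c, r))"
    using assms by (rule mat_trace_mult)
  also have "\<dots> = (\<Sum>i<m. \<Sum>k<n. \<Sum>j<m. \<Sum>l<n.
      X $$ (i * n + k, j * n + l) * Z $$ (j * n + l, i * n + k))"
    by (simp add: sum_blocks)
  also have "\<dots> = (\<Sum>i<m. \<Sum>j<m. \<Sum>k<n. \<Sum>l<n.
      X $$ (i * n + k, j * n + l) * Z $$ (j * n + l, i * n + k))"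
    by (rule sum.cong[OF refl], rule sum.swap)
  also have "\<dots> = (\<Sum>i<m. \<Sum>j<m. mat_trace (mat_block n X i j * mat_block n Z j i))"
    by (intro sum.cong refl) (simp add: mat_trace_mult[of _ n] mat_block_index)
  finally show ?thesis .
qed

lemma trace_diag_blocks:
  assumes "X \<in> carrier_mat (m * n) (m * n)"
  shows "mat_trace X = (\<Sum>i<m. mat_trace (mat_block n X i i))"
  using assms by (simp add: mat_trace_def sum_blocks mat_block_index mat_block_carrier[THEN carrier_matD(1)])

text \<open>The defining identity is imposed on Hermitian arguments only; both sides are complex
  bilinear, and every matrix is H + i K with H and K Hermitian.\<close>

lemma adjoint_map_trace:
  assumes adj: "is_adjoint_map n \<Phi> \<Psi>" and \<Phi>: "mat_linear_map n \<Phi>"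
    and X: "X \<in> carrier_mat n n" and Y: "Y \<in> carrier_mat n n"
  shows "mat_trace (X * \<Phi> Y) = mat_trace (\<Psi> X * Y)"
proof -
  have \<Psi>: "mat_linear_map n \<Psi>" using adj by (simp add: is_adjoint_map_def)
  note lin = mat_linear_mapD(2,3)[OF \<Phi>] mat_linear_mapD(2,3)[OF \<Psi>]
    mult_add_distrib_mat[of _ n n _ n] add_mult_distrib_mat[of _ n n _ _ n]
    mult_smult_distrib[of _ n n _ n] mult_smult_assoc_mat[of _ n n _ n]
    mat_trace_add[of _ n] mat_trace_smult[of _ n]
  obtain H K where HK: "hermitian_mat n H" "hermitian_mat n K" "X = H + \<i> \<cdot>\<^sub>m K"
    using hermitian_decomp[OF X] .
  obtain H' K' where HK': "hermitian_mat n H'" "hermitian_mat n K'" "Y = H' + \<i> \<cdot>\<^sub>m K'"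
    using hermitian_decomp[OF Y] .
  have c: "H \<in> carrier_mat n n" "K \<in> carrier_mat n n" "H' \<in> carrier_mat n n" "K' \<in> carrier_mat n n"
    using HK HK' by (auto simp: hermitian_mat_def)
  have c': "\<Psi> H \<in> carrier_mat n n" "\<Psi> K \<in> carrier_mat n n" "\<Phi> H' \<in> carrier_mat n n" "\<Phi> K' \<in> carrier_mat n n"
    using c mat_linear_mapD(1)[OF \<Phi>] mat_linear_mapD(1)[OF \<Psi>] by auto
  have a: "mat_trace (A * \<Phi> B) = mat_trace (\<Psi> A * B)"
    if "hermitian_mat n A" "hermitian_mat n B" for A B
    using adj that by (simp add: is_adjoint_map_def)
  show ?thesis unfolding HK(3) HK'(3)
    using a[OF HK(1) HK'(1)] a[OF HK(1) HK'(2)] a[OF HK(2) HK'(1)] a[OF HK(2) HK'(2)] c c'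
    by (simp add: lin)
qed

lemma id_tensor_adjoint_trace:
  assumes adj: "is_adjoint_map n \<Phi> \<Psi>" and \<Phi>: "mat_linear_map n \<Phi>"
    and X: "X \<in> carrier_mat (m * n) (m * n)" and Y: "Y \<in> carrier_mat (m * n) (m * n)"
  shows "mat_trace (X * id_tensor m n \<Phi> Y) = mat_trace (id_tensor m n \<Psi> X * Y)"
proof -
  have \<Psi>: "mat_linear_map n \<Psi>" using adj by (simp add: is_adjoint_map_def)
  show ?thesis using X Y
    by (auto simp: trace_blocks[of _ m n] mat_block_id_tensor[OF \<Phi>] mat_block_id_tensor[OF \<Psi>]
        adjoint_map_trace[OF adj \<Phi>] intro!: sum.cong)
qed

lemma hermiticity_preserving_adj:
  assumes \<Phi>: "mat_linear_map n \<Phi>" and hp: "hermiticity_preserving n \<Phi>" and Y: "Y \<in> carrier_mat n n"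
  shows "\<Phi> (mat_adjoint Y) = mat_adjoint (\<Phi> Y)"
proof -
  obtain H K where HK: "hermitian_mat n H" "hermitian_mat n K" "Y = H + \<i> \<cdot>\<^sub>m K"
    using hermitian_decomp[OF Y] .
  have h: "hermitian_mat n (\<Phi> H)" "hermitian_mat n (\<Phi> K)"
    using hp HK by (auto simp: hermiticity_preserving_def)
  have c: "H \<in> carrier_mat n n" "K \<in> carrier_mat n n" "\<Phi> H \<in> carrier_mat n n" "\<Phi> K \<in> carrier_mat n n"
    using HK h by (auto simp: hermitian_mat_def)
  show ?thesis unfolding HK(3)
    using c by (simp add: mat_linear_mapD(2,3)[OF \<Phi>] adj_add adj_smult hermitian_adj[OF HK(1)]
        hermitian_adj[OF HK(2)] hermitian_adj[OF h(1)] hermitian_adj[OF h(2)])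
qed

lemma trace_mult_unit_mat:
  assumes "B \<in> carrier_mat n n" "i < n" "j < n"
  shows "mat_trace (B * unit_mat n (j, i)) = B $$ (i, j)"
proof -
  have "mat_trace (B * unit_mat n (j, i)) =
    (\<Sum>a<n. \<Sum>b<n. B $$ (a, b) * (if (b, a) = (j, i) then 1 else 0))"
    using assms by (subst mat_trace_mult[of _ n]) auto
  also have "\<dots> = (\<Sum>a<n. \<Sum>b<n. if b = j then (if a = i then B $$ (a, b) else 0) else 0)"
    by (intro sum.cong) auto
  also have "\<dots> = B $$ (i, j)" using assms by simp
  finally show ?thesis .
qed

text \<open>For any \<open>Y\<close>, conjugating the trace, moving the adjoint through \<Phi> and
  conjugating back shows that \<open>\<Psi> H\<close> and its adjoint have the same trace against
  \<open>Y\<close>. Matrix units then identify the two.\<close>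

lemma hermiticity_preserving_adjoint:
  assumes adj: "is_adjoint_map n \<Phi> \<Psi>" and \<Phi>: "mat_linear_map n \<Phi>" and hp: "hermiticity_preserving n \<Phi>"
  shows "hermiticity_preserving n \<Psi>"
  unfolding hermiticity_preserving_def
proof (intro allI impI)
  fix H assume H: "hermitian_mat n H"
  have Hc: "H \<in> carrier_mat n n" using hermitian_carrier[OF H] .
  have \<Psi>: "mat_linear_map n \<Psi>" using adj by (simp add: is_adjoint_map_def)
  have B: "\<Psi> H \<in> carrier_mat n n" using mat_linear_mapD(1)[OF \<Psi> Hc] .
  have tr: "mat_trace (mat_adjoint (\<Psi> H) * Y) = mat_trace (\<Psi> H * Y)" if Y: "Y \<in> carrier_mat n n" for Y
  proof -
    have \<Phi>Y: "\<Phi> Y \<in> carrier_mat n n" using mat_linear_mapD(1)[OF \<Phi> Y] .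
    have "mat_trace (mat_adjoint (\<Psi> H) * Y) = cnj (mat_trace (mat_adjoint Y * \<Psi> H))"
      using trace_adj[of "mat_adjoint Y * \<Psi> H"] Y B by (simp add: adj_mult)
    also have "mat_trace (mat_adjoint Y * \<Psi> H) = mat_trace (\<Psi> H * mat_adjoint Y)"
      using Y B by (intro trace_comm) auto
    also have "\<dots> = mat_trace (H * mat_adjoint (\<Phi> Y))"
      using adjoint_map_trace[OF adj \<Phi> Hc adj_carrier[OF Y]] hermiticity_preserving_adj[OF \<Phi> hp Y] by simp
    also have "cnj \<dots> = mat_trace (\<Phi> Y * H)"
      using trace_adj[of "H * mat_adjoint (\<Phi> Y)"] Hc \<Phi>Y by (simp add: adj_mult hermitian_adj[OF H])
    also have "\<dots> = mat_trace (H * \<Phi> Y)" using Hc \<Phi>Y by (intro trace_comm) auto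
    also have "\<dots> = mat_trace (\<Psi> H * Y)" by (rule adjoint_map_trace[OF adj \<Phi> Hc Y])
    finally show ?thesis .
  qed
  have "mat_adjoint (\<Psi> H) = \<Psi> H"
  proof (rule eq_matI)
    fix i j assume "i < dim_row (\<Psi> H)" "j < dim_col (\<Psi> H)"
    then have ij: "i < n" "j < n" using B by auto
    show "mat_adjoint (\<Psi> H) $$ (i, j) = \<Psi> H $$ (i, j)"
      using tr[of "unit_mat n (j, i)"] trace_mult_unit_mat[OF B ij]
        trace_mult_unit_mat[OF adj_carrier[OF B] ij] by simp
  qed (use B in auto)
  then show "hermitian_mat n (\<Psi> H)" using B by (simp add: hermitian_mat_def)
qed

text \<open>Block (i, j) of a Hermitian matrix is the adjoint of block (j, i), and \<Psi> commutes
  with adjoints on all of M_n. The blocks themselves are not Hermitian, which is why that extension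
  from Hermitian arguments was made.\<close>

lemma id_tensor_hermitian:
  assumes \<Psi>: "mat_linear_map n \<Psi>" and hp: "hermiticity_preserving n \<Psi>" and X: "hermitian_mat (m * n) X"
  shows "hermitian_mat (m * n) (id_tensor m n \<Psi> X)"
proof -
  have "mat_adjoint (id_tensor m n \<Psi> X) = id_tensor m n \<Psi> X"
  proof (rule eq_matI_blocks)
    fix i j k l assume *: "i < m" "j < m" "k < n" "l < n"
    have "mat_block n X i j = mat_adjoint (mat_block n X j i)"
      using * hermitian_index[OF X] by (intro eq_matI) (auto simp: mat_block_def mult_add_less)
    then have "\<Psi> (mat_block n X i j) = mat_adjoint (\<Psi> (mat_block n X j i))"
      by (simp add: hermiticity_preserving_adj[OF \<Psi> hp])
    then show "mat_adjoint (id_tensor m n \<Psi> X) $$ (i * n + k, j * n + l) =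
      id_tensor m n \<Psi> X $$ (i * n + k, j * n + l)"
      using * mat_linear_mapD(1)[OF \<Psi>, of "mat_block n X j i"] by (simp add: id_tensor_index mult_add_less)
  qed (auto intro!: carrier_matI)
  then show ?thesis by (simp add: hermitian_mat_def)
qed

section \<open>Subspaces and isometries\<close>

text \<open>A maximal independent subset of \<open>S\<close> is a basis, and its members become the
  columns of \<open>M\<close>. This is the passage from the abstract dimension of \<open>S\<close>
  to matrices.\<close>

lemma subspace_basis_matrix:
  assumes S: "vec_subspace N S"
  obtains M :: "complex mat" where "M \<in> carrier_mat N (vec_subspace_dim N S)"
    "\<And>v. v \<in> carrier_vec (vec_subspace_dim N S) \<Longrightarrow> M *\<^sub>v v \<in> S"
    "\<And>v. v \<in> carrier_vec (vec_subspace_dim N S) \<Longrightarrow> M *\<^sub>v v = 0\<^sub>v N \<Longrightarrow> v = 0\<^sub>v (vec_subspace_dim N S)"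
    "vec_subspace_dim N S \<le> N"
proof -
  interpret V: vec_space "TYPE(complex)" N .
  have sub: "submodule class_ring S V.V" using S unfolding subspace_def by simp
  have SV: "S \<subseteq> carrier V.V" using sub unfolding submodule_def by simp
  interpret W: vectorspace class_ring "V.V\<lparr>carrier := S\<rparr>"
    using V.subspace_is_vs[OF S] .
  \<comment> \<open>Span and dependence of a subset of \<open>S\<close> mean the same inside
    \<open>S\<close> and in the whole space, so independent subsets of \<open>S\<close> are bounded
    by the ambient dimension.\<close>
  have dep: "W.lin_dep A = V.lin_dep A" "W.span A = V.span A" if "A \<subseteq> S" for A
    using V.span_li_not_depend[OF that sub] by auto
  have "\<exists>A. finite A \<and> maximal A (\<lambda>A. A \<subseteq> carrier (V.V\<lparr>carrier := S\<rparr>) \<and> W.lin_indpt A)"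
  proof (rule maximal_exists[where B = "{}"])
    fix A assume "A \<subseteq> carrier (V.V\<lparr>carrier := S\<rparr>) \<and> W.lin_indpt A"
    then have "A \<subseteq> carrier V.V" "V.lin_indpt A" using dep SV by auto
    then show "finite A \<and> card A \<le> V.dim" using V.li_le_dim[OF V.fin_dim] by auto
  next
    show "{} \<subseteq> carrier (V.V\<lparr>carrier := S\<rparr>) \<and> W.lin_indpt {}"
      by (auto simp: W.lin_dep_def)
  qed
  then obtain A where A: "finite A" "maximal A (\<lambda>A. A \<subseteq> carrier (V.V\<lparr>carrier := S\<rparr>) \<and> W.lin_indpt A)"
    by blast
  have AS: "A \<subseteq> S" and li: "V.lin_indpt A" using A(2) dep by (auto simp: maximal_def)
  have b: "W.basis A" by (rule W.max_li_is_basis[OF A(2)])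
  have d: "W.dim = card A" by (rule W.dim_basis[OF A(1) b])
  have sp: "V.span A = S" using b dep(2)[OF AS] by (simp add: W.basis_def)
  have dN: "card A \<le> N"
    using V.li_le_dim(2)[OF V.fin_dim _ li] AS SV V.dim_is_n by auto
  obtain vs where vs: "set vs = A" "distinct vs" using finite_distinct_list[OF A(1)] by blast
  have len: "length vs = card A" using vs distinct_card by metis
  have vsN: "set vs \<subseteq> carrier_vec N" using vs AS SV by auto
  define M where "M = mat_of_cols N vs"
  have M: "M \<in> carrier_mat N (card A)" by (simp add: M_def len[symmetric])
  have cols: "cols M = vs" using vsN by (simp add: M_def)
  show ?thesis
  proof (rule that[unfolded d, OF M])
    fix v :: "complex vec" assume v: "v \<in> carrier_vec (card A)"
    have "V.lincomb (\<lambda>a. v $ find_first a (cols M)) (set (cols M)) = M *\<^sub>v v"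
      by (rule V.lincomb_eq_mat_mult[OF M v]) (simp add: cols vs)
    moreover have "V.lincomb (\<lambda>a. v $ find_first a (cols M)) (set (cols M)) \<in> V.span A"
      unfolding cols vs by (rule V.in_spanI[OF refl A(1)]) simp
    ultimately show "M *\<^sub>v v \<in> S" using sp by simp
    assume "M *\<^sub>v v = 0\<^sub>v N"
    then show "v = 0\<^sub>v (card A)"
      using V.lin_depI[OF M v] li by (auto simp: cols vs)
  qed (fact dN)
qed

lemma quad_form_gram:
  assumes M: "M \<in> carrier_mat N d"
  shows "quad_form d (mat_adjoint M * M) f = of_real (\<Sum>i<N. (cmod ((M *\<^sub>v vec d f) $ i))\<^sup>2)"
proof -
  have "quad_form d (mat_adjoint M * M) f
      = quad_form d (mat_adjoint M * 1\<^sub>m N * mat_adjoint (mat_adjoint M)) f"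
    using M by simp
  also have "\<dots> = quad_form N (1\<^sub>m N) (\<lambda>i. \<Sum>k<d. cnj (mat_adjoint M $$ (k, i)) * f k)"
    using M by (intro quad_form_conj) auto
  also have "\<dots> = of_real (\<Sum>i<N. (cmod (\<Sum>k<d. cnj (mat_adjoint M $$ (k, i)) * f k))\<^sup>2)"
    by (rule quad_form_one)
  also have "(\<Sum>i<N. (cmod (\<Sum>k<d. cnj (mat_adjoint M $$ (k, i)) * f k))\<^sup>2) =
      (\<Sum>i<N. (cmod ((M *\<^sub>v vec d f) $ i))\<^sup>2)"
    using M by (intro sum.cong refl) (auto simp: scalar_prod_def lessThan_atLeast0)
  finally show ?thesis .
qed

text \<open>Symmetric orthonormalization \<open>M (M\<^sup>* M)\<^sup>-\<^sup>1\<^sup>/\<^sup>2\<close> of the columns of \<open>M\<close>.\<close>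

lemma orthonormalize:
  fixes M :: "complex mat"
  assumes M: "M \<in> carrier_mat N d"
    and inj: "\<And>v. v \<in> carrier_vec d \<Longrightarrow> M *\<^sub>v v = 0\<^sub>v N \<Longrightarrow> v = 0\<^sub>v d"
  obtains R R' where "R \<in> carrier_mat d d" "R' \<in> carrier_mat d d" "R * R' = 1\<^sub>m d" "R' * R = 1\<^sub>m d"
    "mat_adjoint (M * R) * (M * R) = 1\<^sub>m d"
proof -
  have "psd_mat d (mat_adjoint M * M)" using psd_gram[of "mat_adjoint M" d N] M by auto
  moreover have "0 < Re (quad_form d (mat_adjoint M * M) f)" if "\<exists>i<d. f i \<noteq> 0" for f
  proof -
    have "M *\<^sub>v vec d f \<noteq> 0\<^sub>v N"
    proof
      assume "M *\<^sub>v vec d f = 0\<^sub>v N"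
      then have "vec d f = 0\<^sub>v d" by (intro inj) auto
      then show False using that by (metis index_vec index_zero_vec(1))
    qed
    moreover have "dim_vec (M *\<^sub>v vec d f) = N" using M by simp
    ultimately obtain i where i: "i < N" "(M *\<^sub>v vec d f) $ i \<noteq> 0"
      by (metis eq_vecI index_zero_vec)
    have "0 < (cmod ((M *\<^sub>v vec d f) $ i))\<^sup>2" using i by simp
    also have "\<dots> \<le> (\<Sum>i<N. (cmod ((M *\<^sub>v vec d f) $ i))\<^sup>2)" using i by (intro member_le_sum) auto
    finally show ?thesis unfolding quad_form_gram[OF M] by simp
  qed
  ultimately obtain R R' where R: "R \<in> carrier_mat d d" "R' \<in> carrier_mat d d" "R * R' = 1\<^sub>m d" "R' * R = 1\<^sub>m d"
    "mat_adjoint R * (mat_adjoint M * M) * R = 1\<^sub>m d"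
    using positive_definite_inverse_sqrt[OF psd_hermitian] by metis
  have "mat_adjoint (M * R) * (M * R) = 1\<^sub>m d"
    using R M by (simp add: adj_mult mult_assoc_dim)
  then show ?thesis using that R by blast
qed

lemma isometry_range_subspace:
  fixes Q :: "complex mat"
  assumes Q: "Q \<in> carrier_mat N d" and iso: "mat_adjoint Q * Q = 1\<^sub>m d"
  obtains S where "vec_subspace N S" "vec_subspace_dim N S = d"
    "\<And>v. v \<in> S \<Longrightarrow> \<exists>w \<in> carrier_vec d. v = Q *\<^sub>v w"
proof -
  interpret V: vec_space "TYPE(complex)" N .
  have inj: "v = 0\<^sub>v d" if "v \<in> carrier_vec d" "Q *\<^sub>v v = 0\<^sub>v N" for v
  proof -
    have "v = (mat_adjoint Q * Q) *\<^sub>v v" using iso that by simp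
    also have "\<dots> = mat_adjoint Q *\<^sub>v (Q *\<^sub>v v)"
      using Q that by (intro assoc_mult_mat_vec[OF adj_carrier[OF Q] Q]) auto
    also have "\<dots> = 0\<^sub>v d" using that Q by (auto simp: scalar_prod_def intro!: eq_vecI)
    finally show ?thesis .
  qed
  \<comment> \<open>The dimension is counted on the set of columns. Two equal columns would make a
    diagonal and an off-diagonal entry of \<open>Q\<^sup>* Q\<close> agree, that is, 1 = 0.\<close>
  have dist: "distinct (cols Q)"
    unfolding distinct_conv_nth
  proof (intro allI impI notI)
    fix i j assume ij: "i < length (cols Q)" "j < length (cols Q)" "i \<noteq> j" "cols Q ! i = cols Q ! j"
    then have ij': "i < d" "j < d" "col Q i = col Q j" using Q by auto
    have "(mat_adjoint Q * Q) $$ (i, i) = (mat_adjoint Q * Q) $$ (i, j)"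
      using ij' Q by simp
    then show False using iso ij' ij(3) by simp
  qed
  have li: "V.lin_indpt (set (cols Q))"
    using V.lin_depE[OF Q _ dist] inj by metis
  have QN: "set (cols Q) \<subseteq> carrier_vec N" using Q cols_dim[of Q] by auto
  show ?thesis
  proof (rule that[of "V.span (set (cols Q))"])
    show "vec_subspace N (V.span (set (cols Q)))" using V.span_is_subspace[OF QN] .
    show "vec_subspace_dim N (V.span (set (cols Q))) = d"
      using V.lin_indpt_full_rank[OF Q dist li] by (simp add: V.rank_def)
    fix v assume "v \<in> V.span (set (cols Q))"
    then obtain a where "V.lincomb a (set (cols Q)) = v"
      using V.finite_in_span[OF _ QN] by auto
    then have "v = Q *\<^sub>v vec d (\<lambda>i. a (col Q i))"
      using V.mat_mult_eq_lincomb[OF Q dist, of a] by simp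
    then show "\<exists>w \<in> carrier_vec d. v = Q *\<^sub>v w" by auto
  qed
qed

text \<open>The subspace is given by an isometry \<open>Q\<close> onto it: the states supported in
  the range of \<open>Q\<close> are exactly the matrices \<open>Q W Q\<^sup>*\<close> with
  \<open>W\<close> a state on C^d. Quantifying over \<open>W\<close> puts all states on one fixed
  matrix space.\<close>

definition good_dim :: "nat \<Rightarrow> nat \<Rightarrow> (complex mat \<Rightarrow> complex mat) \<Rightarrow> nat \<Rightarrow> bool" where
  "good_dim m n \<Psi> d \<longleftrightarrow> (\<exists>Q \<in> carrier_mat (m * n) d. mat_adjoint Q * Q = 1\<^sub>m d \<and>
     (\<forall>W. density_matrix d W \<longrightarrow> \<not> psd_mat (m * n) (id_tensor m n \<Psi> (Q * W * mat_adjoint Q))))"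

lemma isometry_density:
  assumes Q: "Q \<in> carrier_mat N d" and iso: "mat_adjoint Q * Q = 1\<^sub>m d" and W: "density_matrix d W"
  shows "density_matrix N (Q * W * mat_adjoint Q)"
proof -
  have "mat_trace (Q * W * mat_adjoint Q) = mat_trace (W * (mat_adjoint Q * Q))"
    using Q density_carrier[OF W] trace_comm[of Q "W * mat_adjoint Q"] by (auto simp: mult_assoc_dim)
  then show ?thesis
    using psd_conj[OF density_psd[OF W] Q] iso density_carrier[OF W] density_trace[OF W]
    by (simp add: density_matrix_def)
qed

lemma non_psd_subspace_good_dim:
  assumes S: "non_psd_subspace m n \<Psi> S"
  shows "good_dim m n \<Psi> (vec_subspace_dim (m * n) S)"
proof -
  let ?d = "vec_subspace_dim (m * n) S"
  have sub: "vec_subspace (m * n) S" using S by (simp add: non_psd_subspace_def)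
  obtain M where M: "M \<in> carrier_mat (m * n) ?d"
    "\<And>v. v \<in> carrier_vec ?d \<Longrightarrow> M *\<^sub>v v \<in> S"
    "\<And>v. v \<in> carrier_vec ?d \<Longrightarrow> M *\<^sub>v v = 0\<^sub>v (m * n) \<Longrightarrow> v = 0\<^sub>v ?d"
    using subspace_basis_matrix[OF sub] by metis
  obtain R where R: "R \<in> carrier_mat ?d ?d" "mat_adjoint (M * R) * (M * R) = 1\<^sub>m ?d"
    using orthonormalize[OF M(1,3)] by metis
  have Q: "M * R \<in> carrier_mat (m * n) ?d" using M R by simp
  have "\<not> psd_mat (m * n) (id_tensor m n \<Psi> (M * R * W * mat_adjoint (M * R)))"
    if W: "density_matrix ?d W" for W
  proof -
    have Wc: "W \<in> carrier_mat ?d ?d" using density_carrier[OF W] .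
    have "mat_support (M * R * W * mat_adjoint (M * R)) \<subseteq> S"
    proof (clarsimp simp: mat_support_def)
      fix v :: "complex vec" assume "v \<in> carrier_vec (dim_row M)"
      then have v: "v \<in> carrier_vec (m * n)" using M by simp
      let ?X = "R * (W * mat_adjoint (M * R))"
      have X: "?X \<in> carrier_mat ?d (m * n)" using R(1) M(1) Wc by (intro mult_carrier_mat adj_carrier)
      have "(M * R * W * mat_adjoint (M * R)) *\<^sub>v v = (M * ?X) *\<^sub>v v"
        using M(1) R(1) Wc by (simp add: mult_assoc_dim)
      also have "\<dots> = M *\<^sub>v (?X *\<^sub>v v)"
        by (rule assoc_mult_mat_vec[OF M(1) X v])
      also have "\<dots> \<in> S" using M(2) X v by (intro M(2) mult_mat_vec_carrier[OF X v])
      finally show "(M * R * W * mat_adjoint (M * R)) *\<^sub>v v \<in> S" .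
    qed
    then show ?thesis
      using S isometry_density[OF Q R(2) W] by (simp add: non_psd_subspace_def)
  qed
  then show ?thesis unfolding good_dim_def using Q R(2) by blast
qed

lemma good_dim_non_psd_subspace:
  assumes "good_dim m n \<Psi> d"
  obtains S where "non_psd_subspace m n \<Psi> S" "vec_subspace_dim (m * n) S = d"
proof -
  let ?N = "m * n"
  obtain Q where Q: "Q \<in> carrier_mat ?N d" and iso: "mat_adjoint Q * Q = 1\<^sub>m d"
    and bad: "\<And>W. density_matrix d W \<Longrightarrow> \<not> psd_mat ?N (id_tensor m n \<Psi> (Q * W * mat_adjoint Q))"
    using assms by (auto simp: good_dim_def)
  obtain S where S: "vec_subspace ?N S" "vec_subspace_dim ?N S = d"
    "\<And>v. v \<in> S \<Longrightarrow> \<exists>w \<in> carrier_vec d. v = Q *\<^sub>v w"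
    using isometry_range_subspace[OF Q iso] by metis
  have "\<not> psd_mat ?N (id_tensor m n \<Psi> \<rho>)" if \<rho>: "density_matrix ?N \<rho>" "mat_support \<rho> \<subseteq> S" for \<rho>
  proof -
    have \<rho>c: "\<rho> \<in> carrier_mat ?N ?N" using density_carrier[OF \<rho>(1)] .
    let ?P = "Q * mat_adjoint Q"
    have Pc: "?P \<in> carrier_mat ?N ?N" using Q by auto
    \<comment> \<open>Columns of \<rho> belong to its support, hence to the range of
      \<open>Q\<close>, where the projection \<open>?P\<close> acts as the identity. Taking adjoints
      gives the identity on the other side as well.\<close>
    have P\<rho>: "?P * \<rho> = \<rho>"
    proof (rule mat_col_eqI)
      fix j assume "j < dim_col \<rho>"
      then have j: "j < ?N" using \<rho>c by simp
      have "col \<rho> j = \<rho> *\<^sub>v unit_vec ?N j" using \<rho>c j by (intro eq_vecI) auto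
      then have "col \<rho> j \<in> S" using \<rho>(2) \<rho>c by (auto simp: mat_support_def)
      then obtain w where w: "w \<in> carrier_vec d" "col \<rho> j = Q *\<^sub>v w" using S(3) by blast
      have "col (?P * \<rho>) j = ?P *\<^sub>v (Q *\<^sub>v w)"
        using j \<rho>c Pc w(2) by (metis carrier_matD(2) col_mult2)
      also have "\<dots> = (?P * Q) *\<^sub>v w"
        using Pc Q w(1) by (simp add: assoc_mult_mat_vec)
      also have "?P * Q = Q * (mat_adjoint Q * Q)" using Q by (simp add: mult_assoc_dim)
      also have "\<dots> = Q" using Q iso by simp
      finally show "col (?P * \<rho>) j = col \<rho> j" using w(2) by simp
    qed (use \<rho>c Q in auto)
    have adjP: "mat_adjoint ?P = ?P" using Q by (simp add: adj_mult)
    have \<rho>h: "mat_adjoint \<rho> = \<rho>" using hermitian_adj[OF psd_hermitian[OF density_psd[OF \<rho>(1)]]] .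
    have "mat_adjoint (?P * \<rho>) = mat_adjoint \<rho> * mat_adjoint ?P"
      using \<rho>c Pc by (intro adj_mult) auto
    then have \<rho>P: "\<rho> * ?P = \<rho>" by (simp only: P\<rho> adjP \<rho>h)
    \<comment> \<open>The compression of \<rho> to the range of \<open>Q\<close>, in the coordinates
      given by \<open>Q\<close>; nothing is lost because \<open>?P\<close> fixes \<rho> from both
      sides.\<close>
    define W where "W = mat_adjoint Q * \<rho> * mat_adjoint (mat_adjoint Q)"
    have Wp: "psd_mat d W" unfolding W_def using Q by (intro psd_conj[OF density_psd[OF \<rho>(1)]]) auto
    have "Q * W * mat_adjoint Q = ?P * \<rho> * ?P"
      using Q \<rho>c by (simp add: W_def mult_assoc_dim)
    also have "\<dots> = \<rho>" using P\<rho> \<rho>P by simp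
    finally have QW: "Q * W * mat_adjoint Q = \<rho>" .
    have "mat_trace W = mat_trace (\<rho> * ?P)"
      using Q \<rho>c trace_comm[of "mat_adjoint Q" "\<rho> * Q"] by (simp add: W_def mult_assoc_dim)
    then have "density_matrix d W"
      using Wp density_trace[OF \<rho>(1)] \<rho>P by (simp add: density_matrix_def)
    from bad[OF this] show ?thesis by (simp add: QW)
  qed
  then have "non_psd_subspace m n \<Psi> S" using S(1) unfolding non_psd_subspace_def by blast
  then show ?thesis using that S(2) by blast
qed

text \<open>An empty matrix has trace 0, so there is no state to test. This makes the set of
  dimensions nonempty, as the maximum requires.\<close>

lemma good_dim_0: "good_dim m n \<Psi> 0"
proof -
  have "\<not> density_matrix 0 W" for W
    using density_trace[of 0 W] density_carrier[of 0 W] by (auto simp: mat_trace_def)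
  moreover have "mat_adjoint (0\<^sub>m (m * n) 0) * 0\<^sub>m (m * n) 0 = (1\<^sub>m 0 :: complex mat)"
    by (intro eq_matI) auto
  ultimately show ?thesis unfolding good_dim_def by (intro bexI[of _ "0\<^sub>m (m * n) 0"]) auto
qed

lemma nu_m_eq_Max: "nu_m m n \<Psi> = Max {d. good_dim m n \<Psi> d}"
proof -
  have "{vec_subspace_dim (m * n) S | S. non_psd_subspace m n \<Psi> S} = {d. good_dim m n \<Psi> d}"
  proof (intro equalityI subsetI)
    fix d assume "d \<in> {d. good_dim m n \<Psi> d}"
    then obtain S where "non_psd_subspace m n \<Psi> S" "vec_subspace_dim (m * n) S = d"
      using good_dim_non_psd_subspace by blast
    then show "d \<in> {vec_subspace_dim (m * n) S | S. non_psd_subspace m n \<Psi> S}" by blast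
  qed (use non_psd_subspace_good_dim in blast)
  then show ?thesis by (simp add: nu_m_def)
qed

lemma good_dim_le: "good_dim m n \<Psi> d \<Longrightarrow> d \<le> m * n"
proof -
  assume "good_dim m n \<Psi> d"
  then obtain S where S: "non_psd_subspace m n \<Psi> S" "vec_subspace_dim (m * n) S = d"
    using good_dim_non_psd_subspace by blast
  show ?thesis
    using S subspace_basis_matrix[of S "m * n"] by (auto simp: non_psd_subspace_def)
qed

lemma finite_good_dim: "finite {d. good_dim m n \<Psi> d}"
  by (rule finite_subset[of _ "{..m * n}"]) (auto dest: good_dim_le)

lemma good_dim_nu_m: "good_dim m n \<Psi> (nu_m m n \<Psi>)"
  using Max_in[OF finite_good_dim, of m n \<Psi>] good_dim_0 unfolding nu_m_eq_Max by blast

lemma good_dim_le_nu_m: "good_dim m n \<Psi> d \<Longrightarrow> d \<le> nu_m m n \<Psi>"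
  unfolding nu_m_eq_Max by (rule Max_ge[OF finite_good_dim]) simp

section \<open>Superadditivity\<close>

lemma mult_add_dim:
  "dim_col A = dim_row B \<Longrightarrow> dim_row B = dim_row C \<Longrightarrow> dim_col B = dim_col C \<Longrightarrow>
    A * (B + C) = A * B + A * C" for A :: "complex mat"
  by (rule mult_add_distrib_mat[of _ "dim_row A" "dim_col A" _ "dim_col B"]) auto

lemma add_mult_dim:
  "dim_row A = dim_row B \<Longrightarrow> dim_col A = dim_col B \<Longrightarrow> dim_col A = dim_row C \<Longrightarrow>
    (A + B) * C = A * C + B * C" for A :: "complex mat"
  by (rule add_mult_distrib_mat[of _ "dim_row A" "dim_col A" _ _ "dim_col C"]) auto

text \<open>By homogeneity the condition on states extends to positive semidefinite matrices of
  positive trace. Compressions of a state are of this kind, but in general not normalized.\<close>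

lemma psd_not_density_imp:
  assumes Q: "Q \<in> carrier_mat (m * n) d" and \<Psi>: "mat_linear_map n \<Psi>"
    and bad: "\<And>W. density_matrix d W \<Longrightarrow> \<not> psd_mat (m * n) (id_tensor m n \<Psi> (Q * W * mat_adjoint Q))"
    and W: "psd_mat d W" "0 < Re (mat_trace W)"
  shows "\<not> psd_mat (m * n) (id_tensor m n \<Psi> (Q * W * mat_adjoint Q))"
proof
  assume p: "psd_mat (m * n) (id_tensor m n \<Psi> (Q * W * mat_adjoint Q))"
  define t where "t = Re (mat_trace W)"
  have t: "0 < t" using W(2) by (simp add: t_def)
  have Wc: "W \<in> carrier_mat d d" using psd_carrier[OF W(1)] .
  have d: "density_matrix d (complex_of_real (1 / t) \<cdot>\<^sub>m W)"
    unfolding t_def by (rule psd_normalize[OF W])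
  have "Q * (complex_of_real (1 / t) \<cdot>\<^sub>m W) * mat_adjoint Q =
      complex_of_real (1 / t) \<cdot>\<^sub>m (Q * W * mat_adjoint Q)"
    using Q Wc mult_smult_distrib[OF Q Wc]
      mult_smult_assoc_mat[of "Q * W" "m * n" d "mat_adjoint Q" "m * n"] by auto
  then have "id_tensor m n \<Psi> (Q * (complex_of_real (1 / t) \<cdot>\<^sub>m W) * mat_adjoint Q) =
      complex_of_real (1 / t) \<cdot>\<^sub>m id_tensor m n \<Psi> (Q * W * mat_adjoint Q)"
    using id_tensor_smult[OF \<Psi> mult_carrier_mat[OF mult_carrier_mat[OF Q Wc] adj_carrier[OF Q]]] by simp
  then show False
    using bad[OF d] psd_smult[OF p, of "1 / t"] t by simp
qed

definition incl_left :: "nat \<Rightarrow> nat \<Rightarrow> complex mat" where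
  "incl_left p q = mat (p + q) p (\<lambda>(i, j). if i = j then 1 else 0)"

definition incl_right :: "nat \<Rightarrow> nat \<Rightarrow> complex mat" where
  "incl_right p q = mat (p + q) q (\<lambda>(i, j). if i = p + j then 1 else 0)"

lemma incl_dim [simp]:
  "dim_row (incl_left p q) = p + q" "dim_col (incl_left p q) = p"
  "dim_row (incl_right p q) = p + q" "dim_col (incl_right p q) = q"
  by (simp_all add: incl_left_def incl_right_def)

lemma incl_carrier:
  "incl_left p q \<in> carrier_mat (p + q) p" "incl_right p q \<in> carrier_mat (p + q) q"
  by (auto simp: incl_left_def incl_right_def)

lemma incl_products:
  "mat_adjoint (incl_left p q) * incl_left p q = 1\<^sub>m p"
  "mat_adjoint (incl_right p q) * incl_right p q = 1\<^sub>m q"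
  "mat_adjoint (incl_left p q) * incl_right p q = 0\<^sub>m p q"
  "mat_adjoint (incl_right p q) * incl_left p q = 0\<^sub>m q p"
  by (rule eq_matI; auto simp: mult_index_sum incl_left_def incl_right_def
      if_distrib[of "\<lambda>x. x * _"] if_distrib[of cnj] cong: if_cong simp del: index_mult_mat(1))+

lemma incl_decomposition:
  "incl_left p q * mat_adjoint (incl_left p q) + incl_right p q * mat_adjoint (incl_right p q) = 1\<^sub>m (p + q)"
proof (rule eq_matI)
  fix i j assume "i < dim_row (1\<^sub>m (p + q))" "j < dim_col (1\<^sub>m (p + q))"
  then have ij: "i < p + q" "j < p + q" by auto
  have 1: "(incl_left p q * mat_adjoint (incl_left p q)) $$ (i, j) = (if i = j \<and> i < p then 1 else 0)"
  proof -
    have "(incl_left p q * mat_adjoint (incl_left p q)) $$ (i, j) =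
        (\<Sum>k<p. (if i = k then 1 else 0) * cnj (if j = k then 1 else 0))"
      using ij by (subst mult_index_sum) (auto simp: incl_left_def)
    also have "\<dots> = (\<Sum>k<p. if k = i then (if i = j then 1 else 0) else 0)"
      by (intro sum.cong) auto
    finally show ?thesis by simp
  qed
  have 2: "(incl_right p q * mat_adjoint (incl_right p q)) $$ (i, j) = (if i = j \<and> \<not> i < p then 1 else 0)"
  proof -
    have "(incl_right p q * mat_adjoint (incl_right p q)) $$ (i, j) =
        (\<Sum>k<q. (if i = p + k then 1 else 0) * cnj (if j = p + k then 1 else 0))"
      using ij by (subst mult_index_sum) (auto simp: incl_right_def)
    also have "\<dots> = (\<Sum>k<q. if k = i - p then (if i = j \<and> \<not> i < p then 1 else 0) else 0)"
      by (intro sum.cong) auto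
    finally show ?thesis using ij by auto
  qed
  show "(incl_left p q * mat_adjoint (incl_left p q) + incl_right p q * mat_adjoint (incl_right p q)) $$ (i, j)
     = 1\<^sub>m (p + q) $$ (i, j)"
    using ij 1 2 by (simp del: index_mult_mat(1))
qed auto

lemma amp_zero: "amp n (0\<^sub>m p q) = 0\<^sub>m (p * n) (q * n)"
  by (rule eq_matI) (auto simp: amp_def less_mult_imp_div_less)

text \<open>If the image of a state on the direct sum were positive semidefinite, then so would be its two
  compressions, and one of these comes from a nonzero state.\<close>

lemma good_dim_add:
  assumes \<Psi>: "mat_linear_map n \<Psi>" and g: "good_dim m n \<Psi> d" "good_dim k n \<Psi> e"
  shows "good_dim (m + k) n \<Psi> (d + e)"
proof -
  obtain Q1 where Q1: "Q1 \<in> carrier_mat (m * n) d" "mat_adjoint Q1 * Q1 = 1\<^sub>m d"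
    and bad1: "\<And>W. density_matrix d W \<Longrightarrow> \<not> psd_mat (m * n) (id_tensor m n \<Psi> (Q1 * W * mat_adjoint Q1))"
    using g(1) by (auto simp: good_dim_def)
  obtain Q2 where Q2: "Q2 \<in> carrier_mat (k * n) e" "mat_adjoint Q2 * Q2 = 1\<^sub>m e"
    and bad2: "\<And>W. density_matrix e W \<Longrightarrow> \<not> psd_mat (k * n) (id_tensor k n \<Psi> (Q2 * W * mat_adjoint Q2))"
    using g(2) by (auto simp: good_dim_def)
  let ?N = "(m + k) * n"
  define E1 where "E1 = amp n (incl_left m k)"
  define E2 where "E2 = amp n (incl_right m k)"
  define F1 where "F1 = incl_left d e"
  define F2 where "F2 = incl_right d e"
  have dims: "dim_row E1 = ?N" "dim_col E1 = m * n" "dim_row E2 = ?N" "dim_col E2 = k * n"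
    "dim_row F1 = d + e" "dim_col F1 = d" "dim_row F2 = d + e" "dim_col F2 = e"
    by (simp_all add: E1_def E2_def F1_def F2_def)
  have Qdims: "dim_row Q1 = m * n" "dim_col Q1 = d" "dim_row Q2 = k * n" "dim_col Q2 = e"
    using Q1 Q2 by auto
  have EE: "mat_adjoint E1 * E1 = 1\<^sub>m (m * n)" "mat_adjoint E2 * E2 = 1\<^sub>m (k * n)"
    "mat_adjoint E1 * E2 = 0\<^sub>m (m * n) (k * n)" "mat_adjoint E2 * E1 = 0\<^sub>m (k * n) (m * n)"
    unfolding E1_def E2_def amp_adj
    using amp_mult[OF adj_carrier[OF incl_carrier(1)[of m k]] incl_carrier(1)[of m k], of n]
      amp_mult[OF adj_carrier[OF incl_carrier(2)[of m k]] incl_carrier(2)[of m k], of n]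
      amp_mult[OF adj_carrier[OF incl_carrier(1)[of m k]] incl_carrier(2)[of m k], of n]
      amp_mult[OF adj_carrier[OF incl_carrier(2)[of m k]] incl_carrier(1)[of m k], of n]
    by (simp_all add: incl_products amp_one amp_zero)
  have cancel: "mat_adjoint E1 * (E1 * X) = X" "mat_adjoint E2 * (E1 * X) = 0\<^sub>m (k * n) (dim_col X)"
    if "dim_row X = m * n" for X
  proof -
    have X: "X \<in> carrier_mat (m * n) (dim_col X)" using that by auto
    show "mat_adjoint E1 * (E1 * X) = X"
    proof -
      have "mat_adjoint E1 * (E1 * X) = mat_adjoint E1 * E1 * X"
        using dims that by (intro mult_assoc_dim[symmetric]; simp)
      then show ?thesis unfolding EE(1) using X by simp
    qed
    show "mat_adjoint E2 * (E1 * X) = 0\<^sub>m (k * n) (dim_col X)"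
    proof -
      have "mat_adjoint E2 * (E1 * X) = mat_adjoint E2 * E1 * X"
        using dims that by (intro mult_assoc_dim[symmetric]; simp)
      then show ?thesis unfolding EE(4) using left_mult_zero_mat[OF X] by simp
    qed
  qed
  have cancel': "mat_adjoint E2 * (E2 * X) = X" "mat_adjoint E1 * (E2 * X) = 0\<^sub>m (m * n) (dim_col X)"
    if "dim_row X = k * n" for X
  proof -
    have X: "X \<in> carrier_mat (k * n) (dim_col X)" using that by auto
    show "mat_adjoint E2 * (E2 * X) = X"
    proof -
      have "mat_adjoint E2 * (E2 * X) = mat_adjoint E2 * E2 * X"
        using dims that by (intro mult_assoc_dim[symmetric]; simp)
      then show ?thesis unfolding EE(2) using X by simp
    qed
    show "mat_adjoint E1 * (E2 * X) = 0\<^sub>m (m * n) (dim_col X)"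
    proof -
      have "mat_adjoint E1 * (E2 * X) = mat_adjoint E1 * E2 * X"
        using dims that by (intro mult_assoc_dim[symmetric]; simp)
      then show ?thesis unfolding EE(3) using left_mult_zero_mat[OF X] by simp
    qed
  qed
  define A where "A = Q1 * mat_adjoint F1"
  define B where "B = Q2 * mat_adjoint F2"
  have ABc: "A \<in> carrier_mat (m * n) (d + e)" "B \<in> carrier_mat (k * n) (d + e)"
    using Qdims dims by (auto simp: A_def B_def)
  \<comment> \<open>The direct sum of the two isometries: \<open>F1\<close>, \<open>F2\<close> split
    the domain and \<open>E1\<close>, \<open>E2\<close> embed the summands of the outer factor,
    tensored with C^n.\<close>
  define Q where "Q = E1 * A + E2 * B"
  have Qc: "Q \<in> carrier_mat ?N (d + e)" using ABc dims by (auto simp: Q_def)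
  have E1Q: "mat_adjoint E1 * Q = A" and E2Q: "mat_adjoint E2 * Q = B"
    using ABc dims by (simp_all add: Q_def mult_add_dim cancel cancel')
  have "mat_adjoint Q * Q = mat_adjoint A * A + mat_adjoint B * B"
  proof -
    have "mat_adjoint Q * Q = mat_adjoint A * (mat_adjoint E1 * Q) + mat_adjoint B * (mat_adjoint E2 * Q)"
      using ABc dims by (simp add: Q_def adj_add adj_mult add_mult_dim mult_assoc_dim)
    then show ?thesis by (simp add: E1Q E2Q)
  qed
  also have "mat_adjoint A * A = F1 * (mat_adjoint Q1 * Q1) * mat_adjoint F1"
    using Qdims dims by (simp add: A_def adj_mult mult_assoc_dim)
  also have "mat_adjoint B * B = F2 * (mat_adjoint Q2 * Q2) * mat_adjoint F2"
    using Qdims dims by (simp add: B_def adj_mult mult_assoc_dim)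
  also have "F1 * (mat_adjoint Q1 * Q1) * mat_adjoint F1 + F2 * (mat_adjoint Q2 * Q2) * mat_adjoint F2 = 1\<^sub>m (d + e)"
    unfolding Q1(2) Q2(2) using incl_decomposition[of d e] incl_carrier[of d e] by (simp add: F1_def F2_def)
  finally have iso: "mat_adjoint Q * Q = 1\<^sub>m (d + e)" .
  have "\<not> psd_mat ?N (id_tensor (m + k) n \<Psi> (Q * W * mat_adjoint Q))" if W: "density_matrix (d + e) W" for W
  proof
    assume p: "psd_mat ?N (id_tensor (m + k) n \<Psi> (Q * W * mat_adjoint Q))"
    have Wc: "W \<in> carrier_mat (d + e) (d + e)" using density_carrier[OF W] .
    have Xc: "Q * W * mat_adjoint Q \<in> carrier_mat ?N ?N" using Qc Wc by auto
    define W1 where "W1 = mat_adjoint F1 * W * mat_adjoint (mat_adjoint F1)"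
    define W2 where "W2 = mat_adjoint F2 * W * mat_adjoint (mat_adjoint F2)"
    have W1: "psd_mat d W1" and W2: "psd_mat e W2"
      unfolding W1_def W2_def F1_def F2_def
      by (intro psd_conj[OF density_psd[OF W]] adj_carrier incl_carrier)+
    \<comment> \<open>The compression acts on the outer factor only, so it commutes with I \<otimes>
      \<Psi>; applied to the state it leaves the corner \<open>W1\<close> of \<open>W\<close> in the
      coordinates of \<open>Q1\<close>.\<close>
    have "mat_adjoint E1 * (Q * W * mat_adjoint Q) * mat_adjoint (mat_adjoint E1) =
        (mat_adjoint E1 * Q) * W * mat_adjoint (mat_adjoint E1 * Q)"
      using Qc Wc dims by (simp add: adj_mult mult_assoc_dim)
    also have "\<dots> = Q1 * W1 * mat_adjoint Q1"
      unfolding E1Q using Qdims Wc dims by (simp add: A_def W1_def adj_mult mult_assoc_dim)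
    finally have "id_tensor m n \<Psi> (Q1 * W1 * mat_adjoint Q1) =
        mat_adjoint E1 * id_tensor (m + k) n \<Psi> (Q * W * mat_adjoint Q) * mat_adjoint (mat_adjoint E1)"
      using id_tensor_amp_conj[OF \<Psi> adj_carrier[OF incl_carrier(1)] Xc] by (simp add: E1_def amp_adj)
    then have p1: "psd_mat (m * n) (id_tensor m n \<Psi> (Q1 * W1 * mat_adjoint Q1))"
      using psd_conj[OF p, of "mat_adjoint E1" "m * n"] dims by (metis adj_dim carrier_matI)
    have "mat_adjoint E2 * (Q * W * mat_adjoint Q) * mat_adjoint (mat_adjoint E2) =
        (mat_adjoint E2 * Q) * W * mat_adjoint (mat_adjoint E2 * Q)"
      using Qc Wc dims by (simp add: adj_mult mult_assoc_dim)
    also have "\<dots> = Q2 * W2 * mat_adjoint Q2"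
      unfolding E2Q using Qdims Wc dims by (simp add: B_def W2_def adj_mult mult_assoc_dim)
    finally have "id_tensor k n \<Psi> (Q2 * W2 * mat_adjoint Q2) =
        mat_adjoint E2 * id_tensor (m + k) n \<Psi> (Q * W * mat_adjoint Q) * mat_adjoint (mat_adjoint E2)"
      using id_tensor_amp_conj[OF \<Psi> adj_carrier[OF incl_carrier(2)] Xc] by (simp add: E2_def amp_adj)
    then have p2: "psd_mat (k * n) (id_tensor k n \<Psi> (Q2 * W2 * mat_adjoint Q2))"
      using psd_conj[OF p, of "mat_adjoint E2" "k * n"] dims by (metis adj_dim carrier_matI)
    \<comment> \<open>The two corners of \<open>W\<close> carry its full diagonal, so their traces
      add up to 1 and one of them is positive.\<close>
    have "mat_trace W1 + mat_trace W2 = mat_trace (W * (F1 * mat_adjoint F1)) + mat_trace (W * (F2 * mat_adjoint F2))"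
      using Wc dims trace_comm[of "mat_adjoint F1" "W * F1"] trace_comm[of "mat_adjoint F2" "W * F2"]
      by (simp add: W1_def W2_def mult_assoc_dim)
    also have "\<dots> = mat_trace (W * (F1 * mat_adjoint F1) + W * (F2 * mat_adjoint F2))"
      using Wc dims by (subst mat_trace_add[of _ "d + e"]) (auto intro!: mult_carrier_mat)
    also have "W * (F1 * mat_adjoint F1) + W * (F2 * mat_adjoint F2) = W * (F1 * mat_adjoint F1 + F2 * mat_adjoint F2)"
      using Wc dims by (subst mult_add_dim) auto
    also have "\<dots> = W" using Wc by (simp add: F1_def F2_def incl_decomposition)
    finally have "Re (mat_trace W1) + Re (mat_trace W2) = 1"
      using density_trace[OF W] by (metis one_complex.sel(1) plus_complex.sel(1))
    then consider "0 < Re (mat_trace W1)" | "0 < Re (mat_trace W2)" by linarith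
    then show False
    proof cases
      case 1
      then show False using psd_not_density_imp[OF Q1(1) \<Psi> bad1 W1] p1 by blast
    next
      case 2
      then show False using psd_not_density_imp[OF Q2(1) \<Psi> bad2 W2] p2 by blast
    qed
  qed
  then show ?thesis unfolding good_dim_def using Qc iso by blast
qed

text \<open>The limit is the supremum of the ratios over positive indices, and the linear bound
  keeps this supremum finite.\<close>

lemma fekete_superadditive:
  fixes a :: "nat \<Rightarrow> nat"
  assumes super: "\<And>m k. a m + a k \<le> a (m + k)" and bound: "\<And>m. a m \<le> m * c"
  shows "convergent (\<lambda>m. real (a m) / real m)"
proof -
  define f where "f m = real (a m) / real m" for m
  define s where "s = (SUP m \<in> {1..}. f m)"
  have fc: "f m \<le> real c" for m
  proof (cases "m = 0")
    case False
    have "real (a m) \<le> real m * real c" using bound[of m] by (metis of_nat_le_iff of_nat_mult)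
    then show ?thesis using False by (simp add: f_def divide_le_eq mult.commute)
  qed (simp add: f_def)
  have bdd: "bdd_above (f ` {1..})" using fc by (intro bdd_aboveI[of _ "real c"]) auto
  have up: "f m \<le> s" if "m \<ge> 1" for m
    unfolding s_def using that by (intro cSUP_upper bdd) auto
  have mult: "q * a p \<le> a (q * p)" for q p
  proof (induction q)
    case (Suc q)
    have "Suc q * a p \<le> a p + a (q * p)" using Suc by simp
    also have "\<dots> \<le> a (Suc q * p)" using super[of p "q * p"] by simp
    finally show ?case .
  qed simp
  \<comment> \<open>Write m as q p + r. Superadditivity gives q times \<open>a p\<close> and the
    remainder only helps; replacing q by the smaller number m / p - 1 costs at most
    \<open>a p\<close>, hence at most \<open>a p / m\<close> in the ratio.\<close>
  have low: "f p - real (a p) / real m \<le> f m" if p: "p \<ge> 1" and m: "m \<ge> 1" for p m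
  proof -
    have "(m div p) * a p \<le> a ((m div p) * p)" by (rule mult)
    also have "\<dots> \<le> a ((m div p) * p + m mod p)" using super[of "(m div p) * p" "m mod p"] by simp
    also have "(m div p) * p + m mod p = m" by simp
    finally have 1: "real (m div p) * real (a p) \<le> real (a m)" by (metis of_nat_le_iff of_nat_mult)
    have "m < (m div p + 1) * p" using p dividend_less_div_times[of p m] by simp
    then have "real m \<le> (real (m div p) + 1) * real p"
      by (metis less_imp_le of_nat_1 of_nat_add of_nat_le_iff of_nat_mult)
    then have "real m / real p - 1 \<le> real (m div p)" using p by (simp add: field_simps)
    then have "(real m / real p - 1) * real (a p) \<le> real (m div p) * real (a p)"
      by (intro mult_right_mono) auto
    then have "(real m / real p - 1) * real (a p) \<le> real (a m)" using 1 by linarith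
    then have "(real m / real p - 1) * real (a p) / real m \<le> f m"
      unfolding f_def by (intro divide_right_mono) auto
    moreover have "(real m / real p - 1) * real (a p) / real m = f p - real (a p) / real m"
      using m p by (simp add: f_def field_simps)
    ultimately show ?thesis by simp
  qed
  \<comment> \<open>Half of \<epsilon> pays for choosing \<open>p\<close> with nearly optimal ratio,
    the other half for the remainder term \<open>a p / m\<close>, which vanishes as \<open>m\<close>
    grows with \<open>p\<close> fixed.\<close>
  have "f \<longlonglongrightarrow> s"
  proof (rule LIMSEQ_I)
    fix \<epsilon> :: real assume \<epsilon>: "0 < \<epsilon>"
    have "s - \<epsilon> / 2 < s" using \<epsilon> by simp
    then obtain p where p: "p \<ge> 1" "s - \<epsilon> / 2 < f p"
      unfolding s_def using less_cSUP_iff[OF _ bdd] by (metis atLeast_iff empty_iff order_refl)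
    obtain n0 where n0: "2 * real (a p) / \<epsilon> < real n0" using reals_Archimedean2 by blast
    show "\<exists>no. \<forall>m\<ge>no. norm (f m - s) < \<epsilon>"
    proof (intro exI[of _ "Suc n0"] allI impI)
      fix m assume m: "Suc n0 \<le> m"
      have "2 * real (a p) / \<epsilon> < real m" using n0 m by linarith
      then have "real (a p) / real m < \<epsilon> / 2" using \<epsilon> m by (simp add: field_simps)
      then show "norm (f m - s) < \<epsilon>" using low[OF p(1), of m] up[of m] p(2) m \<epsilon> by (simp add: abs_if)
    qed
  qed
  then show ?thesis unfolding f_def by (rule convergentI)
qed

text \<open>\<open>nu\<close> is defined by \<open>lim\<close>, which is informative only once
  convergence is known. Superadditivity comes from direct sums, and the linear bound from the
  dimension m n of the space.\<close>

lemma nu_m_ratio_convergent: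
  assumes "mat_linear_map n \<Psi>"
  shows "(\<lambda>m. real (nu_m m n \<Psi>) / real m) \<longlonglongrightarrow> nu n \<Psi>"
proof -
  have "nu_m m n \<Psi> + nu_m k n \<Psi> \<le> nu_m (m + k) n \<Psi>" for m k
    using good_dim_add[OF assms good_dim_nu_m good_dim_nu_m] by (rule good_dim_le_nu_m)
  then have "convergent (\<lambda>m. real (nu_m m n \<Psi>) / real m)"
    using good_dim_le[OF good_dim_nu_m] by (rule fekete_superadditive)
  then show ?thesis unfolding nu_def convergent_LIMSEQ_iff .
qed

section \<open>Partial traces\<close>

text \<open>The suffix names the factor that is traced out: \<open>ptrace_right\<close> lands in
  M_m, \<open>ptrace_left\<close> in M_n.\<close>

definition ptrace_right :: "nat \<Rightarrow> nat \<Rightarrow> complex mat \<Rightarrow> complex mat" where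
  "ptrace_right m n X = mat m m (\<lambda>(i, j). \<Sum>k<n. X $$ (i * n + k, j * n + k))"

definition ptrace_left :: "nat \<Rightarrow> nat \<Rightarrow> complex mat \<Rightarrow> complex mat" where
  "ptrace_left m n X = mat n n (\<lambda>(k, l). \<Sum>i<m. X $$ (i * n + k, i * n + l))"

lemma quad_form_blocks:
  "quad_form (m * n) X g = (\<Sum>i<m. \<Sum>a<n. \<Sum>j<m. \<Sum>b<n.
     cnj (g (i * n + a)) * X $$ (i * n + a, j * n + b) * g (j * n + b))"
  by (simp add: quad_form_def sum_blocks)

text \<open>The arguments in the sum are the product vectors f \<otimes> e_k in coordinates, so
  positivity of the reduction is inherited from \<open>X\<close>.\<close>

lemma quad_form_ptrace_right:
  "quad_form m (ptrace_right m n X) f =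
    (\<Sum>k<n. quad_form (m * n) X (\<lambda>r. if r mod n = k then f (r div n) else 0))"
proof -
  have 1: "quad_form (m * n) X (\<lambda>r. if r mod n = k then f (r div n) else 0) =
      (\<Sum>i<m. \<Sum>j<m. cnj (f i) * X $$ (i * n + k, j * n + k) * f j)" if k: "k < n" for k
  proof -
    have "quad_form (m * n) X (\<lambda>r. if r mod n = k then f (r div n) else 0) =
        (\<Sum>i<m. \<Sum>a<n. if a = k then (\<Sum>j<m. cnj (f i) * X $$ (i * n + a, j * n + k) * f j) else 0)"
      unfolding quad_form_blocks
    proof (intro sum.cong refl)
      fix i a assume "i \<in> {..<m}" "a \<in> {..<n}"
      then have a: "a < n" by simp
      have "(\<Sum>b<n. cnj (if (i * n + a) mod n = k then f ((i * n + a) div n) else 0) *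
            X $$ (i * n + a, j * n + b) * (if (j * n + b) mod n = k then f ((j * n + b) div n) else 0)) =
          (\<Sum>b<n. if b = k then (if a = k then cnj (f i) * X $$ (i * n + a, j * n + k) * f j else 0) else 0)" for j
        using a by (intro sum.cong refl) auto
      then show "(\<Sum>j<m. \<Sum>b<n. cnj (if (i * n + a) mod n = k then f ((i * n + a) div n) else 0) *
            X $$ (i * n + a, j * n + b) * (if (j * n + b) mod n = k then f ((j * n + b) div n) else 0)) =
          (if a = k then (\<Sum>j<m. cnj (f i) * X $$ (i * n + a, j * n + k) * f j) else 0)"
        using k by simp
    qed
    then show ?thesis using k by simp
  qed
  have "(\<Sum>k<n. quad_form (m * n) X (\<lambda>r. if r mod n = k then f (r div n) else 0)) =
      (\<Sum>k<n. \<Sum>i<m. \<Sum>j<m. cnj (f i) * X $$ (i * n + k, j * n + k) * f j)"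
    using 1 by simp
  also have "\<dots> = (\<Sum>i<m. \<Sum>k<n. \<Sum>j<m. cnj (f i) * X $$ (i * n + k, j * n + k) * f j)"
    by (rule sum.swap)
  also have "\<dots> = (\<Sum>i<m. \<Sum>j<m. \<Sum>k<n. cnj (f i) * X $$ (i * n + k, j * n + k) * f j)"
    by (rule sum.cong[OF refl], rule sum.swap)
  also have "\<dots> = quad_form m (ptrace_right m n X) f"
    by (simp add: quad_form_def ptrace_right_def sum_distrib_left sum_distrib_right)
  finally show ?thesis ..
qed

text \<open>Here the arguments are the product vectors e_p \<otimes> f.\<close>

lemma quad_form_ptrace_left:
  "quad_form n (ptrace_left m n X) f =
    (\<Sum>p<m. quad_form (m * n) X (\<lambda>r. if r div n = p then f (r mod n) else 0))"
proof -
  have 1: "quad_form (m * n) X (\<lambda>r. if r div n = p then f (r mod n) else 0) =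
      (\<Sum>a<n. \<Sum>b<n. cnj (f a) * X $$ (p * n + a, p * n + b) * f b)" if p: "p < m" for p
  proof -
    have "quad_form (m * n) X (\<lambda>r. if r div n = p then f (r mod n) else 0) =
        (\<Sum>i<m. if i = p then (\<Sum>a<n. \<Sum>b<n. cnj (f a) * X $$ (p * n + a, p * n + b) * f b) else 0)"
      unfolding quad_form_blocks
    proof (intro sum.cong refl)
      fix i assume "i \<in> {..<m}"
      have "(\<Sum>j<m. \<Sum>b<n. cnj (if (i * n + a) div n = p then f ((i * n + a) mod n) else 0) *
            X $$ (i * n + a, j * n + b) * (if (j * n + b) div n = p then f ((j * n + b) mod n) else 0)) =
          (\<Sum>j<m. if j = p then (if i = p then \<Sum>b<n. cnj (f a) * X $$ (p * n + a, p * n + b) * f b else 0) else 0)"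
        if a: "a < n" for a
        using a by (intro sum.cong refl) auto
      then show "(\<Sum>a<n. \<Sum>j<m. \<Sum>b<n. cnj (if (i * n + a) div n = p then f ((i * n + a) mod n) else 0) *
            X $$ (i * n + a, j * n + b) * (if (j * n + b) div n = p then f ((j * n + b) mod n) else 0)) =
          (if i = p then (\<Sum>a<n. \<Sum>b<n. cnj (f a) * X $$ (p * n + a, p * n + b) * f b) else 0)"
        using p by simp
    qed
    then show ?thesis using p by simp
  qed
  have "(\<Sum>p<m. quad_form (m * n) X (\<lambda>r. if r div n = p then f (r mod n) else 0)) =
      (\<Sum>p<m. \<Sum>a<n. \<Sum>b<n. cnj (f a) * X $$ (p * n + a, p * n + b) * f b)"
    using 1 by simp
  also have "\<dots> = (\<Sum>a<n. \<Sum>p<m. \<Sum>b<n. cnj (f a) * X $$ (p * n + a, p * n + b) * f b)"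
    by (rule sum.swap)
  also have "\<dots> = (\<Sum>a<n. \<Sum>b<n. \<Sum>p<m. cnj (f a) * X $$ (p * n + a, p * n + b) * f b)"
    by (rule sum.cong[OF refl], rule sum.swap)
  also have "\<dots> = quad_form n (ptrace_left m n X) f"
    by (simp add: quad_form_def ptrace_left_def sum_distrib_left sum_distrib_right)
  finally show ?thesis ..
qed

lemma trace_ptrace_left:
  "X \<in> carrier_mat (m * n) (m * n) \<Longrightarrow> mat_trace (ptrace_left m n X) = mat_trace X"
  by (simp add: mat_trace_def ptrace_left_def sum_blocks) (rule sum.swap)

lemma ptrace_right_hermitian:
  "hermitian_mat (m * n) X \<Longrightarrow> hermitian_mat m (ptrace_right m n X)"
  using hermitian_index[of "m * n" X]
  by (intro hermitian_matI) (auto simp: ptrace_right_def mult_add_less)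

lemma ptrace_left_density:
  assumes \<sigma>: "density_matrix (m * n) \<sigma>"
  shows "density_matrix n (ptrace_left m n \<sigma>)"
proof -
  have p: "psd_mat (m * n) \<sigma>" using density_psd[OF \<sigma>] .
  have "hermitian_mat n (ptrace_left m n \<sigma>)"
    using hermitian_index[OF psd_hermitian[OF p]]
    by (intro hermitian_matI) (auto simp: ptrace_left_def mult_add_less)
  moreover have "0 \<le> Re (quad_form n (ptrace_left m n \<sigma>) f)" for f
    using p unfolding quad_form_ptrace_left psd_mat_iff by (simp add: sum_nonneg)
  ultimately show ?thesis
    using density_trace[OF \<sigma>] trace_ptrace_left[OF density_carrier[OF \<sigma>]]
    by (simp add: density_matrix_def psd_mat_iff)
qed

text \<open>The trace of \<Psi> is a linear functional evaluated on the diagonal blocks, and these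
  sum to the reduction to M_n. This is how a state on the large space is compared with the minimum
  over states of M_n.\<close>

lemma trace_id_tensor:
  assumes \<Psi>: "mat_linear_map n \<Psi>"
  shows "mat_trace (id_tensor m n \<Psi> X) = mat_trace (\<Psi> (ptrace_left m n X))"
proof -
  let ?f = "\<lambda>Y. mat_trace (\<Psi> Y)"
  have exp: "?f Y = (\<Sum>p \<in> {..<n} \<times> {..<n}. Y $$ p * ?f (unit_mat n p))" if "Y \<in> carrier_mat n n" for Y
    using mat_linear_mapD[OF \<Psi>]
    by (intro linear_functional_expand[OF _ _ that]) (auto simp: mat_trace_add[of _ n] mat_trace_smult[of _ n])
  have "mat_trace (id_tensor m n \<Psi> X) = (\<Sum>i<m. ?f (mat_block n X i i))"
    by (simp add: trace_diag_blocks[OF id_tensor_carrier] mat_block_id_tensor[OF \<Psi>])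
  also have "\<dots> = (\<Sum>i<m. \<Sum>p \<in> {..<n} \<times> {..<n}. mat_block n X i i $$ p * ?f (unit_mat n p))"
    by (intro sum.cong refl exp) simp
  also have "\<dots> = (\<Sum>p \<in> {..<n} \<times> {..<n}. \<Sum>i<m. mat_block n X i i $$ p * ?f (unit_mat n p))"
    by (rule sum.swap)
  also have "\<dots> = (\<Sum>p \<in> {..<n} \<times> {..<n}. ptrace_left m n X $$ p * ?f (unit_mat n p))"
    by (intro sum.cong refl) (auto simp: ptrace_left_def mat_block_def sum_distrib_right)
  also have "\<dots> = ?f (ptrace_left m n X)" by (rule exp[symmetric]) (simp add: ptrace_left_def)
  finally show ?thesis .
qed

section \<open>The depolarizing map and its scaled difference with \<Phi>\<close>

lemma depolarizing_linear: "mat_linear_map n (depolarizing n)"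
  unfolding mat_linear_map_iff depolarizing_def
  by (auto simp: mat_trace_add[of _ n] mat_trace_smult[of _ n] add_divide_distrib
      add_smult_distrib_right_mat[of _ n n] intro!: eq_matI)

lemma trace_depolarizing: "n \<ge> 1 \<Longrightarrow> mat_trace (depolarizing n X) = mat_trace X"
  by (simp add: depolarizing_def mat_trace_smult[of _ n] trace_one)

lemma depolarizing_hermiticity_preserving: "hermiticity_preserving n (depolarizing n)"
  unfolding hermiticity_preserving_def
proof (intro allI impI)
  fix X assume X: "hermitian_mat n X"
  have "mat_trace X / of_nat n = complex_of_real (Re (mat_trace X) / real n)"
    using hermitian_trace_Im[OF X] by (simp add: complex_eq_iff)
  then show "hermitian_mat n (depolarizing n X)"
    using hermitian_smult[OF hermitian_one] by (simp only: depolarizing_def)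
qed

text \<open>The image depends on \<open>X\<close> only through its reduction to M_m, so an operation
  on the outer factor alone can make it a multiple of the identity.\<close>

lemma id_tensor_depolarizing:
  "id_tensor m n (depolarizing n) X = amp n ((1 / of_nat n) \<cdot>\<^sub>m ptrace_right m n X)"
proof (rule eq_matI_blocks)
  fix i j k l assume *: "i < m" "j < m" "k < n" "l < n"
  have c: "(1 / of_nat n) \<cdot>\<^sub>m ptrace_right m n X \<in> carrier_mat m m" by (simp add: ptrace_right_def)
  show "id_tensor m n (depolarizing n) X $$ (i * n + k, j * n + l) =
    amp n ((1 / of_nat n) \<cdot>\<^sub>m ptrace_right m n X) $$ (i * n + k, j * n + l)"
    unfolding amp_index[OF c *]
    using * by (simp add: id_tensor_index depolarizing_def ptrace_right_def mat_trace_def mat_block_def)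
qed (auto simp: ptrace_right_def)

definition scaled_diff :: "nat \<Rightarrow> real \<Rightarrow> (complex mat \<Rightarrow> complex mat) \<Rightarrow> complex mat \<Rightarrow> complex mat" where
  "scaled_diff n x \<Phi> X = complex_of_real x \<cdot>\<^sub>m depolarizing n X - \<Phi> X"

lemma scaled_diff_linear:
  assumes \<Phi>: "mat_linear_map n \<Phi>"
  shows "mat_linear_map n (scaled_diff n x \<Phi>)"
proof -
  have c: "depolarizing n X \<in> carrier_mat n n" "\<Phi> X \<in> carrier_mat n n" if "X \<in> carrier_mat n n" for X
    using mat_linear_mapD(1)[OF depolarizing_linear that] mat_linear_mapD(1)[OF \<Phi> that] by auto
  show ?thesis
    unfolding mat_linear_map_iff scaled_diff_def
  proof (intro conjI ballI allI)
    fix X Y :: "complex mat" assume XY: "X \<in> carrier_mat n n" "Y \<in> carrier_mat n n"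
    show "complex_of_real x \<cdot>\<^sub>m depolarizing n (X + Y) - \<Phi> (X + Y) =
      complex_of_real x \<cdot>\<^sub>m depolarizing n X - \<Phi> X + (complex_of_real x \<cdot>\<^sub>m depolarizing n Y - \<Phi> Y)"
      using c[OF XY(1)] c[OF XY(2)]
      unfolding mat_linear_mapD(2)[OF depolarizing_linear XY] mat_linear_mapD(2)[OF \<Phi> XY]
      by (intro eq_matI) (auto simp: algebra_simps)
  next
    fix a :: complex and X :: "complex mat" assume X: "X \<in> carrier_mat n n"
    show "complex_of_real x \<cdot>\<^sub>m depolarizing n (a \<cdot>\<^sub>m X) - \<Phi> (a \<cdot>\<^sub>m X) =
      a \<cdot>\<^sub>m (complex_of_real x \<cdot>\<^sub>m depolarizing n X - \<Phi> X)"
      using c[OF X]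
      unfolding mat_linear_mapD(3)[OF depolarizing_linear X] mat_linear_mapD(3)[OF \<Phi> X]
      by (intro eq_matI) (auto simp: algebra_simps)
  qed (use c in \<open>auto intro!: minus_carrier_mat\<close>)
qed

lemma scaled_diff_hermiticity_preserving:
  assumes \<Phi>: "hermiticity_preserving n \<Phi>"
  shows "hermiticity_preserving n (scaled_diff n x \<Phi>)"
  unfolding hermiticity_preserving_def
proof (intro allI impI)
  fix X assume X: "hermitian_mat n X"
  have 1: "hermitian_mat n (complex_of_real x \<cdot>\<^sub>m depolarizing n X)" and 2: "hermitian_mat n (\<Phi> X)"
    using X \<Phi> depolarizing_hermiticity_preserving
    by (auto simp: hermiticity_preserving_def intro!: hermitian_smult)
  have "scaled_diff n x \<Phi> X = complex_of_real x \<cdot>\<^sub>m depolarizing n X + complex_of_real (-1) \<cdot>\<^sub>m \<Phi> X"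
    using hermitian_carrier[OF 1] hermitian_carrier[OF 2]
    unfolding scaled_diff_def by (intro eq_matI) auto
  then show "hermitian_mat n (scaled_diff n x \<Phi> X)"
    using hermitian_add[OF 1 hermitian_smult[OF 2, of "-1"]] by simp
qed

lemma trace_scaled_diff:
  assumes \<Phi>: "mat_linear_map n \<Phi>" and n: "n \<ge> 1" and \<rho>: "density_matrix n \<rho>"
  shows "mat_trace (scaled_diff n x \<Phi> \<rho>) = of_real x - mat_trace (\<Phi> \<rho>)"
proof -
  have c: "depolarizing n \<rho> \<in> carrier_mat n n" "\<Phi> \<rho> \<in> carrier_mat n n"
    using mat_linear_mapD(1)[OF depolarizing_linear] mat_linear_mapD(1)[OF \<Phi>] density_carrier[OF \<rho>] by auto
  have "scaled_diff n x \<Phi> \<rho> = of_real x \<cdot>\<^sub>m depolarizing n \<rho> + (-1) \<cdot>\<^sub>m \<Phi> \<rho>"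
    using c unfolding scaled_diff_def by (intro eq_matI) auto
  then show ?thesis
    using c n density_trace[OF \<rho>]
    by (simp add: mat_trace_add[of _ n] mat_trace_smult[of _ n] trace_depolarizing)
qed

lemma id_tensor_scaled_diff:
  assumes \<Phi>: "mat_linear_map n \<Phi>"
  shows "id_tensor m n (scaled_diff n x \<Phi>) X =
    of_real x \<cdot>\<^sub>m id_tensor m n (depolarizing n) X + (-1) \<cdot>\<^sub>m id_tensor m n \<Phi> X"
proof (rule eq_matI_blocks)
  fix i j k l assume *: "i < m" "j < m" "k < n" "l < n"
  have c: "depolarizing n (mat_block n X i j) \<in> carrier_mat n n" "\<Phi> (mat_block n X i j) \<in> carrier_mat n n"
    using mat_linear_mapD(1)[OF depolarizing_linear] mat_linear_mapD(1)[OF \<Phi>] by auto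
  then show "id_tensor m n (scaled_diff n x \<Phi>) X $$ (i * n + k, j * n + l) =
    (of_real x \<cdot>\<^sub>m id_tensor m n (depolarizing n) X + (-1) \<cdot>\<^sub>m id_tensor m n \<Phi> X) $$ (i * n + k, j * n + l)"
    using * by (simp add: id_tensor_index mult_add_less scaled_diff_def)
qed (auto intro!: carrier_matI)

text \<open>\<open>Q Q\<^sup>*\<close> is a Gram matrix, and so is its complement, a Hermitian
  idempotent. The form of the projection therefore lies between 0 and the squared norm, and that of
  the reflection between plus and minus the squared norm.\<close>

lemma projection_contraction_form:
  assumes Q: "Q \<in> carrier_mat N d" and iso: "mat_adjoint Q * Q = 1\<^sub>m d"
  shows "contraction_form N (2 \<cdot>\<^sub>m (Q * mat_adjoint Q) + (-1) \<cdot>\<^sub>m 1\<^sub>m N)"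
proof -
  let ?P = "Q * mat_adjoint Q"
  have Pc: "?P \<in> carrier_mat N N" using Q by auto
  have P: "psd_mat N ?P" by (rule psd_gram[OF Q])
  define Z where "Z = 1\<^sub>m N + (-1) \<cdot>\<^sub>m ?P"
  have Zc: "Z \<in> carrier_mat N N" using Pc by (simp add: Z_def)
  have PP: "?P * ?P = ?P"
  proof -
    have "?P * ?P = Q * (mat_adjoint Q * Q) * mat_adjoint Q" using Q by (simp add: mult_assoc_dim)
    then show ?thesis using Q iso by simp
  qed
  have adjZ: "mat_adjoint Z = Z"
    using Pc Q hermitian_adj[OF psd_hermitian[OF P]] by (simp add: Z_def adj_add adj_smult)
  have "Z * mat_adjoint Z = Z * 1\<^sub>m N + (-1) \<cdot>\<^sub>m (Z * ?P)"
    unfolding adjZ using Zc Pc Q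
    by (subst (2) Z_def) (simp add: mult_add_dim mult_smult_distrib[OF Zc Pc])
  also have "Z * ?P = 0\<^sub>m N N"
  proof -
    have "Z * ?P = ?P + (-1) \<cdot>\<^sub>m (?P * ?P)"
      unfolding Z_def using Pc by (subst add_mult_dim) (auto simp: mult_smult_assoc_mat[OF Pc Pc])
    also have "\<dots> = 0\<^sub>m N N" unfolding PP using Pc Q by (intro eq_matI) (auto simp del: index_mult_mat(1))
    finally show ?thesis .
  qed
  finally have "Z * mat_adjoint Z = Z" using Zc by (simp add: smult_zero_mat)
  then have Zp: "psd_mat N Z" using psd_gram[OF Zc] by simp
  have "\<bar>Re (quad_form N (2 \<cdot>\<^sub>m ?P + (-1) \<cdot>\<^sub>m 1\<^sub>m N) f)\<bar> \<le> (\<Sum>i<N. (cmod (f i))\<^sup>2)" for f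
  proof -
    have "0 \<le> Re (quad_form N ?P f)" using P by (simp add: psd_mat_iff)
    moreover have "Re (quad_form N Z f) = (\<Sum>i<N. (cmod (f i))\<^sup>2) - Re (quad_form N ?P f)"
      unfolding Z_def using Pc by (simp add: quad_form_add quad_form_smult quad_form_one)
    moreover have "0 \<le> Re (quad_form N Z f)" using Zp by (simp add: psd_mat_iff)
    moreover have "Re (quad_form N (2 \<cdot>\<^sub>m ?P + (-1) \<cdot>\<^sub>m 1\<^sub>m N) f) =
        2 * Re (quad_form N ?P f) - (\<Sum>i<N. (cmod (f i))\<^sup>2)"
      using Pc by (simp add: quad_form_add quad_form_smult quad_form_one)
    ultimately show ?thesis by linarith
  qed
  then show ?thesis using Pc by (simp add: contraction_form_def)
qed

section \<open>The dimension bound\<close>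

text \<open>The form of the reduction is a sum of values of the form of \<open>D'\<close> at the
  vectors f \<otimes> e_k. All are nonnegative, and the one with k = 0 is at least \<epsilon> times
  the squared norm of \<open>f\<close>.\<close>

lemma ptrace_right_positive_definite:
  assumes n: "n \<ge> 1" and D: "psd_mat (m * n) D" and \<epsilon>: "0 < \<epsilon>" and f: "\<exists>i<m. f i \<noteq> 0"
  defines "D' \<equiv> D + complex_of_real \<epsilon> \<cdot>\<^sub>m 1\<^sub>m (m * n)"
  shows "0 < Re (quad_form m (ptrace_right m n D') f)"
proof -
  have Dc: "D \<in> carrier_mat (m * n) (m * n)" using psd_carrier[OF D] .
  obtain i where i: "i < m" "f i \<noteq> 0" using f by blast
  define g where "g k = (\<lambda>r. if r mod n = k then f (r div n) else 0)" for k
  have q: "Re (quad_form (m * n) D' g) \<ge> \<epsilon> * (\<Sum>r<m * n. (cmod (g r))\<^sup>2)" for g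
  proof -
    have "quad_form (m * n) D' g = quad_form (m * n) D g + of_real \<epsilon> * of_real (\<Sum>r<m * n. (cmod (g r))\<^sup>2)"
      using Dc unfolding D'_def
      by (subst quad_form_add) (auto simp: quad_form_smult[OF one_carrier_mat] quad_form_one)
    then have "Re (quad_form (m * n) D' g) = Re (quad_form (m * n) D g) + \<epsilon> * (\<Sum>r<m * n. (cmod (g r))\<^sup>2)"
      by (simp only: of_real_mult[symmetric] plus_complex.sel Re_complex_of_real)
    then show ?thesis using D by (simp add: psd_mat_iff)
  qed
  have "0 < \<epsilon> * (cmod (f i))\<^sup>2" using \<epsilon> i by simp
  also have "\<dots> = \<epsilon> * (cmod (g 0 (i * n + 0)))\<^sup>2" using n by (simp add: g_def)
  also have "\<dots> \<le> \<epsilon> * (\<Sum>r<m * n. (cmod (g 0 r))\<^sup>2)"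
    using \<epsilon> i n mult_add_less[of i m 0 n]
    by (intro mult_left_mono member_le_sum[where f = "\<lambda>r. (cmod (g 0 r))\<^sup>2"]) auto
  also have "\<dots> \<le> Re (quad_form (m * n) D' (g 0))" by (rule q)
  also have "\<dots> \<le> (\<Sum>k<n. Re (quad_form (m * n) D' (g k)))"
  proof (rule member_le_sum)
    fix k assume "k \<in> {..<n} - {0}"
    have "0 \<le> \<epsilon> * (\<Sum>r<m * n. (cmod (g k r))\<^sup>2)" using \<epsilon> by (simp add: sum_nonneg)
    then show "0 \<le> Re (quad_form (m * n) D' (g k))" using q[of "g k"] by linarith
  qed (use n in auto)
  also have "\<dots> = Re (quad_form m (ptrace_right m n D') f)"
    by (simp add: quad_form_ptrace_right g_def)
  finally show ?thesis .
qed

text \<open>By duality and separation, a good isometry \<open>Q\<close> of dimension \<open>d\<close> yields a positive definite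
  \<open>Y\<close> for which $(I \otimes \Phi)(Y)$ is negative on the range of \<open>Q\<close>.\<close>

lemma good_dim_dual_witness:
  assumes \<Phi>: "mat_linear_map n \<Phi>" and hp: "hermiticity_preserving n \<Phi>" and adj: "is_adjoint_map n \<Phi> \<Psi>"
    and Q: "Q \<in> carrier_mat (m * n) d" and iso: "mat_adjoint Q * Q = 1\<^sub>m d" and d: "0 < d"
    and bad: "\<And>W. density_matrix d W \<Longrightarrow> \<not> psd_mat (m * n) (id_tensor m n \<Psi> (Q * W * mat_adjoint Q))"
  obtains D \<epsilon> where "psd_mat (m * n) D" "0 < \<epsilon>"
    "\<And>W. psd_mat d W \<Longrightarrow> 0 < Re (mat_trace W) \<Longrightarrow>
      Re (mat_trace (id_tensor m n \<Phi> (D + complex_of_real \<epsilon> \<cdot>\<^sub>m 1\<^sub>m (m * n)) * (Q * W * mat_adjoint Q))) < 0"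
proof -
  let ?N = "m * n"
  have \<Psi>: "mat_linear_map n \<Psi>" using adj by (simp add: is_adjoint_map_def)
  have hp': "hermiticity_preserving n \<Psi>" by (rule hermiticity_preserving_adjoint[OF adj \<Phi> hp])
  define T where "T W = id_tensor m n \<Psi> (Q * W * mat_adjoint Q)" for W
  have QWc: "Q * W * mat_adjoint Q \<in> carrier_mat ?N ?N" if "W \<in> carrier_mat d d" for W
    using Q that by auto
  have Tc: "T W \<in> carrier_mat ?N ?N" for W by (simp add: T_def)
  have T_add: "T (V + W) = T V + T W" if "V \<in> carrier_mat d d" "W \<in> carrier_mat d d" for V W
  proof -
    have "Q * (V + W) * mat_adjoint Q = Q * V * mat_adjoint Q + Q * W * mat_adjoint Q"
      using Q that by (simp add: mult_add_dim add_mult_dim)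
    then show ?thesis unfolding T_def using id_tensor_add[OF \<Psi> QWc[OF that(1)] QWc[OF that(2)]] by simp
  qed
  have T_smult: "T (a \<cdot>\<^sub>m W) = a \<cdot>\<^sub>m T W" if "W \<in> carrier_mat d d" for a W
  proof -
    have "Q * (a \<cdot>\<^sub>m W) * mat_adjoint Q = a \<cdot>\<^sub>m (Q * W * mat_adjoint Q)"
      using mult_smult_distrib[OF Q that]
        mult_smult_assoc_mat[OF mult_carrier_mat[OF Q that] adj_carrier[OF Q]] by simp
    then show ?thesis unfolding T_def using id_tensor_smult[OF \<Psi> QWc[OF that]] by simp
  qed
  have T_herm: "hermitian_mat ?N (T W)" if "density_matrix d W" for W
    unfolding T_def
    by (intro id_tensor_hermitian[OF \<Psi> hp'] hermitian_conj[OF _ Q] psd_hermitian density_psd that)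
  obtain D c where D: "psd_mat ?N D" and c: "0 < c"
    and Dneg: "\<And>W. density_matrix d W \<Longrightarrow> Re (mat_trace (D * T W)) \<le> - c"
    using separation_from_psd_cone[of d T ?N, OF d Tc T_add T_smult T_herm] bad unfolding T_def by metis
  have Dc: "D \<in> carrier_mat ?N ?N" using psd_carrier[OF D] .
  define K where "K = (\<Sum>p \<in> {..<d} \<times> {..<d}. cmod (mat_trace (T (unit_mat d p))))"
  have K0: "0 \<le> K" by (simp add: K_def sum_nonneg)
  have K: "cmod (mat_trace (T W)) \<le> K" if "density_matrix d W" for W
    unfolding K_def
    by (rule linear_functional_bound[where f = "\<lambda>W. mat_trace (T W)", OF _ _ that])
      (auto simp: T_add T_smult mat_trace_add[OF Tc Tc] mat_trace_smult[OF Tc])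
  \<comment> \<open>\<open>K\<close> bounds the trace of \<open>T W\<close> over all states, so
    adding \<epsilon> I to \<open>D\<close> changes the functional by at most \<epsilon> K < c and
    keeps it negative.\<close>
  define \<epsilon> where "\<epsilon> = c / (2 * (K + 1))"
  have \<epsilon>: "0 < \<epsilon>" using c K0 by (simp add: \<epsilon>_def)
  have "\<epsilon> * K \<le> \<epsilon> * (K + 1)" using \<epsilon> by simp
  also have "\<dots> = c / 2" using K0 by (simp add: \<epsilon>_def field_simps)
  finally have \<epsilon>K: "\<epsilon> * K < c" using c by linarith
  define Y where "Y = D + complex_of_real \<epsilon> \<cdot>\<^sub>m 1\<^sub>m ?N"
  have Yc: "Y \<in> carrier_mat ?N ?N" using Dc by (simp add: Y_def)
  have neg: "Re (mat_trace (Y * T W)) < 0" if W: "density_matrix d W" for W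
  proof -
    have "Y * T W = D * T W + complex_of_real \<epsilon> \<cdot>\<^sub>m T W"
      using Dc Tc[of W] unfolding Y_def
      by (simp add: add_mult_distrib_mat[of _ ?N ?N _ _ ?N] mult_smult_assoc_mat[of _ ?N ?N _ ?N])
    then have "Re (mat_trace (Y * T W)) = Re (mat_trace (D * T W)) + \<epsilon> * Re (mat_trace (T W))"
      using Dc Tc[of W] by (simp add: mat_trace_add[of _ ?N] mat_trace_smult[of _ ?N])
    also have "\<epsilon> * Re (mat_trace (T W)) \<le> \<epsilon> * K"
      using K[OF W] \<epsilon> abs_Re_le_cmod[of "mat_trace (T W)"] by (intro mult_left_mono) auto
    finally show ?thesis using Dneg[OF W] \<epsilon>K by linarith
  qed
  have "Re (mat_trace (id_tensor m n \<Phi> Y * (Q * W * mat_adjoint Q))) < 0"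
    if W: "psd_mat d W" "0 < Re (mat_trace W)" for W
  proof -
    have Wc: "W \<in> carrier_mat d d" using psd_carrier[OF W(1)] .
    define t where "t = Re (mat_trace W)"
    have t: "0 < t" using W(2) by (simp add: t_def)
    have dW: "density_matrix d (complex_of_real (1 / t) \<cdot>\<^sub>m W)"
      unfolding t_def by (rule psd_normalize[OF W])
    have "Y * T (complex_of_real (1 / t) \<cdot>\<^sub>m W) = complex_of_real (1 / t) \<cdot>\<^sub>m (Y * T W)"
      unfolding T_smult[OF Wc] using mult_smult_distrib[OF Yc Tc] by simp
    then have "Re (mat_trace (Y * T (complex_of_real (1 / t) \<cdot>\<^sub>m W))) = 1 / t * Re (mat_trace (Y * T W))"
      using mat_trace_smult[OF mult_carrier_mat[OF Yc Tc], of "complex_of_real (1 / t)" W]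
      by (simp only: Re_complex_of_real times_complex.sel Im_complex_of_real)
    then have "1 / t * Re (mat_trace (Y * T W)) < 0" using neg[OF dW] by simp
    \<comment> \<open>Homogeneity has removed the normalization of \<open>W\<close>; duality now
      moves the map off the state and onto \<open>Y\<close>, where it becomes \<Phi>.\<close>
    then have "Re (mat_trace (Y * T W)) < 0" using t by (simp add: divide_less_0_iff)
    also have "mat_trace (Y * T W) = mat_trace (T W * Y)"
      using Yc Tc[of W] by (intro trace_comm) auto
    also have "\<dots> = mat_trace (Q * W * mat_adjoint Q * id_tensor m n \<Phi> Y)"
      unfolding T_def by (rule id_tensor_adjoint_trace[OF adj \<Phi> QWc[OF Wc] Yc, symmetric])
    also have "\<dots> = mat_trace (id_tensor m n \<Phi> Y * (Q * W * mat_adjoint Q))"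
      using QWc[OF Wc] by (intro trace_comm) auto
    finally show ?thesis .
  qed
  then show ?thesis using that[OF D \<epsilon>] unfolding Y_def by blast
qed

text \<open>Filtering: conjugating by $A \otimes I$ with $A = \sigma_1^{-1/2}$, \<open>\<sigma>\<^sub>1\<close> the reduction to $M_m$, turns
  the witness into a state whose image under $I \otimes \Delta$ is maximally mixed, and keeps the image under
  $I \otimes \Phi$ negative on a space of the same dimension.\<close>

lemma filtered_witness:
  assumes m: "m \<ge> 1" and n: "n \<ge> 1" and \<Phi>: "mat_linear_map n \<Phi>"
    and Q: "Q \<in> carrier_mat (m * n) d" and iso: "mat_adjoint Q * Q = 1\<^sub>m d" and d: "0 < d"
    and D: "psd_mat (m * n) D" and \<epsilon>: "0 < \<epsilon>"
    and neg: "\<And>W. psd_mat d W \<Longrightarrow> 0 < Re (mat_trace W) \<Longrightarrow>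
      Re (mat_trace (id_tensor m n \<Phi> (D + complex_of_real \<epsilon> \<cdot>\<^sub>m 1\<^sub>m (m * n)) * (Q * W * mat_adjoint Q))) < 0"
  obtains \<sigma> P where "density_matrix (m * n) \<sigma>"
    "id_tensor m n (depolarizing n) \<sigma> = complex_of_real (1 / (real m * real n)) \<cdot>\<^sub>m 1\<^sub>m (m * n)"
    "P \<in> carrier_mat (m * n) d" "mat_adjoint P * P = 1\<^sub>m d"
    "Re (mat_trace (P * mat_adjoint P * id_tensor m n \<Phi> \<sigma>)) < 0"
proof -
  let ?N = "m * n"
  define Y where "Y = D + complex_of_real \<epsilon> \<cdot>\<^sub>m 1\<^sub>m ?N"
  have Yp: "psd_mat ?N Y" unfolding Y_def using \<epsilon> by (intro psd_add D psd_smult psd_one) auto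
  have Yc: "Y \<in> carrier_mat ?N ?N" using psd_carrier[OF Yp] .
  let ?\<sigma>1 = "ptrace_right m n Y"
  have \<sigma>1c: "?\<sigma>1 \<in> carrier_mat m m" by (simp add: ptrace_right_def)
  have "hermitian_mat m ?\<sigma>1" by (rule ptrace_right_hermitian[OF psd_hermitian[OF Yp]])
  moreover have "0 < Re (quad_form m ?\<sigma>1 f)" if "\<exists>i<m. f i \<noteq> 0" for f
    unfolding Y_def by (rule ptrace_right_positive_definite[OF n D \<epsilon> that])
  ultimately obtain R R' where R: "R \<in> carrier_mat m m" "R' \<in> carrier_mat m m" "R * R' = 1\<^sub>m m"
    "mat_adjoint R * ?\<sigma>1 * R = 1\<^sub>m m"
    using positive_definite_inverse_sqrt by metis
  define A where "A = amp n (mat_adjoint R)"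
  \<comment> \<open>\<open>B\<close> inverts the adjoint of \<open>A\<close>. Conjugating the image
    by \<open>A\<close> carries negativity from the range of \<open>Q\<close> to the range of
    \<open>B Q\<close>.\<close>
  define B where "B = amp n R'"
  have Ac: "A \<in> carrier_mat ?N ?N" and Bc: "B \<in> carrier_mat ?N ?N"
    unfolding A_def B_def using amp_carrier R by auto
  have adjA: "mat_adjoint A = amp n R" by (simp add: A_def amp_adj)
  have AB: "mat_adjoint A * B = 1\<^sub>m ?N"
    unfolding adjA B_def using amp_mult[OF R(1,2), of n] R(3) by (simp add: amp_one)
  define Z where "Z = A * Y * mat_adjoint A"
  have Zp: "psd_mat ?N Z" unfolding Z_def by (rule psd_conj[OF Yp Ac])
  have Zc: "Z \<in> carrier_mat ?N ?N" using psd_carrier[OF Zp] .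
  have "id_tensor m n (depolarizing n) Z = A * amp n ((1 / of_nat n) \<cdot>\<^sub>m ?\<sigma>1) * mat_adjoint A"
    unfolding Z_def A_def
    using id_tensor_amp_conj[OF depolarizing_linear adj_carrier[OF R(1)] Yc]
    by (simp add: id_tensor_depolarizing)
  also have "\<dots> = amp n (mat_adjoint R * ((1 / of_nat n) \<cdot>\<^sub>m ?\<sigma>1)) * amp n R"
    unfolding adjA unfolding A_def using \<sigma>1c R(1) by (subst amp_mult[of _ m m _ m]) auto
  also have "\<dots> = amp n (mat_adjoint R * ((1 / of_nat n) \<cdot>\<^sub>m ?\<sigma>1) * R)"
    using \<sigma>1c R(1) by (intro amp_mult[symmetric, of _ m m _ m]) auto
  also have "mat_adjoint R * ((1 / of_nat n) \<cdot>\<^sub>m ?\<sigma>1) * R = (1 / of_nat n) \<cdot>\<^sub>m 1\<^sub>m m"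
    using mult_smult_distrib[OF adj_carrier[OF R(1)] \<sigma>1c]
      mult_smult_assoc_mat[OF mult_carrier_mat[OF adj_carrier[OF R(1)] \<sigma>1c] R(1)] R(4) by simp
  finally have IZ: "id_tensor m n (depolarizing n) Z = (1 / of_nat n) \<cdot>\<^sub>m 1\<^sub>m ?N"
    by (simp add: amp_smult amp_one)
  \<comment> \<open>The depolarizing map preserves traces, so the trace of \<open>Z\<close> is that
    of I/n on a space of dimension m n. This accounts for the normalization 1/m of \<sigma>.\<close>
  have "mat_trace Z = mat_trace (ptrace_left m n Z)"
    by (rule trace_ptrace_left[OF Zc, symmetric])
  also have "\<dots> = mat_trace (depolarizing n (ptrace_left m n Z))"
    by (rule trace_depolarizing[OF n, symmetric])
  also have "\<dots> = mat_trace (id_tensor m n (depolarizing n) Z)"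
    by (rule trace_id_tensor[OF depolarizing_linear, symmetric])
  also have "\<dots> = of_nat m"
    unfolding IZ using n by (simp add: mat_trace_smult[OF one_carrier_mat] trace_one)
  finally have trZ: "mat_trace Z = of_nat m" .
  define \<sigma> where "\<sigma> = complex_of_real (1 / real m) \<cdot>\<^sub>m Z"
  have \<sigma>: "density_matrix ?N \<sigma>"
    using psd_smult[OF Zp, of "1 / real m"] m
    by (simp add: density_matrix_def \<sigma>_def mat_trace_smult[OF Zc] trZ)
  have "id_tensor m n (depolarizing n) \<sigma> = complex_of_real (1 / real m) \<cdot>\<^sub>m ((1 / of_nat n) \<cdot>\<^sub>m 1\<^sub>m ?N)"
    unfolding \<sigma>_def id_tensor_smult[OF depolarizing_linear Zc] IZ ..
  then have I\<sigma>: "id_tensor m n (depolarizing n) \<sigma> = complex_of_real (1 / (real m * real n)) \<cdot>\<^sub>m 1\<^sub>m ?N"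
    by (auto intro!: eq_matI)
  let ?X = "id_tensor m n \<Phi> Y"
  have Xc: "?X \<in> carrier_mat ?N ?N" by simp
  have X\<sigma>: "id_tensor m n \<Phi> \<sigma> = complex_of_real (1 / real m) \<cdot>\<^sub>m (A * ?X * mat_adjoint A)"
    unfolding \<sigma>_def id_tensor_smult[OF \<Phi> Zc]
    unfolding Z_def A_def
    using id_tensor_amp_conj[OF \<Phi> adj_carrier[OF R(1)] Yc] by simp
  have BQc: "B * Q \<in> carrier_mat ?N d" using Bc Q by simp
  \<comment> \<open>\<open>Q\<^sup>* A\<^sup>*\<close> is a left inverse of
    \<open>B Q\<close>.\<close>
  have inj: "v = 0\<^sub>v d" if v: "v \<in> carrier_vec d" "(B * Q) *\<^sub>v v = 0\<^sub>v ?N" for v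
  proof -
    have L: "mat_adjoint Q * mat_adjoint A \<in> carrier_mat d ?N" using Q Ac by auto
    have "(mat_adjoint Q * mat_adjoint A) * (B * Q) = mat_adjoint Q * (mat_adjoint A * B) * Q"
      using Q Ac Bc by (simp add: mult_assoc_dim)
    also have "\<dots> = 1\<^sub>m d" unfolding AB using Q iso by simp
    finally have "v = ((mat_adjoint Q * mat_adjoint A) * (B * Q)) *\<^sub>v v" using v by simp
    also have "\<dots> = (mat_adjoint Q * mat_adjoint A) *\<^sub>v ((B * Q) *\<^sub>v v)"
      by (rule assoc_mult_mat_vec[OF L BQc v(1)])
    also have "\<dots> = 0\<^sub>v d"
      unfolding v(2) using L Q by (intro eq_vecI) (auto simp: scalar_prod_def)
    finally show ?thesis .
  qed
  obtain S S' where S: "S \<in> carrier_mat d d" "S' \<in> carrier_mat d d" "S * S' = 1\<^sub>m d" "S' * S = 1\<^sub>m d"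
    "mat_adjoint (B * Q * S) * (B * Q * S) = 1\<^sub>m d"
    using orthonormalize[OF BQc inj] by metis
  define P where "P = B * Q * S"
  have Pc: "P \<in> carrier_mat ?N d" using BQc S by (simp add: P_def)
  have W: "psd_mat d (S * mat_adjoint S)" by (rule psd_gram[OF S(1)])
  have tW: "0 < Re (mat_trace (S * mat_adjoint S))"
  proof -
    have "mat_trace (S * mat_adjoint S) = mat_trace (mat_adjoint S * S)"
      using S(1) by (intro trace_comm) auto
    then have tr: "Re (mat_trace (S * mat_adjoint S)) = (\<Sum>j<d. \<Sum>i<d. (cmod (S $$ (i, j)))\<^sup>2)"
      using frobenius_trace[OF S(1)] by (metis Re_complex_of_real)
    have "\<exists>i<d. \<exists>j<d. S $$ (i, j) \<noteq> 0"
    proof (rule ccontr)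
      assume "\<not> ?thesis"
      then have "S = 0\<^sub>m d d" using S(1) by (intro eq_matI) auto
      then have "1\<^sub>m d $$ (0, 0) = (0\<^sub>m d d :: complex mat) $$ (0, 0)"
        using S(2,3) by (metis left_mult_zero_mat)
      then show False using d by simp
    qed
    then obtain i j where ij: "i < d" "j < d" "S $$ (i, j) \<noteq> 0" by blast
    have "0 < (cmod (S $$ (i, j)))\<^sup>2" using ij by simp
    also have "\<dots> \<le> (\<Sum>j<d. \<Sum>i<d. (cmod (S $$ (i, j)))\<^sup>2)"
      using ij by (intro member_le_double_sum[where g = "\<lambda>j i. (cmod (S $$ (i, j)))\<^sup>2"]) auto
    finally show ?thesis unfolding tr .
  qed
  have AP: "mat_adjoint A * P = Q * S"
  proof -
    have "mat_adjoint A * P = mat_adjoint A * B * (Q * S)"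
      unfolding P_def using Ac Bc Q S(1) by (simp add: mult_assoc_dim)
    then show ?thesis unfolding AB using Q S(1) by simp
  qed
  have PAc: "P * mat_adjoint P * (A * ?X * mat_adjoint A) \<in> carrier_mat ?N ?N" using Pc Ac by auto
  have PXc: "A * ?X * mat_adjoint A \<in> carrier_mat ?N ?N" using Ac by auto
  have "mat_trace (P * mat_adjoint P * (A * ?X * mat_adjoint A)) =
      mat_trace (P * (mat_adjoint P * A * ?X * mat_adjoint A))"
    using Pc Ac by (simp add: mult_assoc_dim)
  also have "\<dots> = mat_trace (mat_adjoint P * A * ?X * mat_adjoint A * P)"
    using Pc Ac by (intro trace_comm) auto
  also have "mat_adjoint P * A * ?X * mat_adjoint A * P =
      mat_adjoint (mat_adjoint A * P) * (?X * (mat_adjoint A * P))"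
    using Pc Ac by (simp add: adj_mult mult_assoc_dim)
  also have "mat_trace \<dots> = mat_trace (?X * (mat_adjoint A * P) * mat_adjoint (mat_adjoint A * P))"
    using Pc Ac by (intro trace_comm) auto
  also have "\<dots> = mat_trace (?X * (Q * (S * mat_adjoint S) * mat_adjoint Q))"
    unfolding AP using Q S(1) by (simp add: adj_mult mult_assoc_dim)
  finally have "Re (mat_trace (P * mat_adjoint P * (A * ?X * mat_adjoint A))) < 0"
    using neg[OF W tW] by (simp add: Y_def)
  moreover have "mat_trace (P * mat_adjoint P * id_tensor m n \<Phi> \<sigma>) =
      complex_of_real (1 / real m) * mat_trace (P * mat_adjoint P * (A * ?X * mat_adjoint A))"
    unfolding X\<sigma> using mult_smult_distrib[OF mult_carrier_mat[OF Pc adj_carrier[OF Pc]] PXc]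
      mat_trace_smult[OF PAc] by simp
  ultimately have "Re (mat_trace (P * mat_adjoint P * id_tensor m n \<Phi> \<sigma>)) < 0"
    using m by (simp add: divide_less_0_iff)
  then show ?thesis using that[OF \<sigma> I\<sigma> Pc] S(5) by (simp add: P_def)
qed

text \<open>\<open>C\<close> is the reflection 2P - I for the filtered isometry. The bound retains
  the trace against \<open>C\<close> instead of a norm, so that both the m-norm and the diamond norm
  can be inserted for the same \<sigma>; strictness stems from the negative trace of P against (I
  \<otimes> \<Phi>)(\<sigma>).\<close>

lemma good_dim_bound:
  assumes m: "m \<ge> 1" and n: "n \<ge> 1" and \<Phi>: "mat_linear_map n \<Phi>" and hp: "hermiticity_preserving n \<Phi>"
    and g: "good_dim m n (adjoint_map n \<Phi>) d" and d: "0 < d"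
  obtains \<sigma> C where "density_matrix (m * n) \<sigma>" "contraction_form (m * n) C"
    "2 * x * real d / (real m * real n) <
      Re (mat_trace (C * id_tensor m n (scaled_diff n x \<Phi>) \<sigma>)) + x - Re (mat_trace (\<Phi> (ptrace_left m n \<sigma>)))"
proof -
  let ?N = "m * n"
  have adj: "is_adjoint_map n \<Phi> (adjoint_map n \<Phi>)" by (rule is_adjoint_map_adjoint_map[OF \<Phi>])
  obtain Q where Q: "Q \<in> carrier_mat ?N d" and iso: "mat_adjoint Q * Q = 1\<^sub>m d"
    and bad: "\<And>W. density_matrix d W \<Longrightarrow>
      \<not> psd_mat ?N (id_tensor m n (adjoint_map n \<Phi>) (Q * W * mat_adjoint Q))"
    using g by (auto simp: good_dim_def)
  obtain D \<epsilon> where D: "psd_mat ?N D" "0 < \<epsilon>"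
    "\<And>W. psd_mat d W \<Longrightarrow> 0 < Re (mat_trace W) \<Longrightarrow>
      Re (mat_trace (id_tensor m n \<Phi> (D + complex_of_real \<epsilon> \<cdot>\<^sub>m 1\<^sub>m ?N) * (Q * W * mat_adjoint Q))) < 0"
    using good_dim_dual_witness[OF \<Phi> hp adj Q iso d bad] by blast
  obtain \<sigma> P where \<sigma>: "density_matrix ?N \<sigma>"
    and I\<sigma>: "id_tensor m n (depolarizing n) \<sigma> = complex_of_real (1 / (real m * real n)) \<cdot>\<^sub>m 1\<^sub>m ?N"
    and P: "P \<in> carrier_mat ?N d" "mat_adjoint P * P = 1\<^sub>m d"
    and neg: "Re (mat_trace (P * mat_adjoint P * id_tensor m n \<Phi> \<sigma>)) < 0"
    using filtered_witness[OF m n \<Phi> Q iso d D] by blast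
  let ?P = "P * mat_adjoint P"
  define C where "C = 2 \<cdot>\<^sub>m ?P + (-1) \<cdot>\<^sub>m 1\<^sub>m ?N"
  define X where "X = id_tensor m n \<Phi> \<sigma>"
  define Y where "Y = id_tensor m n (scaled_diff n x \<Phi>) \<sigma>"
  have Pc: "?P \<in> carrier_mat ?N ?N" using P(1) by auto
  have Xc: "X \<in> carrier_mat ?N ?N" and Yc: "Y \<in> carrier_mat ?N ?N" by (simp_all add: X_def Y_def)
  define z where "z = complex_of_real (x / (real m * real n))"
  have Y: "Y = z \<cdot>\<^sub>m 1\<^sub>m ?N + (-1) \<cdot>\<^sub>m X"
    unfolding Y_def X_def id_tensor_scaled_diff[OF \<Phi>] I\<sigma> z_def by (auto intro!: eq_matI)
  have trP: "mat_trace ?P = of_nat d"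
    using P trace_comm[of P "mat_adjoint P"] by (simp add: trace_one)
  have "?P * Y = z \<cdot>\<^sub>m ?P + (-1) \<cdot>\<^sub>m (?P * X)"
    unfolding Y using Pc Xc mult_smult_distrib[OF Pc Xc] mult_smult_distrib[OF Pc one_carrier_mat]
    by (subst mult_add_distrib_mat[of _ ?N ?N _ ?N]) auto
  then have trPY: "mat_trace (?P * Y) = z * of_nat d - mat_trace (?P * X)"
    using Pc Xc mult_carrier_mat[OF Pc Xc]
    by (simp only: mat_trace_add[of _ ?N] smult_carrier_mat mat_trace_smult[of _ ?N] trP mult_minus1 add_uminus_conv_diff)
  have trY: "mat_trace Y = of_real x - mat_trace (\<Phi> (ptrace_left m n \<sigma>))"
    unfolding Y_def trace_id_tensor[OF scaled_diff_linear[OF \<Phi>]]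
    by (rule trace_scaled_diff[OF \<Phi> n ptrace_left_density[OF \<sigma>]])
  have "C * Y = 2 \<cdot>\<^sub>m (?P * Y) + (-1) \<cdot>\<^sub>m Y"
    unfolding C_def using Pc Yc mult_smult_assoc_mat[OF Pc Yc] mult_smult_assoc_mat[OF one_carrier_mat Yc]
    by (subst add_mult_distrib_mat[of _ ?N ?N _ _ ?N]) auto
  then have "mat_trace (C * Y) = 2 * mat_trace (?P * Y) - mat_trace Y"
    using Yc mult_carrier_mat[OF Pc Yc]
    by (simp add: mat_trace_add[of _ ?N] mat_trace_smult[of _ ?N])
  then have "Re (mat_trace (C * Y)) = 2 * (x / (real m * real n) * real d - Re (mat_trace (?P * X)))
      - (x - Re (mat_trace (\<Phi> (ptrace_left m n \<sigma>))))"
    unfolding trPY trY z_def by simp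
  then have "2 * x * real d / (real m * real n) <
      Re (mat_trace (C * Y)) + x - Re (mat_trace (\<Phi> (ptrace_left m n \<sigma>)))"
    using neg unfolding X_def by simp
  moreover have "contraction_form ?N C"
    unfolding C_def by (rule projection_contraction_form[OF P])
  ultimately show ?thesis using that[OF \<sigma>] unfolding Y_def by blast
qed

section \<open>Stabilization and the main estimate\<close>

lemma map_norm_ge_trace:
  assumes \<Psi>: "mat_linear_map n \<Psi>" and hp: "hermiticity_preserving n \<Psi>"
    and \<sigma>: "density_matrix (m * n) \<sigma>" and C: "contraction_form (m * n) C"
  shows "Re (mat_trace (C * id_tensor m n \<Psi> \<sigma>)) \<le> map_norm m n \<Psi>"
proof -
  have "Re (mat_trace (C * id_tensor m n \<Psi> \<sigma>)) \<le> trace_norm (id_tensor m n \<Psi> \<sigma>)"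
    by (intro trace_norm_ge[OF C] id_tensor_hermitian[OF \<Psi> hp] psd_hermitian density_psd \<sigma>)
  also have "\<dots> \<le> map_norm m n \<Psi>"
    using trace_norm_psd[OF density_psd[OF \<sigma>]] density_trace[OF \<sigma>]
    by (intro trace_norm_le_map_norm[OF \<Psi> density_carrier[OF \<sigma>]]) simp
  finally show ?thesis .
qed

text \<open>The spectral theorem writes a state as a convex combination of rank-one states, so an
  upper bound for a real linear functional on pure states holds on all states.\<close>

lemma density_pure_decomposition:
  assumes \<sigma>: "density_matrix N \<sigma>"
  obtains f \<alpha> where "\<forall>i<N. 0 \<le> \<alpha> i" "(\<Sum>i<N. \<alpha> i) = 1"
    "\<forall>i<N. (\<Sum>j<N. (cmod (f i j))\<^sup>2) = 1"
    "\<forall>r<N. \<forall>c<N. \<sigma> $$ (r, c) = (\<Sum>i<N. of_real (\<alpha> i) * (f i r * cnj (f i c)))"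
proof -
  obtain U \<alpha> where U: "U \<in> carrier_mat N N" "mat_adjoint U * U = 1\<^sub>m N" "U * mat_adjoint U = 1\<^sub>m N"
    and \<sigma>U: "\<sigma> = U * real_diag N \<alpha> * mat_adjoint U"
    using spectral_theorem[OF psd_hermitian[OF density_psd[OF \<sigma>]]] .
  show ?thesis
  proof (rule that[of \<alpha> "\<lambda>i j. U $$ (j, i)"]; (intro allI impI)?)
    show "0 \<le> \<alpha> i" if "i < N" for i by (rule spectral_nonneg[OF density_psd[OF \<sigma>] U(1,2) \<sigma>U that])
    have "complex_of_real (\<Sum>i<N. \<alpha> i) = 1"
      using trace_spectral[OF U(1,2), of \<alpha>] density_trace[OF \<sigma>] \<sigma>U by simp
    then show "(\<Sum>i<N. \<alpha> i) = 1" using of_real_eq_1_iff by blast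
    show "(\<Sum>j<N. (cmod (U $$ (j, i)))\<^sup>2) = 1" if "i < N" for i
      by (rule unitary_col_norm[OF U(1,2) that])
    fix r c assume rc: "r < N" "c < N"
    have "\<sigma> $$ (r, c) = (\<Sum>i<N. (U * real_diag N \<alpha>) $$ (r, i) * mat_adjoint U $$ (i, c))"
      unfolding \<sigma>U using rc U(1) by (subst mult_index_sum) auto
    also have "\<dots> = (\<Sum>i<N. of_real (\<alpha> i) * (U $$ (r, i) * cnj (U $$ (c, i))))"
    proof (intro sum.cong refl)
      fix i assume "i \<in> {..<N}"
      then show "(U * real_diag N \<alpha>) $$ (r, i) * mat_adjoint U $$ (i, c) =
          of_real (\<alpha> i) * (U $$ (r, i) * cnj (U $$ (c, i)))"
        using rc U(1) by (subst mult_real_diag_index) auto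
    qed
    finally show "\<sigma> $$ (r, c) = (\<Sum>i<N. of_real (\<alpha> i) * (U $$ (r, i) * cnj (U $$ (c, i))))" .
  qed
qed

text \<open>Smith's argument: a vector of $\mathbb{C}^m \otimes \mathbb{C}^n$ is the image of a vector of
  $\mathbb{C}^n \otimes \mathbb{C}^n$ under $V \otimes I$ with \<open>V\<close> a contraction. Adding \<open>\<epsilon>\<close> to the Gram
  matrix avoids pseudo-inverses, at the cost of a factor \<open>1 + \<epsilon> n\<close>.\<close>

lemma pure_state_stabilization_eps:
  assumes \<Psi>: "mat_linear_map n \<Psi>" and hp: "hermiticity_preserving n \<Psi>"
    and C: "contraction_form (m * n) C" and f: "(\<Sum>r<m * n. (cmod (f r))\<^sup>2) = 1" and \<epsilon>: "0 < \<epsilon>"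
  shows "Re (mat_trace (C * id_tensor m n \<Psi> (col_mat (m * n) f * mat_adjoint (col_mat (m * n) f))))
    \<le> (1 + \<epsilon> * real n) * map_norm n n \<Psi>"
proof -
  have Cc: "C \<in> carrier_mat (m * n) (m * n)" using C by (simp add: contraction_form_def)
  \<comment> \<open>The vector \<open>f\<close> reshaped as a matrix; its squared Frobenius norm is
    1.\<close>
  define M where "M = mat m n (\<lambda>(i, k). f (i * n + k))"
  have M: "M \<in> carrier_mat m n" by (simp add: M_def)
  define G where "G = mat_adjoint M * M + complex_of_real \<epsilon> \<cdot>\<^sub>m 1\<^sub>m n"
  have Mp: "psd_mat n (mat_adjoint M * M)" using psd_gram[of "mat_adjoint M" n m] M by auto
  have MMc: "mat_adjoint M * M \<in> carrier_mat n n" using M by auto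
  have "hermitian_mat n G" unfolding G_def
    by (intro hermitian_add hermitian_smult psd_hermitian[OF Mp] hermitian_one)
  moreover have "0 < Re (quad_form n G h)" if h: "\<exists>i<n. h i \<noteq> 0" for h
  proof -
    obtain i where i: "i < n" "h i \<noteq> 0" using h by blast
    have "0 < (cmod (h i))\<^sup>2" using i by simp
    also have "\<dots> \<le> (\<Sum>i<n. (cmod (h i))\<^sup>2)" using i by (intro member_le_sum) auto
    finally have "0 < \<epsilon> * (\<Sum>i<n. (cmod (h i))\<^sup>2)" using \<epsilon> by simp
    moreover have "0 \<le> Re (quad_form n (mat_adjoint M * M) h)" using Mp by (simp add: psd_mat_iff)
    moreover have "Re (quad_form n G h) =
        Re (quad_form n (mat_adjoint M * M) h) + \<epsilon> * (\<Sum>i<n. (cmod (h i))\<^sup>2)"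
      unfolding G_def using MMc by (simp add: quad_form_add quad_form_smult quad_form_one)
    ultimately show ?thesis by linarith
  qed
  ultimately obtain R R' where R: "R \<in> carrier_mat n n" "R' \<in> carrier_mat n n" "R * R' = 1\<^sub>m n"
    "mat_adjoint R * G * R = 1\<^sub>m n" "G = mat_adjoint R' * R'"
    using positive_definite_inverse_sqrt by metis
  define V where "V = M * R"
  have V: "V \<in> carrier_mat m n" using M R by (simp add: V_def)
  have VR: "V * R' = M" using M R by (simp add: V_def mult_assoc_dim)
  define E where "E = amp n V"
  have Ec: "E \<in> carrier_mat (m * n) (n * n)" unfolding E_def by (rule amp_carrier[OF V])
  \<comment> \<open>The entries of \<open>R'\<close> listed row by row. V \<otimes> I sends this
    list to that of \<open>V R' = M\<close>, which is \<open>f\<close>.\<close>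
  define h where "h s = R' $$ (s div n, s mod n)" for s
  let ?u = "col_mat (m * n) f" and ?w = "col_mat (n * n) h"
  have Ew: "E * ?w = ?u"
  proof (rule eq_matI)
    fix r c assume "r < dim_row ?u" "c < dim_col ?u"
    then have r: "r < m * n" "c = 0" by auto
    obtain i k where ik: "i < m" "k < n" "r = i * n + k" using block_index_cases[OF r(1)] .
    have "(E * ?w) $$ (i * n + k, 0) = (\<Sum>a<n. V $$ (i, a) * ?w $$ (a * n + k, 0))"
      unfolding E_def by (rule amp_mult_index[OF V]) (use ik in auto)
    also have "\<dots> = (\<Sum>a<n. V $$ (i, a) * R' $$ (a, k))"
      using ik by (intro sum.cong refl) (auto simp: h_def mult_add_less)
    also have "\<dots> = (V * R') $$ (i, k)" using ik V R by (subst mult_index_sum) auto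
    also have "\<dots> = f (i * n + k)" using ik by (simp add: VR M_def)
    finally show "(E * ?w) $$ (r, c) = ?u $$ (r, c)" using r ik by simp
  qed (use Ec in auto)
  define X where "X = ?w * mat_adjoint ?w"
  have Xp: "psd_mat (n * n) X" unfolding X_def using psd_gram[of ?w "n * n" 1] by simp
  have Xc: "X \<in> carrier_mat (n * n) (n * n)" using psd_carrier[OF Xp] .
  have uu: "?u * mat_adjoint ?u = E * X * mat_adjoint E"
    unfolding Ew[symmetric] X_def using Ec by (simp add: adj_mult mult_assoc_dim)
  \<comment> \<open>The contraction is shifted onto the test operator; what remains is a multiple of
    a state on C^n \<otimes> C^n.\<close>
  define C' where "C' = mat_adjoint E * C * mat_adjoint (mat_adjoint E)"
  have C'c: "C' \<in> carrier_mat (n * n) (n * n)" unfolding C'_def using Ec Cc by auto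
  \<comment> \<open>The normalization \<open>R\<^sup>* G R = 1\<close> makes
    \<open>V\<^sup>* V\<close> fall short of the identity by \<epsilon> times a Gram matrix, so
    \<open>V\<close> is a contraction.\<close>
  have VV: "mat_adjoint V * V = 1\<^sub>m n + (- complex_of_real \<epsilon>) \<cdot>\<^sub>m (mat_adjoint R * R)"
  proof -
    have RRc: "mat_adjoint R * R \<in> carrier_mat n n" using R(1) by auto
    have "1\<^sub>m n = mat_adjoint R * G * R" using R(4) by simp
    also have "\<dots> = mat_adjoint R * (mat_adjoint M * M) * R +
        mat_adjoint R * (complex_of_real \<epsilon> \<cdot>\<^sub>m 1\<^sub>m n) * R"
      unfolding G_def using R(1) M by (simp add: mult_add_dim add_mult_dim)
    also have "mat_adjoint R * (mat_adjoint M * M) * R = mat_adjoint V * V"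
      unfolding V_def using R(1) M by (simp add: adj_mult mult_assoc_dim)
    also have "mat_adjoint R * (complex_of_real \<epsilon> \<cdot>\<^sub>m 1\<^sub>m n) * R = complex_of_real \<epsilon> \<cdot>\<^sub>m (mat_adjoint R * R)"
      using mult_smult_distrib[OF adj_carrier[OF R(1)] one_carrier_mat]
        mult_smult_assoc_mat[OF adj_carrier[OF R(1)] R(1)] R(1) by simp
    finally show ?thesis
      using RRc V R(1) by (intro eq_matI) (auto simp del: index_mult_mat(1))
  qed
  have EE_le: "Re (quad_form (n * n) (mat_adjoint E * E) g) \<le> (\<Sum>s<n * n. (cmod (g s))\<^sup>2)" for g
  proof -
    define F where "F = amp n (mat_adjoint R)"
    have Fc: "F \<in> carrier_mat (n * n) (n * n)" unfolding F_def using amp_carrier R(1) by auto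
    have FF: "psd_mat (n * n) (F * mat_adjoint F)" by (rule psd_gram[OF Fc])
    have "mat_adjoint E * E = amp n (mat_adjoint V * V)"
      unfolding E_def amp_adj by (rule amp_mult[OF adj_carrier[OF V] V, symmetric])
    also have "\<dots> = 1\<^sub>m (n * n) + (- complex_of_real \<epsilon>) \<cdot>\<^sub>m amp n (mat_adjoint R * R)"
    proof -
      have amp_add: "amp n (1\<^sub>m n + Z) = 1\<^sub>m (n * n) + amp n Z" if Z: "Z \<in> carrier_mat n n" for Z
      proof (rule eq_matI_blocks)
        fix i j k l assume *: "i < n" "j < n" "k < n" "l < n"
        have c: "1\<^sub>m n + Z \<in> carrier_mat n n" using Z by simp
        have "(1\<^sub>m (n * n) + amp n Z) $$ (i * n + k, j * n + l) =
            amp n (1\<^sub>m n) $$ (i * n + k, j * n + l) + amp n Z $$ (i * n + k, j * n + l)"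
          using * Z by (simp add: mult_add_less amp_one)
        also have "\<dots> = (if k = l then 1\<^sub>m n $$ (i, j) + Z $$ (i, j) else 0)"
          unfolding amp_index[OF one_carrier_mat *] amp_index[OF Z *] by simp
        also have "\<dots> = amp n (1\<^sub>m n + Z) $$ (i * n + k, j * n + l)"
          unfolding amp_index[OF c *] using * Z by simp
        finally show "amp n (1\<^sub>m n + Z) $$ (i * n + k, j * n + l) =
          (1\<^sub>m (n * n) + amp n Z) $$ (i * n + k, j * n + l)" ..
      qed (use Z in \<open>auto intro: amp_carrier\<close>)
      show ?thesis unfolding VV amp_smult[symmetric] by (rule amp_add) (use R(1) in auto)
    qed
    also have "amp n (mat_adjoint R * R) = F * mat_adjoint F"
      unfolding F_def amp_adj using amp_mult[OF adj_carrier[OF R(1)] R(1), of n] by simp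
    finally have "Re (quad_form (n * n) (mat_adjoint E * E) g) =
        (\<Sum>s<n * n. (cmod (g s))\<^sup>2) - \<epsilon> * Re (quad_form (n * n) (F * mat_adjoint F) g)"
      using Fc psd_carrier[OF FF] by (simp add: quad_form_add quad_form_smult quad_form_one)
    moreover have "0 \<le> \<epsilon> * Re (quad_form (n * n) (F * mat_adjoint F) g)"
      using FF \<epsilon> by (simp add: psd_mat_iff)
    ultimately show ?thesis by linarith
  qed
  have C'f: "contraction_form (n * n) C'"
    unfolding contraction_form_def
  proof (intro conjI allI C'c)
    fix g
    have "quad_form (n * n) C' g =
        quad_form (m * n) C (\<lambda>r. \<Sum>s<n * n. cnj (mat_adjoint E $$ (s, r)) * g s)"
      unfolding C'_def by (rule quad_form_conj[OF Cc adj_carrier[OF Ec]])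
    then have "\<bar>Re (quad_form (n * n) C' g)\<bar> \<le>
        (\<Sum>r<m * n. (cmod (\<Sum>s<n * n. cnj (mat_adjoint E $$ (s, r)) * g s))\<^sup>2)"
      using C by (simp add: contraction_form_def)
    also have "\<dots> = (\<Sum>r<m * n. (cmod ((E *\<^sub>v vec (n * n) g) $ r))\<^sup>2)"
      using Ec by (intro sum.cong refl) (auto simp: scalar_prod_def lessThan_atLeast0)
    also have "\<dots> = Re (quad_form (n * n) (mat_adjoint E * E) g)"
      unfolding quad_form_gram[OF Ec] by simp
    also have "\<dots> \<le> (\<Sum>s<n * n. (cmod (g s))\<^sup>2)" by (rule EE_le)
    finally show "\<bar>Re (quad_form (n * n) C' g)\<bar> \<le> (\<Sum>s<n * n. (cmod (g s))\<^sup>2)" .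
  qed
  \<comment> \<open>The squared norm of \<open>h\<close> is the trace of \<open>G\<close>: 1 from
    the unit vector \<open>f\<close>, plus \<epsilon> n from the regularization.\<close>
  define \<tau> where "\<tau> = 1 + \<epsilon> * real n"
  have \<tau>: "0 < \<tau>" using \<epsilon> by (simp add: \<tau>_def add_pos_nonneg)
  have trX: "mat_trace X = of_real \<tau>"
  proof -
    have "mat_trace X = of_real (\<Sum>s<n * n. (cmod (h s))\<^sup>2)"
      by (simp add: X_def mat_trace_def mult_index_sum complex_norm_square[symmetric] del: index_mult_mat(1))
    also have "(\<Sum>s<n * n. (cmod (h s))\<^sup>2) = (\<Sum>a<n. \<Sum>k<n. (cmod (R' $$ (a, k)))\<^sup>2)"
      unfolding sum_blocks by (intro sum.cong refl) (auto simp: h_def)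
    also have "\<dots> = (\<Sum>k<n. \<Sum>a<n. (cmod (R' $$ (a, k)))\<^sup>2)" by (rule sum.swap)
    also have "of_real \<dots> = mat_trace G"
      unfolding R(5) by (rule frobenius_trace[OF R(2), symmetric])
    also have "\<dots> = mat_trace (mat_adjoint M * M) + complex_of_real \<epsilon> * of_nat n"
      unfolding G_def using MMc by (simp add: mat_trace_add[of _ n] mat_trace_smult[of _ n] trace_one)
    also have "mat_trace (mat_adjoint M * M) = of_real (\<Sum>k<n. \<Sum>i<m. (cmod (M $$ (i, k)))\<^sup>2)"
      by (rule frobenius_trace[OF M])
    also have "(\<Sum>k<n. \<Sum>i<m. (cmod (M $$ (i, k)))\<^sup>2) = (\<Sum>i<m. \<Sum>k<n. (cmod (f (i * n + k)))\<^sup>2)"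
      by (subst sum.swap) (simp add: M_def)
    also have "\<dots> = 1" using f by (simp add: sum_blocks)
    finally show ?thesis by (simp add: \<tau>_def)
  qed
  define \<rho> where "\<rho> = complex_of_real (1 / \<tau>) \<cdot>\<^sub>m X"
  have \<rho>: "density_matrix (n * n) \<rho>"
    using psd_smult[OF Xp, of "1 / \<tau>"] \<tau> by (simp add: density_matrix_def \<rho>_def mat_trace_smult[OF Xc] trX)
  have X\<rho>: "X = complex_of_real \<tau> \<cdot>\<^sub>m \<rho>"
    unfolding \<rho>_def using \<tau> Xc by (intro eq_matI) auto
  have "mat_trace (C * id_tensor m n \<Psi> (?u * mat_adjoint ?u)) =
      mat_trace (C * (E * id_tensor n n \<Psi> X * mat_adjoint E))"
    unfolding uu E_def using id_tensor_amp_conj[OF \<Psi> V Xc] by simp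
  also have "\<dots> = mat_trace ((C * E * id_tensor n n \<Psi> X) * mat_adjoint E)"
    using Cc Ec by (simp add: mult_assoc_dim)
  also have "\<dots> = mat_trace (C' * id_tensor n n \<Psi> X)"
    unfolding C'_def using Cc Ec by (subst trace_comm) (auto simp: mult_assoc_dim)
  also have "\<dots> = complex_of_real \<tau> * mat_trace (C' * id_tensor n n \<Psi> \<rho>)"
    unfolding X\<rho> id_tensor_smult[OF \<Psi> density_carrier[OF \<rho>]]
    using mult_smult_distrib[OF C'c id_tensor_carrier] mat_trace_smult[OF mult_carrier_mat[OF C'c id_tensor_carrier]]
    by simp
  finally have "Re (mat_trace (C * id_tensor m n \<Psi> (?u * mat_adjoint ?u))) =
      \<tau> * Re (mat_trace (C' * id_tensor n n \<Psi> \<rho>))" by simp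
  also have "\<dots> \<le> \<tau> * map_norm n n \<Psi>"
    using map_norm_ge_trace[OF \<Psi> hp \<rho> C'f] \<tau> by (intro mult_left_mono) auto
  finally show ?thesis by (simp add: \<tau>_def)
qed

text \<open>Pure states are handled with an arbitrary \<epsilon>, mixed states by convexity, and
  then \<epsilon> tends to 0. Only this inequality for states and contractions enters the limit
  bound, for every \<open>m\<close> at once.\<close>

lemma diamond_norm_ge_trace:
  assumes \<Psi>: "mat_linear_map n \<Psi>" and hp: "hermiticity_preserving n \<Psi>"
    and \<sigma>: "density_matrix (m * n) \<sigma>" and C: "contraction_form (m * n) C"
  shows "Re (mat_trace (C * id_tensor m n \<Psi> \<sigma>)) \<le> diamond_norm n \<Psi>"
proof -
  let ?N = "m * n"
  let ?dia = "map_norm n n \<Psi>"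
  have Cc: "C \<in> carrier_mat ?N ?N" using C by (simp add: contraction_form_def)
  define F where "F X = mat_trace (C * id_tensor m n \<Psi> X)" for X
  have F_exp: "F X = (\<Sum>p \<in> {..<?N} \<times> {..<?N}. X $$ p * F (unit_mat ?N p))" if "X \<in> carrier_mat ?N ?N" for X
    unfolding F_def
    by (rule linear_functional_expand[where f = "\<lambda>X. mat_trace (C * id_tensor m n \<Psi> X)", OF _ _ that])
      (simp_all add: id_tensor_add[OF \<Psi>] id_tensor_smult[OF \<Psi>]
        mult_add_distrib_mat[OF Cc id_tensor_carrier id_tensor_carrier]
        mult_smult_distrib[OF Cc id_tensor_carrier]
        mat_trace_add[OF mult_carrier_mat[OF Cc id_tensor_carrier] mult_carrier_mat[OF Cc id_tensor_carrier]]
        mat_trace_smult[OF mult_carrier_mat[OF Cc id_tensor_carrier]])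
  obtain f \<alpha> where \<alpha>: "\<forall>i<?N. 0 \<le> \<alpha> i" "(\<Sum>i<?N. \<alpha> i) = 1"
    and f: "\<forall>i<?N. (\<Sum>j<?N. (cmod (f i j))\<^sup>2) = 1"
    and dec: "\<forall>r<?N. \<forall>c<?N. \<sigma> $$ (r, c) = (\<Sum>i<?N. of_real (\<alpha> i) * (f i r * cnj (f i c)))"
    by (rule density_pure_decomposition[OF \<sigma>])
  define P where "P i = col_mat ?N (f i) * mat_adjoint (col_mat ?N (f i))" for i
  have Pc: "P i \<in> carrier_mat ?N ?N" for i by (auto simp: P_def)
  have "F \<sigma> = (\<Sum>p \<in> {..<?N} \<times> {..<?N}. \<sigma> $$ p * F (unit_mat ?N p))"
    by (rule F_exp[OF density_carrier[OF \<sigma>]])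
  also have "\<dots> = (\<Sum>p \<in> {..<?N} \<times> {..<?N}. \<Sum>i<?N. of_real (\<alpha> i) * (P i $$ p * F (unit_mat ?N p)))"
  proof (intro sum.cong refl)
    fix p assume "p \<in> {..<?N} \<times> {..<?N}"
    then have rc: "fst p < ?N" "snd p < ?N" by auto
    have "P i $$ (fst p, snd p) = f i (fst p) * cnj (f i (snd p))" for i
      unfolding P_def using rc by (subst mult_index_sum) auto
    then have "\<sigma> $$ p = (\<Sum>i<?N. of_real (\<alpha> i) * P i $$ p)"
      using dec rc by (cases p) simp
    then show "\<sigma> $$ p * F (unit_mat ?N p) = (\<Sum>i<?N. of_real (\<alpha> i) * (P i $$ p * F (unit_mat ?N p)))"
      by (simp add: sum_distrib_right mult.assoc)
  qed
  also have "\<dots> = (\<Sum>i<?N. \<Sum>p \<in> {..<?N} \<times> {..<?N}. of_real (\<alpha> i) * (P i $$ p * F (unit_mat ?N p)))"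
    by (rule sum.swap)
  also have "\<dots> = (\<Sum>i<?N. of_real (\<alpha> i) * F (P i))"
    unfolding F_exp[OF Pc] sum_distrib_left ..
  finally have F\<sigma>: "Re (F \<sigma>) = (\<Sum>i<?N. \<alpha> i * Re (F (P i)))" by simp
  have bound: "Re (F \<sigma>) \<le> (1 + \<epsilon> * real n) * ?dia" if \<epsilon>: "0 < \<epsilon>" for \<epsilon>
  proof -
    have "Re (F \<sigma>) \<le> (\<Sum>i<?N. \<alpha> i * ((1 + \<epsilon> * real n) * ?dia))"
      unfolding F\<sigma>
    proof (intro sum_mono mult_left_mono)
      fix i assume "i \<in> {..<?N}"
      then show "Re (F (P i)) \<le> (1 + \<epsilon> * real n) * ?dia"
        using pure_state_stabilization_eps[OF \<Psi> hp C f[rule_format] \<epsilon>, of i] by (simp add: F_def P_def)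
    qed (use \<alpha> in auto)
    also have "\<dots> = (1 + \<epsilon> * real n) * ?dia" by (simp add: sum_distrib_right[symmetric] \<alpha>(2))
    finally show ?thesis .
  qed
  have "Re (F \<sigma>) \<le> ?dia"
  proof (rule field_le_epsilon)
    fix e :: real assume e: "0 < e"
    \<comment> \<open>Chosen so that the excess \<epsilon> n times the norm is at most
      \<open>e\<close>; the absolute value and the summand 1 make the denominator positive.\<close>
    define \<epsilon> where "\<epsilon> = e / (real n * \<bar>?dia\<bar> + 1)"
    have pos: "0 < real n * \<bar>?dia\<bar> + 1" by (simp add: add_nonneg_pos)
    have \<epsilon>: "0 < \<epsilon>" using e pos by (simp add: \<epsilon>_def)
    have "\<epsilon> * (real n * ?dia) \<le> \<epsilon> * (real n * \<bar>?dia\<bar> + 1)"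
      using \<epsilon> by (intro mult_left_mono) (auto intro: order_trans[OF mult_left_mono[OF abs_ge_self]])
    also have "\<dots> = e" using pos by (simp add: \<epsilon>_def)
    finally show "Re (F \<sigma>) \<le> ?dia + e" using bound[OF \<epsilon>] by (simp add: algebra_simps)
  qed
  then show ?thesis by (simp add: F_def diamond_norm_def)
qed

text \<open>A real \<open>Inf\<close> is a lower bound only for a set that is bounded below, which
  the uniform bound on linear functionals over states provides.\<close>

lemma min_output_trace_le:
  assumes \<Phi>: "mat_linear_map n \<Phi>" and \<rho>: "density_matrix n \<rho>"
  shows "min_output_trace n \<Phi> \<le> Re (mat_trace (\<Phi> \<rho>))"
  unfolding min_output_trace_def
proof (rule cInf_lower)
  define K where "K = (\<Sum>p \<in> {..<n} \<times> {..<n}. cmod (mat_trace (\<Phi> (unit_mat n p))))"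
  have "cmod (mat_trace (\<Phi> \<rho>)) \<le> K" if "density_matrix n \<rho>" for \<rho>
    unfolding K_def
    by (rule linear_functional_bound[where f = "\<lambda>Y. mat_trace (\<Phi> Y)", OF _ _ that])
      (simp_all add: mat_linear_mapD(2,3)[OF \<Phi>] mat_trace_add[of _ n] mat_trace_smult[of _ n]
        mat_linear_mapD(1)[OF \<Phi>])
  then have "- K \<le> Re (mat_trace (\<Phi> \<rho>))" if "density_matrix n \<rho>" for \<rho>
    using abs_Re_le_cmod[of "mat_trace (\<Phi> \<rho>)"] that by (smt (verit))
  then show "bdd_below {Re (mat_trace (\<Phi> \<rho>)) | \<rho>. density_matrix n \<rho>}"
    by (intro bdd_belowI[of _ "- K"]) auto
qed (use \<rho> in blast)

text \<open>Testing with C = -I bounds Tr \<Phi>(\<rho>) - x by the diamond norm, for a reduced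
  state \<rho>. This makes the limit bound nonnegative, as is required where \<open>nu_m\<close> is
  0 and the estimate for positive dimensions is silent.\<close>

lemma diamond_norm_scaled_diff_ge:
  assumes n: "n \<ge> 1" and \<Phi>: "mat_linear_map n \<Phi>" and hp: "hermiticity_preserving n \<Phi>"
  shows "0 \<le> x + diamond_norm n (scaled_diff n x \<Phi>) - min_output_trace n \<Phi>"
proof -
  let ?\<Psi> = "scaled_diff n x \<Phi>"
  obtain \<sigma> where \<sigma>: "density_matrix (n * n) \<sigma>" using density_exists[of "n * n"] n by auto
  define C where "C = (-1 :: complex) \<cdot>\<^sub>m 1\<^sub>m (n * n)"
  have C: "contraction_form (n * n) C"
    by (simp add: contraction_form_def C_def quad_form_smult quad_form_one sum_nonneg)
  have "mat_trace (C * id_tensor n n ?\<Psi> \<sigma>) = - mat_trace (?\<Psi> (ptrace_left n n \<sigma>))"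
    unfolding C_def mult_smult_assoc_mat[OF one_carrier_mat id_tensor_carrier]
    by (simp add: mat_trace_smult[OF id_tensor_carrier] trace_id_tensor[OF scaled_diff_linear[OF \<Phi>]])
  also have "\<dots> = mat_trace (\<Phi> (ptrace_left n n \<sigma>)) - of_real x"
    by (simp add: trace_scaled_diff[OF \<Phi> n ptrace_left_density[OF \<sigma>]])
  finally have "Re (mat_trace (\<Phi> (ptrace_left n n \<sigma>))) - x \<le> diamond_norm n ?\<Psi>"
    using diamond_norm_ge_trace[OF scaled_diff_linear[OF \<Phi>, of x] scaled_diff_hermiticity_preserving[OF hp, of x] \<sigma> C]
    by simp
  then show ?thesis using min_output_trace_le[OF \<Phi> ptrace_left_density[OF \<sigma>]] by linarith
qed

theorem lemma2:
  fixes m n :: nat and \<Phi> :: "complex mat \<Rightarrow> complex mat" and x :: real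
  assumes "m \<ge> 1" and "n \<ge> 1"
    and "mat_linear_map n \<Phi>"
    and "hermiticity_preserving n \<Phi>"
    and "x > 0"
  shows "int (nu_m m n (adjoint_map n \<Phi>))
      \<le> max 0 (\<lceil>real m * real n *
            (x + map_dist m n (\<lambda>X. complex_of_real x \<cdot>\<^sub>m depolarizing n X) \<Phi>
               - min_output_trace n \<Phi>) / (2 * x)\<rceil> - 1)
    \<and> nu n (adjoint_map n \<Phi>)
      \<le> real n *
            (x + diamond_dist n (\<lambda>X. complex_of_real x \<cdot>\<^sub>m depolarizing n X) \<Phi>
               - min_output_trace n \<Phi>) / (2 * x)"
proof -
  note n = assms(2) and \<Phi> = assms(3) and hp = assms(4) and x = assms(5)
  let ?\<Psi> = "scaled_diff n x \<Phi>"
  let ?l = "min_output_trace n \<Phi>"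
  note \<Psi> = scaled_diff_linear[OF \<Phi>, of x] scaled_diff_hermiticity_preserving[OF hp, of x]
  have dist: "map_dist k n (\<lambda>X. complex_of_real x \<cdot>\<^sub>m depolarizing n X) \<Phi> = map_norm k n ?\<Psi>"
    "diamond_dist n (\<lambda>X. complex_of_real x \<cdot>\<^sub>m depolarizing n X) \<Phi> = diamond_norm n ?\<Psi>" for k
    by (simp_all add: map_dist_def diamond_dist_def scaled_diff_def[abs_def])
  have bounds: "real d < real k * real n * (x + map_norm k n ?\<Psi> - ?l) / (2 * x)"
    "real d < real k * real n * (x + diamond_norm n ?\<Psi> - ?l) / (2 * x)"
    if k: "k \<ge> 1" and g: "good_dim k n (adjoint_map n \<Phi>) d" and d: "0 < d" for k d
  proof -
    obtain \<sigma> C where \<sigma>: "density_matrix (k * n) \<sigma>" and C: "contraction_form (k * n) C"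
      and b: "2 * x * real d / (real k * real n) <
        Re (mat_trace (C * id_tensor k n ?\<Psi> \<sigma>)) + x - Re (mat_trace (\<Phi> (ptrace_left k n \<sigma>)))"
      using good_dim_bound[OF k n \<Phi> hp g d] by blast
    have l: "?l \<le> Re (mat_trace (\<Phi> (ptrace_left k n \<sigma>)))"
      by (rule min_output_trace_le[OF \<Phi> ptrace_left_density[OF \<sigma>]])
    \<comment> \<open>One inequality for any \<open>B\<close> dominating the trace against
      \<open>C\<close>, to be instantiated with both norms.\<close>
    have "real d < real k * real n * (x + B - ?l) / (2 * x)"
      if B: "Re (mat_trace (C * id_tensor k n ?\<Psi> \<sigma>)) \<le> B" for B
    proof -
      have "2 * x * real d / (real k * real n) < x + B - ?l" using b l B by linarith
      then show ?thesis using x k n by (simp add: field_simps)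
    qed
    then show "real d < real k * real n * (x + map_norm k n ?\<Psi> - ?l) / (2 * x)"
      "real d < real k * real n * (x + diamond_norm n ?\<Psi> - ?l) / (2 * x)"
      using map_norm_ge_trace[OF \<Psi> \<sigma> C] diamond_norm_ge_trace[OF \<Psi> \<sigma> C] by blast+
  qed
  have "int (nu_m m n (adjoint_map n \<Phi>)) \<le>
      max 0 (\<lceil>real m * real n * (x + map_norm m n ?\<Psi> - ?l) / (2 * x)\<rceil> - 1)"
  \<comment> \<open>Dimension 0 is absorbed by the cut-off at 0; the estimate proper presupposes
    that the subspace carries a state.\<close>
  proof (cases "nu_m m n (adjoint_map n \<Phi>) = 0")
    case False
    then have "real_of_int (int (nu_m m n (adjoint_map n \<Phi>))) <
        real m * real n * (x + map_norm m n ?\<Psi> - ?l) / (2 * x)"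
      using bounds(1)[OF assms(1) good_dim_nu_m] by simp
    \<comment> \<open>An integer strictly below a real number is strictly below its ceiling, hence
      at most the ceiling minus 1.\<close>
    then have "int (nu_m m n (adjoint_map n \<Phi>)) < \<lceil>real m * real n * (x + map_norm m n ?\<Psi> - ?l) / (2 * x)\<rceil>"
      by (simp only: less_ceiling_iff)
    then show ?thesis by linarith
  qed simp
  \<comment> \<open>The real bound with the diamond norm is linear in \<open>k\<close>, so division
    by \<open>k\<close> leaves a constant that passes to the limit.\<close>
  moreover have "nu n (adjoint_map n \<Phi>) \<le> real n * (x + diamond_norm n ?\<Psi> - ?l) / (2 * x)"
  proof (rule LIMSEQ_le_const2)
    show "(\<lambda>k. real (nu_m k n (adjoint_map n \<Phi>)) / real k) \<longlonglongrightarrow> nu n (adjoint_map n \<Phi>)"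
      using is_adjoint_map_adjoint_map[OF \<Phi>] by (intro nu_m_ratio_convergent) (simp add: is_adjoint_map_def)
    show "\<exists>N. \<forall>k\<ge>N. real (nu_m k n (adjoint_map n \<Phi>)) / real k \<le>
        real n * (x + diamond_norm n ?\<Psi> - ?l) / (2 * x)"
    proof (intro exI[of _ 1] allI impI)
      fix k :: nat assume k: "1 \<le> k"
      have "real (nu_m k n (adjoint_map n \<Phi>)) \<le> real k * real n * (x + diamond_norm n ?\<Psi> - ?l) / (2 * x)"
      proof (cases "nu_m k n (adjoint_map n \<Phi>) = 0")
        case True
        then show ?thesis using diamond_norm_scaled_diff_ge[OF n \<Phi> hp, of x] x by simp
      next
        case False
        then show ?thesis using bounds(2)[OF k good_dim_nu_m] by simp
      qed
      then show "real (nu_m k n (adjoint_map n \<Phi>)) / real k \<le>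
          real n * (x + diamond_norm n ?\<Psi> - ?l) / (2 * x)"
        using k by (simp add: divide_le_eq mult_ac)
    qed
  qed
  ultimately show ?thesis unfolding dist by blast
qed

end
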